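(* Let $M$ be a 4-dimensional manifold with a half-flat Cayley structure satisfying $a_6=0$, so that the Pfaffian system $I_{\mathsf{cong}}=\{\omega^2,\omega^3\}$ is integrable and defines a foliation of $M$ by null surfaces. Then the path geometry $(S_{\mathsf{null}},\ell_1,\ell_2)$ induced on the 3-folds $S_{\mathsf{null}}$ locally arises from a projective structure on the integral surfaces of $I_{\mathsf{cong}}$.
   Context: All considerations are local. A Cayley structure on $M$ is the conformal class of a cubic form that locally can be written $\rho=\frac13(\omega^2)^3+\omega^0\omega^3\omega^3-\omega^1\omega^2\omega^3$ for a coframe $(\omega^0,\dots,\omega^3)$ on $M$ (an adapted coframe). The null cone at $x$ is ruled by the 2-planes $\ker\{\omega^0+u\omega^1-\frac13u^3\omega^3,\ \omega^2+u\omega^3\}$, $u\in\mathbb R\cup\{\infty\}$. Half-flatness: there is a 3-parameter family of surfaces in $M$ such that for each $x\in M$ and each ruling plane at $x$ a unique member of the family passes through $x$ tangent to that plane. Let $\mathcal P\to M$ be the 8-dimensional bundle of adapted coframes with tautological forms $\omega^0,\dots,\omega^3$. For half-flat structures there are 1-forms $\theta^1,\theta^2,\phi_0,\phi_1$ completing them to a coframe of $\mathcal P$, fixed by $$\begin{aligned} \mathrm d\omega^0&=-\phi_0\wedge\omega^0-\theta^2\wedge\omega^1-\theta^1\wedge\omega^2,\\ \mathrm d\omega^1&=-(\phi_0+\phi_1)\wedge\omega^1-\theta^2\wedge\omega^2-\theta^1\wedge\omega^3,\\ \mathrm d\omega^2&=-(\phi_0+2\phi_1)\wedge\omega^2-\theta^2\wedge\omega^3+c\,a_6\,\omega^0\wedge\omega^1+a_2\,\omega^0\wedge\omega^3,\\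 \mathrm d\omega^3&=-(\phi_0+3\phi_1)\wedge\omega^3+a_6\omega^0\wedge\omega^2+a_4\omega^0\wedge\omega^3+a_5\omega^1\wedge\omega^2+a_3\omega^1\wedge\omega^3+a_1\omega^2\wedge\omega^3, \end{aligned}$$ with $c=2$ or $c=\frac32$, for functions $a_1,\dots,a_6$ on $\mathcal P$; half-flatness is the integrability of $\{\omega^0,\omega^2,\theta^2\}$. The distribution $\ker\{\omega^2,\omega^3\}$ on $M$ does not depend on the choice of adapted coframe and is null for $\rho$; it is integrable when $a_6=0$. The leaves of $I_{\mathsf{cong}}$ in $\mathcal P$ are 6-dimensional and project to the null surfaces in $M$. On such a 6-dimensional leaf the system $\{\omega^0,\omega^1,\theta^2\}$ is integrable; $S_{\mathsf{null}}$ denotes its 3-dimensional leaf space, with line fields $\ell_1=\{\omega^0,\theta^2\}^\perp$ and $\ell_2=\{\omega^0,\omega^1\}^\perp$. A 2-dimensional path geometry $(S,\ell_1,\ell_2)$ is a 3-manifold with two transverse line fields spanning a contact distribution; locally $S$ is an open subset of $\mathbb PTQ$, where $Q$ is the leaf space of $\ell_2$, and the leaves of $\ell_1$ project to paths in $Q$. It arises from a projective structure on $Q$ if these paths are the unparametrized geodesics of a linear connection on $Q$. Here $Q$ is an integral surface of $I_{\mathsf{cong}}$ in $M$. *)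

theory Defs
  imports "HOL-Analysis.Analysis"
begin

text \<open>
  All considerations being local, manifolds are represented by open subsets of Euclidean spaces
  (coordinate domains), and submanifolds by smooth embeddings of such subsets.
\<close>

abbreviation Diff :: "('a::real_normed_vector \<Rightarrow> 'b::real_normed_vector) \<Rightarrow> 'a \<Rightarrow> 'a \<Rightarrow> 'b" where
  "Diff f x \<equiv> frechet_derivative f (at x)"

primrec times_differentiable_on ::
  "nat \<Rightarrow> 'a::real_normed_vector set \<Rightarrow> ('a \<Rightarrow> 'b::real_normed_vector) \<Rightarrow> bool" where
  "times_differentiable_on 0 S f \<longleftrightarrow> continuous_on S f"
| "times_differentiable_on (Suc k) S f \<longleftrightarrow>
     (\<forall>x\<in>S. f differentiable (at x)) \<and> (\<forall>v. times_differentiable_on k S (\<lambda>x. Diff f x v))"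

text \<open>The derivatives are full (two-sided) ones, so this is meant for open sets only.\<close>

definition smooth_on :: "'a::real_normed_vector set \<Rightarrow> ('a \<Rightarrow> 'b::real_normed_vector) \<Rightarrow> bool" where
  "smooth_on S f \<longleftrightarrow> (\<forall>k. times_differentiable_on k S f)"

definition smooth_embedding_on :: "'a::euclidean_space set \<Rightarrow> ('a \<Rightarrow> 'b::euclidean_space) \<Rightarrow> bool" where
  "smooth_embedding_on U f \<longleftrightarrow>
     open U \<and> smooth_on U f \<and> (\<forall>x\<in>U. inj (Diff f x)) \<and> (\<exists>g. homeomorphism U (f ` U) f g)"


section \<open>Differential forms, distributions and leaf spaces\<close>

text \<open>A differential 1-form maps a point and a tangent vector to a number.\<close>

type_synonym 'a form1 = "'a \<Rightarrow> 'a \<Rightarrow> real"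

definition form1_on :: "'a::euclidean_space set \<Rightarrow> 'a form1 \<Rightarrow> bool" where
  "form1_on U \<alpha> \<longleftrightarrow> (\<forall>x\<in>U. linear (\<alpha> x)) \<and> (\<forall>v. smooth_on U (\<lambda>x. \<alpha> x v))"

definition ext_d :: "'a::euclidean_space form1 \<Rightarrow> 'a \<Rightarrow> 'a \<Rightarrow> 'a \<Rightarrow> real" where
  "ext_d \<alpha> x u v = Diff (\<lambda>y. \<alpha> y v) x u - Diff (\<lambda>y. \<alpha> y u) x v"

definition wedge :: "'a form1 \<Rightarrow> 'a form1 \<Rightarrow> 'a \<Rightarrow> 'a \<Rightarrow> 'a \<Rightarrow> real" where
  "wedge \<alpha> \<beta> x u v = \<alpha> x u * \<beta> x v - \<alpha> x v * \<beta> x u"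

definition pullback :: "('a::euclidean_space \<Rightarrow> 'b::euclidean_space) \<Rightarrow> 'b form1 \<Rightarrow> 'a form1" where
  "pullback f \<alpha> x v = \<alpha> (f x) (Diff f x v)"

definition annihilator :: "'a form1 set \<Rightarrow> 'a \<Rightarrow> 'a set" where
  "annihilator I x = {v. \<forall>\<alpha>\<in>I. \<alpha> x v = 0}"

text \<open>Integrability of the Pfaffian system \<open>I\<close> (which is to have constant rank):
  \<open>d\<alpha>\<close> lies in the ideal generated by \<open>I\<close> for each \<open>\<alpha>\<close> in \<open>I\<close>.\<close>

definition pfaffian_integrable :: "'a::euclidean_space set \<Rightarrow> 'a form1 set \<Rightarrow> bool" where
  "pfaffian_integrable U I \<longleftrightarrow>
     (\<forall>\<alpha>\<in>I. \<forall>x\<in>U. \<forall>u\<in>annihilator I x. \<forall>v\<in>annihilator I x. ext_d \<alpha> x u v = 0)"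

text \<open>\<open>q : W \<rightarrow> S\<close> presents \<open>S\<close> as the leaf space of the distribution \<open>K\<close> on \<open>W\<close>: the fibres are
  the leaves of \<open>K\<close>.\<close>

definition leaf_space ::
  "'a::euclidean_space set \<Rightarrow> ('a \<Rightarrow> 'a set) \<Rightarrow> ('a \<Rightarrow> 'b::euclidean_space) \<Rightarrow> 'b set \<Rightarrow> bool" where
  "leaf_space W K q S \<longleftrightarrow>
     open W \<and> open S \<and> smooth_on W q \<and> q ` W = S \<and>
     (\<forall>w\<in>W. surj (Diff q w) \<and> {v. Diff q w v = 0} = K w) \<and>
     (\<forall>s\<in>S. connected {w \<in> W. q w = s})"

text \<open>The field of subspaces induced on the leaf space by the distribution \<open>L\<close> on \<open>W\<close>. It is only
  meaningful if \<open>Diff q w ` L w\<close> is the same for all \<open>w\<close> in a fibre of \<open>q\<close>; otherwise the union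
  below fails to be a subspace of the expected dimension.\<close>

definition push_distribution ::
  "'a::euclidean_space set \<Rightarrow> ('a \<Rightarrow> 'b::euclidean_space) \<Rightarrow> ('a \<Rightarrow> 'a set) \<Rightarrow> 'b \<Rightarrow> 'b set" where
  "push_distribution W q L s = (\<Union>w\<in>{w \<in> W. q w = s}. Diff q w ` L w)"


section \<open>Cayley structures\<close>

text \<open>The elements of the index type of \<^typ>\<open>real^4\<close> are \<open>0, 1, 2, 3\<close>. A coframe at a point is an
  invertible matrix \<open>A\<close>, with \<open>\<omega>\<^sup>i(v) = (A *v v) $ i\<close>.\<close>

definition cayley_cubic :: "real^4 \<Rightarrow> real" where
  "cayley_cubic w = 1/3 * (w $ 2)^3 + w $ 0 * w $ 3 * w $ 3 - w $ 1 * w $ 2 * w $ 3"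

text \<open>\<open>\<rho>\<close> is a representative of the conformal class; everything below depends on \<open>\<rho>\<close> only up to
  multiplication by a nowhere vanishing function.\<close>

definition cayley_structure :: "(real^4) set \<Rightarrow> (real^4 \<Rightarrow> real^4 \<Rightarrow> real) \<Rightarrow> bool" where
  "cayley_structure M \<rho> \<longleftrightarrow> open M \<and>
     (\<forall>x\<in>M. \<exists>V (\<eta> :: real^4 \<Rightarrow> real^4^4). open V \<and> x \<in> V \<and> V \<subseteq> M \<and> smooth_on V \<eta> \<and>
        (\<forall>y\<in>V. invertible (\<eta> y) \<and> (\<forall>v. \<rho> y v = cayley_cubic (\<eta> y *v v))))"

definition adapted_coframe :: "(real^4 \<Rightarrow> real^4 \<Rightarrow> real) \<Rightarrow> real^4 \<Rightarrow> real^4^4 \<Rightarrow> bool" where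
  "adapted_coframe \<rho> x A \<longleftrightarrow>
     invertible A \<and> (\<exists>r. r \<noteq> 0 \<and> (\<forall>v. cayley_cubic (A *v v) = r * \<rho> x v))"

definition adapted_bundle ::
  "(real^4) set \<Rightarrow> (real^4 \<Rightarrow> real^4 \<Rightarrow> real) \<Rightarrow> ((real^4) \<times> (real^4^4)) set" where
  "adapted_bundle M \<rho> = {(x, A). x \<in> M \<and> adapted_coframe \<rho> x A}"

text \<open>Local parametrizations of the 8-dimensional bundle of adapted coframes, and the
  tautological forms in such a parametrization.\<close>

definition bundle_chart ::
  "(real^4) set \<Rightarrow> (real^4 \<Rightarrow> real^4 \<Rightarrow> real) \<Rightarrow> (real^8) set \<Rightarrow>
   (real^8 \<Rightarrow> (real^4) \<times> (real^4^4)) \<Rightarrow> bool" where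
  "bundle_chart M \<rho> U \<Psi> \<longleftrightarrow>
     smooth_embedding_on U \<Psi> \<and> openin (top_of_set (adapted_bundle M \<rho>)) (\<Psi> ` U)"

definition taut_form :: "(real^8 \<Rightarrow> (real^4) \<times> (real^4^4)) \<Rightarrow> 4 \<Rightarrow> (real^8) form1" where
  "taut_form \<Psi> i p v = (snd (\<Psi> p) *v Diff (\<lambda>p. fst (\<Psi> p)) p v) $ i"

text \<open>For \<open>u \<rightarrow> \<infinity>\<close> the planes \<open>ker {\<omega>\<^sup>0 + u\<omega>\<^sup>1 - u\<^sup>3\<omega>\<^sup>3/3, \<omega>\<^sup>2 + u\<omega>\<^sup>3}\<close> tend to \<open>ker {\<omega>\<^sup>2, \<omega>\<^sup>3}\<close>. The
  parameter \<open>u = \<infinity>\<close> is encoded by \<^term>\<open>None\<close>.\<close>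

definition ruling_plane :: "real^4^4 \<Rightarrow> real option \<Rightarrow> (real^4) set" where
  "ruling_plane A k = (case k of
       Some u \<Rightarrow> {v. (A *v v) $ 0 + u * (A *v v) $ 1 - 1/3 * u^3 * (A *v v) $ 3 = 0 \<and>
                     (A *v v) $ 2 + u * (A *v v) $ 3 = 0}
     | None \<Rightarrow> {v. (A *v v) $ 2 = 0 \<and> (A *v v) $ 3 = 0})"

definition ruling_planes :: "(real^4 \<Rightarrow> real^4 \<Rightarrow> real) \<Rightarrow> real^4 \<Rightarrow> (real^4) set set" where
  "ruling_planes \<rho> x = {ruling_plane A k | A k. adapted_coframe \<rho> x A}"

definition tangent_plane :: "(real^4) set \<Rightarrow> real^4 \<Rightarrow> (real^4) set" where
  "tangent_plane \<Sigma> x =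
     {v. \<exists>(B :: (real^2) set) f b. smooth_embedding_on B f \<and> openin (top_of_set \<Sigma>) (f ` B) \<and>
           b \<in> B \<and> f b = x \<and> v \<in> range (Diff f b)}"

text \<open>Smooth 3-parameter families of surfaces: near each point of each member the family is
  parametrized by a smooth \<open>F(t,b)\<close>, different parameters \<open>t\<close> giving different members. By the last
  condition the surfaces effectively move in every direction of the parameter space.\<close>

definition surface_family :: "(real^4) set set \<Rightarrow> bool" where
  "surface_family \<F> \<longleftrightarrow>
     (\<forall>\<Sigma>\<in>\<F>. \<forall>x\<in>\<Sigma>. \<exists>(T :: (real^3) set) (B :: (real^2) set) F m t\<^sub>0 b\<^sub>0.
        open T \<and> open B \<and> t\<^sub>0 \<in> T \<and> b\<^sub>0 \<in> B \<and> smooth_on (T \<times> B) F \<and>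
        inj_on m T \<and> m ` T \<subseteq> \<F> \<and> m t\<^sub>0 = \<Sigma> \<and> F (t\<^sub>0, b\<^sub>0) = x \<and>
        (\<forall>t\<in>T. smooth_embedding_on B (\<lambda>b. F (t, b)) \<and>
               openin (top_of_set (m t)) ((\<lambda>b. F (t, b)) ` B) \<and>
               (\<forall>s. s \<noteq> 0 \<longrightarrow>
                  (\<exists>b\<in>B. Diff F (t, b) (s, 0) \<notin> range (Diff (\<lambda>b. F (t, b)) b)))))"

definition half_flat :: "(real^4) set \<Rightarrow> (real^4 \<Rightarrow> real^4 \<Rightarrow> real) \<Rightarrow> bool" where
  "half_flat M \<rho> \<longleftrightarrow>
     (\<forall>x\<^sub>0\<in>M. \<exists>M' \<F>. open M' \<and> x\<^sub>0 \<in> M' \<and> M' \<subseteq> M \<and> surface_family \<F> \<and> (\<forall>\<Sigma>\<in>\<F>. \<Sigma> \<subseteq> M') \<and>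
        (\<forall>x\<in>M'. \<forall>L\<in>ruling_planes \<rho> x. \<exists>!\<Sigma>. \<Sigma> \<in> \<F> \<and> x \<in> \<Sigma> \<and> tangent_plane \<Sigma> x = L))"

text \<open>The completion of the tautological forms \<open>\<omega>\<close> to a coframe; \<open>a i\<close> is the function \<open>a\<^sub>i\<close>.\<close>

definition structure_coframe ::
  "(real^8) set \<Rightarrow> (4 \<Rightarrow> (real^8) form1) \<Rightarrow> real \<Rightarrow>
   (real^8) form1 \<Rightarrow> (real^8) form1 \<Rightarrow> (real^8) form1 \<Rightarrow> (real^8) form1 \<Rightarrow>
   (nat \<Rightarrow> real^8 \<Rightarrow> real) \<Rightarrow> bool" where
  "structure_coframe U \<omega> c \<theta>\<^sub>1 \<theta>\<^sub>2 \<phi>\<^sub>0 \<phi>\<^sub>1 a \<longleftrightarrow>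
     (\<forall>\<alpha>\<in>{\<theta>\<^sub>1, \<theta>\<^sub>2, \<phi>\<^sub>0, \<phi>\<^sub>1}. form1_on U \<alpha>) \<and>
     (\<forall>i\<in>{1..6}. smooth_on U (a i)) \<and>
     (\<forall>p\<in>U. annihilator {\<omega> 0, \<omega> 1, \<omega> 2, \<omega> 3, \<theta>\<^sub>1, \<theta>\<^sub>2, \<phi>\<^sub>0, \<phi>\<^sub>1} p = {0}) \<and>
     (\<forall>p\<in>U. \<forall>X Y.
        ext_d (\<omega> 0) p X Y =
          - wedge \<phi>\<^sub>0 (\<omega> 0) p X Y - wedge \<theta>\<^sub>2 (\<omega> 1) p X Y - wedge \<theta>\<^sub>1 (\<omega> 2) p X Y \<and>
        ext_d (\<omega> 1) p X Y =
          - (wedge \<phi>\<^sub>0 (\<omega> 1) p X Y + wedge \<phi>\<^sub>1 (\<omega> 1) p X Y)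
          - wedge \<theta>\<^sub>2 (\<omega> 2) p X Y - wedge \<theta>\<^sub>1 (\<omega> 3) p X Y \<and>
        ext_d (\<omega> 2) p X Y =
          - (wedge \<phi>\<^sub>0 (\<omega> 2) p X Y + 2 * wedge \<phi>\<^sub>1 (\<omega> 2) p X Y)
          - wedge \<theta>\<^sub>2 (\<omega> 3) p X Y
          + c * a 6 p * wedge (\<omega> 0) (\<omega> 1) p X Y + a 2 p * wedge (\<omega> 0) (\<omega> 3) p X Y \<and>
        ext_d (\<omega> 3) p X Y =
          - (wedge \<phi>\<^sub>0 (\<omega> 3) p X Y + 3 * wedge \<phi>\<^sub>1 (\<omega> 3) p X Y)
          + a 6 p * wedge (\<omega> 0) (\<omega> 2) p X Y + a 4 p * wedge (\<omega> 0) (\<omega> 3) p X Y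
          + a 5 p * wedge (\<omega> 1) (\<omega> 2) p X Y + a 3 p * wedge (\<omega> 1) (\<omega> 3) p X Y
          + a 1 p * wedge (\<omega> 2) (\<omega> 3) p X Y)"


section \<open>The null surfaces and the leaves over them\<close>

text \<open>\<open>ker {\<omega>\<^sup>2, \<omega>\<^sup>3}\<close> is the same for all adapted coframes at \<open>x\<close>.\<close>

definition cong_plane :: "(real^4 \<Rightarrow> real^4 \<Rightarrow> real) \<Rightarrow> real^4 \<Rightarrow> (real^4) set" where
  "cong_plane \<rho> x = {v. \<forall>A. adapted_coframe \<rho> x A \<longrightarrow> (A *v v) $ 2 = 0 \<and> (A *v v) $ 3 = 0}"

definition cong_surface ::
  "(real^4) set \<Rightarrow> (real^4 \<Rightarrow> real^4 \<Rightarrow> real) \<Rightarrow> (real^2) set \<Rightarrow> (real^2 \<Rightarrow> real^4) \<Rightarrow> bool" where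
  "cong_surface M \<rho> Q \<sigma> \<longleftrightarrow>
     smooth_embedding_on Q \<sigma> \<and> \<sigma> ` Q \<subseteq> M \<and> (\<forall>b\<in>Q. range (Diff \<sigma> b) = cong_plane \<rho> (\<sigma> b))"

text \<open>Parametrizations of (open parts of) the 6-dimensional leaves of \<open>{\<omega>\<^sup>2, \<omega>\<^sup>3}\<close> in the bundle.\<close>

definition cong_leaf ::
  "(real^8) set \<Rightarrow> (4 \<Rightarrow> (real^8) form1) \<Rightarrow> (real^6) set \<Rightarrow> (real^6 \<Rightarrow> real^8) \<Rightarrow> bool" where
  "cong_leaf U \<omega> W \<psi> \<longleftrightarrow>
     smooth_embedding_on W \<psi> \<and> \<psi> ` W \<subseteq> U \<and>
     (\<forall>w\<in>W. range (Diff \<psi> w) = annihilator {\<omega> 2, \<omega> 3} (\<psi> w))"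


section \<open>Path geometries and projective structures\<close>

definition lie_bracket ::
  "('a::real_normed_vector \<Rightarrow> 'a) \<Rightarrow> ('a \<Rightarrow> 'a) \<Rightarrow> 'a \<Rightarrow> 'a" where
  "lie_bracket X Y p = Diff Y p (X p) - Diff X p (Y p)"

text \<open>In dimension 3, \<open>X\<^sub>1, X\<^sub>2, [X\<^sub>1,X\<^sub>2]\<close> spanning means that \<open>\<langle>X\<^sub>1\<rangle>, \<langle>X\<^sub>2\<rangle>\<close> are transverse line
  fields and span a contact distribution.\<close>

definition path_geometry ::
  "(real^3) set \<Rightarrow> (real^3 \<Rightarrow> (real^3) set) \<Rightarrow> (real^3 \<Rightarrow> (real^3) set) \<Rightarrow> bool" where
  "path_geometry S l\<^sub>1 l\<^sub>2 \<longleftrightarrow> open S \<and>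
     (\<forall>s\<in>S. \<exists>V X\<^sub>1 X\<^sub>2. open V \<and> s \<in> V \<and> V \<subseteq> S \<and> smooth_on V X\<^sub>1 \<and> smooth_on V X\<^sub>2 \<and>
        (\<forall>y\<in>V. l\<^sub>1 y = span {X\<^sub>1 y} \<and> l\<^sub>2 y = span {X\<^sub>2 y} \<and>
               span {X\<^sub>1 y, X\<^sub>2 y, lie_bracket X\<^sub>1 X\<^sub>2 y} = UNIV))"

text \<open>A linear connection on a plane domain, \<open>\<nabla>\<^sub>X Y = DY(X) + \<Gamma>(X, Y)\<close>.\<close>

definition linear_connection_on :: "(real^2) set \<Rightarrow> (real^2 \<Rightarrow> real^2 \<Rightarrow> real^2 \<Rightarrow> real^2) \<Rightarrow> bool" where
  "linear_connection_on Q \<Gamma> \<longleftrightarrow>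
     (\<forall>x\<in>Q. bilinear (\<Gamma> x)) \<and> (\<forall>u v. smooth_on Q (\<lambda>x. \<Gamma> x u v))"

abbreviation velocity :: "(real \<Rightarrow> 'a::real_normed_vector) \<Rightarrow> real \<Rightarrow> 'a" where
  "velocity \<gamma> t \<equiv> vector_derivative \<gamma> (at t)"

definition unparametrized_geodesic ::
  "(real^2 \<Rightarrow> real^2 \<Rightarrow> real^2 \<Rightarrow> real^2) \<Rightarrow> real set \<Rightarrow> (real \<Rightarrow> real^2) \<Rightarrow> bool" where
  "unparametrized_geodesic \<Gamma> I \<gamma> \<longleftrightarrow>
     (\<forall>t\<in>I. velocity \<gamma> t \<noteq> 0 \<and>
        (\<exists>k. velocity (velocity \<gamma>) t + \<Gamma> (\<gamma> t) (velocity \<gamma> t) (velocity \<gamma> t) = k *\<^sub>R velocity \<gamma> t))"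

text \<open>The path geometry \<open>(S, l\<^sub>1, l\<^sub>2)\<close> comes from the projective structure of \<open>\<Gamma>\<close> on the leaf space
  \<open>Q\<close> of \<open>l\<^sub>2\<close>, with quotient map \<open>\<pi>\<close>. By the third condition \<open>s \<mapsto> (\<pi> s, D\<pi>(l\<^sub>1(s)))\<close> identifies
  \<open>S\<close> with a subset of \<open>\<P>TQ\<close>. In the last one, \<open>\<gamma>\<close> is the canonical lift to this subset of the
  regular curve \<open>\<pi> \<circ> \<gamma>\<close> in \<open>Q\<close>; the curve is a path iff \<open>\<gamma>\<close> runs in a leaf of \<open>l\<^sub>1\<close>.\<close>

definition projective_path_geometry ::
  "(real^3) set \<Rightarrow> (real^3 \<Rightarrow> (real^3) set) \<Rightarrow> (real^3 \<Rightarrow> (real^3) set) \<Rightarrow>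
   (real^3 \<Rightarrow> real^2) \<Rightarrow> (real^2) set \<Rightarrow> (real^2 \<Rightarrow> real^2 \<Rightarrow> real^2 \<Rightarrow> real^2) \<Rightarrow> bool" where
  "projective_path_geometry S l\<^sub>1 l\<^sub>2 \<pi> Q \<Gamma> \<longleftrightarrow>
     leaf_space S l\<^sub>2 \<pi> Q \<and> linear_connection_on Q \<Gamma> \<and>
     inj_on (\<lambda>s. (\<pi> s, Diff \<pi> s ` l\<^sub>1 s)) S \<and>
     (\<forall>\<alpha> \<beta> \<gamma>. smooth_on {\<alpha><..<\<beta>} \<gamma> \<and> \<gamma> ` {\<alpha><..<\<beta>} \<subseteq> S \<and>
        (\<forall>t\<in>{\<alpha><..<\<beta>}. velocity (\<pi> \<circ> \<gamma>) t \<noteq> 0 \<and>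
                        velocity (\<pi> \<circ> \<gamma>) t \<in> Diff \<pi> (\<gamma> t) ` l\<^sub>1 (\<gamma> t)) \<longrightarrow>
        (unparametrized_geodesic \<Gamma> {\<alpha><..<\<beta>} (\<pi> \<circ> \<gamma>) \<longleftrightarrow>
           (\<forall>t\<in>{\<alpha><..<\<beta>}. velocity \<gamma> t \<in> l\<^sub>1 (\<gamma> t))))"

end

theory Submission
  imports Defs
begin

text \<open>
  On the leaves of \<open>{\<omega>\<^sup>2, \<omega>\<^sup>3}\<close> the equations \<open>d(d\<omega>\<^sup>2) = d(d\<omega>\<^sup>3) = 0\<close> determine the exterior derivatives of
  \<open>\<phi>\<^sub>0\<close>, \<open>\<phi>\<^sub>1\<close>, \<open>\<theta>\<^sup>2\<close> and the vertical derivative of \<open>a\<^sub>5\<close>. It turns out that these forms can be corrected by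
  multiples of \<open>\<omega>\<^sup>0\<close>, \<open>\<omega>\<^sup>1\<close> to a matrix of 1-forms whose curvature is semibasic over the null surface. Such a
  matrix is the pull-back of a linear connection on the null surface, written in the moving coframe
  \<open>(\<omega>\<^sup>0, \<omega>\<^sup>1)\<close>. A curve with \<open>\<omega>\<^sup>0 = 0\<close> is a geodesic of this connection iff \<open>\<theta>\<^sup>2 = 0\<close> along its lift, and these
  are the paths.
\<close>

section \<open>Smooth functions\<close>

text \<open>The corrections are forced. On a leaf, modulo multiples of w0 \<and> w1, the identities
  d(d\<omega>) = 0 yield, with \<beta> = a4 w0 + a3 w1 and \<tau> = a5 \<theta>2 \<and> w1, d\<phi>0
  = 5 \<tau> - 2 d\<beta>, d(\<phi>0 + \<phi>1) = 3 \<tau> - d\<beta>, and da5 = a5 \<phi>0 modulo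
  w0, w1, so that d(a5 w0) = -\<tau>. Hence
  \<open>(\<phi>0, \<theta>2; 0, \<phi>0 + \<phi>1)\<close> has the right torsion, but its curvature
  sees the fibres. Adding 2\<beta> and \<beta> to the diagonal entries removes d\<beta>, and
  subtracting a2 w0 from \<theta>2 removes da2. The curvature entry of \<theta>2 then allows only
  equal further multiples x a5 w0 on the diagonal. What is left of \<tau> there has to be absorbed
  by a lower left entry y a5 w1: the two diagonal entries require 5 - x = -y and 3 - x = y, so x = 4
  and y = -1. These are the constants of \<open>\<psi>0\<close>, \<open>\<psi>1\<close> and
  \<open>\<kappa>\<close>. Since all corrections are multiples of w0 and w1, they leave the
  equations for dw0 and dw1 unchanged when one argument is tangent to the fibres w0 = w1 =
  0.\<close>

lemma Diff_eq: "(f has_derivative f') (at x) \<Longrightarrow> Diff f x = f'"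
  by (rule frechet_derivative_at[symmetric])

lemma Diff_works: "f differentiable at x \<Longrightarrow> (f has_derivative Diff f x) (at x)"
  using frechet_derivative_works by blast

lemma Diff_cong_open:
  assumes "open S" "x \<in> S" "\<And>y. y \<in> S \<Longrightarrow> f y = g y"
  shows "Diff f x = Diff g x"
proof -
  have "(f has_derivative f') (at x) \<longleftrightarrow> (g has_derivative f') (at x)" for f'
    using has_derivative_transform_within_open[OF _ assms(1,2)] assms(3) by metis
  then show ?thesis by (simp add: frechet_derivative_def)
qed

lemma differentiable_cong_open:
  assumes "open S" "x \<in> S" "\<And>y. y \<in> S \<Longrightarrow> f y = g y" "f differentiable at x"
  shows "g differentiable at x"
  using has_derivative_transform_within_open[OF _ assms(1,2)] assms(3,4)
  by (metis differentiable_def)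

section \<open>Calculus of k times differentiable maps\<close>

lemma times_differentiable_on_cong:
  assumes "open S" "\<And>x. x \<in> S \<Longrightarrow> f x = g x" "times_differentiable_on k S f"
  shows "times_differentiable_on k S g"
  using assms(2,3)
proof (induction k arbitrary: f g)
  case 0
  then show ?case by (simp cong: continuous_on_cong)
next
  case (Suc k)
  have "g differentiable at x" if "x \<in> S" for x
    using differentiable_cong_open[OF assms(1) that, of f g] Suc.prems that by simp
  moreover have "times_differentiable_on k S (\<lambda>x. Diff g x v)" for v
    by (rule Suc.IH[of "\<lambda>x. Diff f x v"]) (use Suc.prems Diff_cong_open[OF assms(1), of _ f g] in auto)
  ultimately show ?case by simp
qed

text \<open>The induction rule for all closure properties below: on an open set a derivative
  \<open>f'\<close> computed pointwise by the usual rules may stand in for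
  \<open>Diff f\<close>.\<close>

lemma times_differentiable_on_SucI:
  assumes "open S" "\<And>x. x \<in> S \<Longrightarrow> (f has_derivative f' x) (at x)"
    and "\<And>v. times_differentiable_on k S (\<lambda>x. f' x v)"
  shows "times_differentiable_on (Suc k) S f"
proof -
  have "times_differentiable_on k S (\<lambda>x. Diff f x v)" for v
    by (rule times_differentiable_on_cong[OF assms(1) _ assms(3)]) (simp add: Diff_eq[OF assms(2)])
  then show ?thesis
    using assms(2) by (auto simp: differentiable_def)
qed

lemma times_differentiable_on_imp_continuous_on:
  "times_differentiable_on k S f \<Longrightarrow> continuous_on S f"
  by (cases k) (auto intro!: continuous_at_imp_continuous_on differentiable_imp_continuous_within)

lemma times_differentiable_on_SucD: "times_differentiable_on (Suc k) S f \<Longrightarrow> times_differentiable_on k S f"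
proof (induction k arbitrary: f)
  case 0
  then show ?case using times_differentiable_on_imp_continuous_on[OF 0] by simp
next
  case (Suc k)
  then show ?case by (metis times_differentiable_on.simps(2))
qed

lemma times_differentiable_on_subset:
  "times_differentiable_on k S f \<Longrightarrow> T \<subseteq> S \<Longrightarrow> times_differentiable_on k T f"
  by (induction k arbitrary: f) (auto intro: continuous_on_subset)

lemma times_differentiable_on_const: "open S \<Longrightarrow> times_differentiable_on k S (\<lambda>x. c)"
proof (induction k arbitrary: c)
  case (Suc k)
  then show ?case by (intro times_differentiable_on_SucI[where f' = "\<lambda>x v. 0"]) auto
qed simp

lemma times_differentiable_on_bounded_linear:
  assumes "open S" "bounded_linear L"
  shows "times_differentiable_on k S L"
proof (cases k)
  case 0
  then show ?thesis using assms by (simp add: linear_continuous_on)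
next
  case (Suc j)
  then show ?thesis
    using times_differentiable_on_SucI[OF assms(1), of L "\<lambda>x. L" j]
      bounded_linear_imp_has_derivative[OF assms(2)] times_differentiable_on_const[OF assms(1)] by blast
qed

lemma times_differentiable_on_add:
  assumes "open S"
  shows "times_differentiable_on k S f \<Longrightarrow> times_differentiable_on k S g \<Longrightarrow>
    times_differentiable_on k S (\<lambda>x. f x + g x)"
proof (induction k arbitrary: f g)
  case 0
  then show ?case by (simp add: continuous_on_add)
next
  case (Suc k)
  show ?case
    by (rule times_differentiable_on_SucI[OF assms, where f' = "\<lambda>x v. Diff f x v + Diff g x v"])
      (use Suc in \<open>auto intro!: has_derivative_add Diff_works\<close>)
qed

lemma times_differentiable_on_sum:
  assumes "open S" "\<And>i. i \<in> I \<Longrightarrow> times_differentiable_on k S (f i)"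
  shows "times_differentiable_on k S (\<lambda>x. \<Sum>i\<in>I. f i x)"
proof (cases "finite I")
  case True
  then show ?thesis using assms(2)
    by (induction I) (auto intro: times_differentiable_on_const times_differentiable_on_add assms(1))
qed (auto intro: times_differentiable_on_const assms(1))

lemma times_differentiable_on_bilinear:
  assumes "open S" "bounded_bilinear B"
  shows "times_differentiable_on k S f \<Longrightarrow> times_differentiable_on k S g \<Longrightarrow>
    times_differentiable_on k S (\<lambda>x. B (f x) (g x))"
proof (induction k arbitrary: f g)
  case 0
  then show ?case by (auto intro!: bounded_bilinear.continuous_on[OF assms(2)])
next
  case (Suc k)
  show ?case
  proof (rule times_differentiable_on_SucI[OF assms(1), where f' = "\<lambda>x v. B (f x) (Diff g x v) + B (Diff f x v) (g x)"])
    show "((\<lambda>x. B (f x) (g x)) has_derivative (\<lambda>v. B (f x) (Diff g x v) + B (Diff f x v) (g x))) (at x)" if "x \<in> S" for x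
      by (rule bounded_bilinear.FDERIV[OF assms(2)]) (use Suc.prems that in \<open>auto intro: Diff_works\<close>)
    show "times_differentiable_on k S (\<lambda>x. B (f x) (Diff g x v) + B (Diff f x v) (g x))" for v
      by (rule times_differentiable_on_add[OF assms(1)]; rule Suc.IH)
        (use Suc.prems times_differentiable_on_SucD in auto)
  qed
qed

lemma times_differentiable_on_linear_compose:
  assumes "open S" "bounded_linear L"
  shows "times_differentiable_on k S f \<Longrightarrow> times_differentiable_on k S (\<lambda>x. L (f x))"
proof (induction k arbitrary: f)
  case 0
  then show ?case by (auto intro: bounded_linear.continuous_on[OF assms(2)])
next
  case (Suc k)
  show ?case
    by (rule times_differentiable_on_SucI[OF assms(1), where f' = "\<lambda>x v. L (Diff f x v)"])
      (use Suc in \<open>auto intro!: bounded_linear.has_derivative[OF assms(2)] Diff_works\<close>)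
qed

lemma times_differentiable_on_componentwise:
  fixes f :: "'a::real_normed_vector \<Rightarrow> 'b::euclidean_space"
  assumes "open S"
  shows "times_differentiable_on k S f \<longleftrightarrow> (\<forall>b\<in>Basis. times_differentiable_on k S (\<lambda>x. f x \<bullet> b))"
proof safe
  fix b :: 'b
  assume "times_differentiable_on k S f"
  then show "times_differentiable_on k S (\<lambda>x. f x \<bullet> b)"
    by (rule times_differentiable_on_linear_compose[OF assms bounded_linear_inner_left])
next
  assume *: "\<forall>b\<in>Basis. times_differentiable_on k S (\<lambda>x. f x \<bullet> b)"
  have "times_differentiable_on k S (\<lambda>x. \<Sum>b\<in>Basis. (f x \<bullet> b) *\<^sub>R b)"
    using * by (intro times_differentiable_on_sum assms
        times_differentiable_on_linear_compose[OF assms bounded_linear_scaleR_left]) auto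
  then show "times_differentiable_on k S f" by (simp add: euclidean_representation)
qed

lemma Diff_euclidean:
  fixes f :: "'a::euclidean_space \<Rightarrow> 'b::real_normed_vector"
  assumes "f differentiable at x"
  shows "Diff f x v = (\<Sum>b\<in>Basis. (v \<bullet> b) *\<^sub>R Diff f x b)"
proof -
  interpret linear "Diff f x" by (rule linear_frechet_derivative[OF assms])
  have "Diff f x (\<Sum>b\<in>Basis. (v \<bullet> b) *\<^sub>R b) = (\<Sum>b\<in>Basis. (v \<bullet> b) *\<^sub>R Diff f x b)"
    by (simp add: sum scaleR)
  then show ?thesis by (simp add: euclidean_representation)
qed

text \<open>The chain rule evaluates the derivative of \<open>g\<close> in the direction
  \<open>Diff f x v\<close>, which moves with \<open>x\<close>, while the induction hypothesis
  speaks of fixed directions only. Expanding the moving direction in the basis of the middle space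
  reduces the one to the other.\<close>

lemma times_differentiable_on_compose:
  fixes g :: "'b::euclidean_space \<Rightarrow> 'c::real_normed_vector"
  assumes "open S" "open T" "f ` S \<subseteq> T"
  shows "times_differentiable_on k S f \<Longrightarrow> times_differentiable_on k T g \<Longrightarrow>
    times_differentiable_on k S (\<lambda>x. g (f x))"
proof (induction k arbitrary: g)
  case 0
  then show ?case using assms(3) by (auto intro: continuous_on_compose2)
next
  case (Suc k)
  have fT: "f x \<in> T" if "x \<in> S" for x using that assms(3) by auto
  show ?case
  proof (rule times_differentiable_on_SucI[OF assms(1), where f' = "\<lambda>x v. \<Sum>b\<in>Basis. (Diff f x v \<bullet> b) *\<^sub>R Diff g (f x) b"])
    fix x assume x: "x \<in> S"
    have "((\<lambda>x. g (f x)) has_derivative (\<lambda>v. Diff g (f x) (Diff f x v))) (at x)"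
      by (rule has_derivative_compose[OF Diff_works Diff_works]) (use Suc.prems fT x in auto)
    moreover have "(\<lambda>v. Diff g (f x) (Diff f x v)) = (\<lambda>v. \<Sum>b\<in>Basis. (Diff f x v \<bullet> b) *\<^sub>R Diff g (f x) b)"
      by (intro ext Diff_euclidean) (use Suc.prems fT x in auto)
    ultimately show "((\<lambda>x. g (f x)) has_derivative (\<lambda>v. \<Sum>b\<in>Basis. (Diff f x v \<bullet> b) *\<^sub>R Diff g (f x) b)) (at x)"
      by (simp only:)
  next
    fix v
    show "times_differentiable_on k S (\<lambda>x. \<Sum>b\<in>Basis. (Diff f x v \<bullet> b) *\<^sub>R Diff g (f x) b)"
    proof (intro times_differentiable_on_sum assms(1)
        times_differentiable_on_bilinear[OF assms(1) bounded_bilinear_scaleR])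
      fix b :: 'b
      show "times_differentiable_on k S (\<lambda>x. Diff f x v \<bullet> b)"
        using Suc.prems by (intro times_differentiable_on_linear_compose[OF assms(1) bounded_linear_inner_left]) auto
      show "times_differentiable_on k S (\<lambda>x. Diff g (f x) b)"
        using Suc.IH[of "\<lambda>y. Diff g y b"] Suc.prems times_differentiable_on_SucD[OF Suc.prems(1)] by simp
    qed
  qed
qed

text \<open>The derivative of 1/f is a product of 1/f, 1/f and a derivative of f, so each order of
  differentiability of 1/f yields the next.\<close>

lemma times_differentiable_on_inverse:
  fixes f :: "'a::real_normed_vector \<Rightarrow> real"
  assumes "open S" "\<And>x. x \<in> S \<Longrightarrow> f x \<noteq> 0"
  shows "times_differentiable_on k S f \<Longrightarrow> times_differentiable_on k S (\<lambda>x. inverse (f x))"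
proof (induction k)
  case 0
  then show ?case using assms by (simp add: continuous_on_inverse)
next
  case (Suc k)
  show ?case
  proof (rule times_differentiable_on_SucI[OF assms(1), where f' = "\<lambda>x v. - (inverse (f x) * Diff f x v * inverse (f x))"])
    show "((\<lambda>x. inverse (f x)) has_derivative (\<lambda>v. - (inverse (f x) * Diff f x v * inverse (f x)))) (at x)" if "x \<in> S" for x
      by (rule Deriv.has_derivative_inverse) (use assms that Suc.prems in \<open>auto intro: Diff_works\<close>)
    have IH: "times_differentiable_on k S (\<lambda>x. inverse (f x))"
      using Suc times_differentiable_on_SucD by blast
    show "times_differentiable_on k S (\<lambda>x. - (inverse (f x) * Diff f x v * inverse (f x)))" for v
      by (intro times_differentiable_on_linear_compose[OF assms(1) bounded_linear_minus[OF bounded_linear_ident]]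
          times_differentiable_on_bilinear[OF assms(1) bounded_bilinear_mult] IH) (use Suc.prems in auto)
  qed
qed

section \<open>Closure properties of smooth maps\<close>

named_theorems smooth_intros

lemma smooth_on_cong:
  "open S \<Longrightarrow> smooth_on S f \<Longrightarrow> (\<And>x. x \<in> S \<Longrightarrow> f x = g x) \<Longrightarrow> smooth_on S g"
  unfolding smooth_on_def by (blast intro: times_differentiable_on_cong)

lemma smooth_on_subset: "smooth_on S f \<Longrightarrow> T \<subseteq> S \<Longrightarrow> smooth_on T f"
  unfolding smooth_on_def by (blast intro: times_differentiable_on_subset)

lemma smooth_on_differentiable: "smooth_on S f \<Longrightarrow> x \<in> S \<Longrightarrow> f differentiable at x"
  unfolding smooth_on_def by (metis times_differentiable_on.simps(2))

lemma smooth_on_has_derivative: "smooth_on S f \<Longrightarrow> x \<in> S \<Longrightarrow> (f has_derivative Diff f x) (at x)"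
  by (rule Diff_works[OF smooth_on_differentiable])

lemma smooth_on_linear_Diff: "smooth_on S f \<Longrightarrow> x \<in> S \<Longrightarrow> linear (Diff f x)"
  by (rule linear_frechet_derivative[OF smooth_on_differentiable])

lemma smooth_on_continuous_on: "smooth_on S f \<Longrightarrow> continuous_on S f"
  unfolding smooth_on_def by (metis times_differentiable_on.simps(1))

lemma smooth_on_Diff_const: "smooth_on S f \<Longrightarrow> smooth_on S (\<lambda>x. Diff f x v)"
  unfolding smooth_on_def by (metis times_differentiable_on.simps(2))

lemma smooth_on_const [smooth_intros]: "open S \<Longrightarrow> smooth_on S (\<lambda>x. c)"
  by (simp add: smooth_on_def times_differentiable_on_const)

lemma smooth_on_bounded_linear: "open S \<Longrightarrow> bounded_linear L \<Longrightarrow> smooth_on S L"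
  by (simp add: smooth_on_def times_differentiable_on_bounded_linear)

lemma smooth_on_linear:
  fixes L :: "'a::euclidean_space \<Rightarrow> 'b::real_normed_vector"
  shows "open S \<Longrightarrow> linear L \<Longrightarrow> smooth_on S L"
  by (simp add: smooth_on_bounded_linear linear_conv_bounded_linear)

lemma smooth_on_ident [smooth_intros]: "open S \<Longrightarrow> smooth_on S (\<lambda>x. x)"
  by (rule smooth_on_bounded_linear[OF _ bounded_linear_ident])

lemma smooth_on_linear_compose:
  "open S \<Longrightarrow> bounded_linear L \<Longrightarrow> smooth_on S f \<Longrightarrow> smooth_on S (\<lambda>x. L (f x))"
  by (simp add: smooth_on_def times_differentiable_on_linear_compose)

lemma smooth_on_linear_compose':
  fixes f :: "'a::real_normed_vector \<Rightarrow> 'b::euclidean_space"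
  shows "open S \<Longrightarrow> linear L \<Longrightarrow> smooth_on S f \<Longrightarrow> smooth_on S (\<lambda>x. L (f x))"
  by (simp add: linear_conv_bounded_linear smooth_on_linear_compose)

lemma smooth_on_bilinear:
  "open S \<Longrightarrow> bounded_bilinear B \<Longrightarrow> smooth_on S f \<Longrightarrow> smooth_on S g \<Longrightarrow> smooth_on S (\<lambda>x. B (f x) (g x))"
  by (simp add: smooth_on_def times_differentiable_on_bilinear)

lemma smooth_on_add [smooth_intros]:
  "open S \<Longrightarrow> smooth_on S f \<Longrightarrow> smooth_on S g \<Longrightarrow> smooth_on S (\<lambda>x. f x + g x)"
  by (simp add: smooth_on_def times_differentiable_on_add)

lemma smooth_on_minus [smooth_intros]: "open S \<Longrightarrow> smooth_on S f \<Longrightarrow> smooth_on S (\<lambda>x. - f x)"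
  by (rule smooth_on_linear_compose[OF _ bounded_linear_minus[OF bounded_linear_ident]])

lemma smooth_on_diff [smooth_intros]:
  "open S \<Longrightarrow> smooth_on S f \<Longrightarrow> smooth_on S g \<Longrightarrow> smooth_on S (\<lambda>x. f x - g x)"
  using smooth_on_add[OF _ _ smooth_on_minus, of S f g] by simp

lemma smooth_on_mult [smooth_intros]:
  fixes f g :: "'a::real_normed_vector \<Rightarrow> real"
  shows "open S \<Longrightarrow> smooth_on S f \<Longrightarrow> smooth_on S g \<Longrightarrow> smooth_on S (\<lambda>x. f x * g x)"
  by (rule smooth_on_bilinear[OF _ bounded_bilinear_mult])

lemma smooth_on_scaleR [smooth_intros]:
  "open S \<Longrightarrow> smooth_on S f \<Longrightarrow> smooth_on S g \<Longrightarrow> smooth_on S (\<lambda>x. f x *\<^sub>R g x)"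
  by (rule smooth_on_bilinear[OF _ bounded_bilinear_scaleR])

lemma smooth_on_divide:
  fixes f g :: "'a::real_normed_vector \<Rightarrow> real"
  assumes "open S" "smooth_on S f" "smooth_on S g" "\<And>x. x \<in> S \<Longrightarrow> g x \<noteq> 0"
  shows "smooth_on S (\<lambda>x. f x / g x)"
proof -
  have "smooth_on S (\<lambda>x. inverse (g x))"
    using assms(3,4) by (simp add: smooth_on_def times_differentiable_on_inverse[OF assms(1)])
  then show ?thesis
    using smooth_on_mult[OF assms(1,2)] by (simp add: divide_inverse)
qed

lemma smooth_on_sum [smooth_intros]:
  "open S \<Longrightarrow> (\<And>i. i \<in> I \<Longrightarrow> smooth_on S (f i)) \<Longrightarrow> smooth_on S (\<lambda>x. \<Sum>i\<in>I. f i x)"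
  by (simp add: smooth_on_def times_differentiable_on_sum)

lemma smooth_on_prod:
  fixes f :: "'i \<Rightarrow> 'a::real_normed_vector \<Rightarrow> real"
  assumes "open S" "\<And>i. i \<in> I \<Longrightarrow> smooth_on S (f i)"
  shows "smooth_on S (\<lambda>x. \<Prod>i\<in>I. f i x)"
proof (cases "finite I")
  case True
  then show ?thesis using assms(2)
    by (induction I) (auto intro: smooth_on_const smooth_on_mult assms(1))
qed (auto intro: smooth_on_const assms(1))

lemma smooth_on_compose:
  fixes g :: "'b::euclidean_space \<Rightarrow> 'c::real_normed_vector"
  shows "open S \<Longrightarrow> open T \<Longrightarrow> f ` S \<subseteq> T \<Longrightarrow> smooth_on T g \<Longrightarrow> smooth_on S f \<Longrightarrow> smooth_on S (\<lambda>x. g (f x))"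
  by (simp add: smooth_on_def times_differentiable_on_compose)

lemma smooth_on_componentwise:
  fixes f :: "'a::real_normed_vector \<Rightarrow> 'b::euclidean_space"
  shows "open S \<Longrightarrow> smooth_on S f \<longleftrightarrow> (\<forall>b\<in>Basis. smooth_on S (\<lambda>x. f x \<bullet> b))"
  unfolding smooth_on_def by (subst times_differentiable_on_componentwise) auto

lemma smooth_on_vec_nth [smooth_intros]:
  fixes f :: "'a::real_normed_vector \<Rightarrow> 'b::euclidean_space ^ 'n"
  shows "open S \<Longrightarrow> smooth_on S f \<Longrightarrow> smooth_on S (\<lambda>x. f x $ i)"
  by (rule smooth_on_linear_compose[OF _ bounded_linear_vec_nth])

lemma smooth_on_vec_lambda:
  fixes f :: "'n::finite \<Rightarrow> 'a::real_normed_vector \<Rightarrow> real"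
  assumes "open S" "\<And>i. smooth_on S (f i)"
  shows "smooth_on S (\<lambda>x. \<chi> i. f i x)"
  by (subst smooth_on_componentwise[OF assms(1)]) (auto simp: Basis_vec_def inner_axis assms)

lemma smooth_on_Pair [smooth_intros]:
  fixes f :: "'a::real_normed_vector \<Rightarrow> 'b::real_normed_vector" and g :: "'a \<Rightarrow> 'c::real_normed_vector"
  assumes "open S" "smooth_on S f" "smooth_on S g"
  shows "smooth_on S (\<lambda>x. (f x, g x))"
proof -
  have "bounded_linear (\<lambda>y::'b. (y, 0::'c))" "bounded_linear (\<lambda>y::'c. (0::'b, y))"
    by (auto intro!: bounded_linear_Pair bounded_linear_ident bounded_linear_zero)
  from smooth_on_add[OF assms(1) smooth_on_linear_compose[OF assms(1) this(1) assms(2)]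
      smooth_on_linear_compose[OF assms(1) this(2) assms(3)]]
  show ?thesis by simp
qed

lemma smooth_on_fst [smooth_intros]: "open S \<Longrightarrow> smooth_on S f \<Longrightarrow> smooth_on S (\<lambda>x. fst (f x))"
  by (rule smooth_on_linear_compose[OF _ bounded_linear_fst])

lemma smooth_on_snd [smooth_intros]: "open S \<Longrightarrow> smooth_on S f \<Longrightarrow> smooth_on S (\<lambda>x. snd (f x))"
  by (rule smooth_on_linear_compose[OF _ bounded_linear_snd])

lemma Diff_compose:
  assumes "f differentiable at x" "g differentiable at (f x)"
  shows "Diff (\<lambda>x. g (f x)) x v = Diff g (f x) (Diff f x v)"
  using has_derivative_compose[OF Diff_works[OF assms(1)] Diff_works[OF assms(2)]] by (simp add: Diff_eq)

lemma Diff_linear_compose: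
  assumes "bounded_linear L" "f differentiable at x"
  shows "Diff (\<lambda>x. L (f x)) x v = L (Diff f x v)"
  using bounded_linear.has_derivative[OF assms(1) Diff_works[OF assms(2)]] by (simp add: Diff_eq)

section \<open>Symmetry of second derivatives\<close>

text \<open>Two applications of the mean value theorem: first to the increment of \<open>f\<close>
  in direction \<open>v\<close> as a function of the step in direction \<open>u\<close>, then to the
  derivative along \<open>u\<close> as a function of the step in direction \<open>v\<close>.\<close>

lemma second_difference_mean_value:
  fixes f :: "'a::real_normed_vector \<Rightarrow> real"
  assumes "smooth_on S f" "0 < h"
    and S: "\<And>\<sigma> \<tau>. 0 \<le> \<sigma> \<Longrightarrow> \<sigma> \<le> h \<Longrightarrow> 0 \<le> \<tau> \<Longrightarrow> \<tau> \<le> h \<Longrightarrow> x + \<sigma> *\<^sub>R u + \<tau> *\<^sub>R v \<in> S"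
  obtains \<sigma> \<tau> where "0 < \<sigma>" "\<sigma> < h" "0 < \<tau>" "\<tau> < h"
    "f (x + h *\<^sub>R u + h *\<^sub>R v) - f (x + h *\<^sub>R u) - f (x + h *\<^sub>R v) + f x =
     h * h * Diff (\<lambda>y. Diff f y u) (x + \<sigma> *\<^sub>R u + \<tau> *\<^sub>R v) v"
proof -
  have lin: "Diff g y (r *\<^sub>R w) = r *\<^sub>R Diff g y w" if "smooth_on S g" "y \<in> S" for g :: "'a \<Rightarrow> real" and y r w
    by (rule linear_scale[OF smooth_on_linear_Diff[OF that]])
  define \<phi> where "\<phi> \<sigma> = f (x + \<sigma> *\<^sub>R u + h *\<^sub>R v) - f (x + \<sigma> *\<^sub>R u)" for \<sigma>
  define \<phi>' where "\<phi>' \<sigma> = Diff f (x + \<sigma> *\<^sub>R u + h *\<^sub>R v) u - Diff f (x + \<sigma> *\<^sub>R u) u" for \<sigma>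
  have der: "((\<lambda>\<sigma>. g (y + \<sigma> *\<^sub>R w)) has_real_derivative Diff g (y + \<sigma> *\<^sub>R w) w) (at \<sigma>)"
    if "smooth_on S g" "y + \<sigma> *\<^sub>R w \<in> S" for g :: "'a \<Rightarrow> real" and y w \<sigma>
  proof -
    have "((\<lambda>\<sigma>. y + \<sigma> *\<^sub>R w) has_derivative (\<lambda>r. r *\<^sub>R w)) (at \<sigma>)"
      by (auto intro!: derivative_eq_intros)
    from has_derivative_compose[OF this smooth_on_has_derivative[OF that]]
    show ?thesis by (simp add: has_field_derivative_def lin[OF that] mult.commute[of _ "Diff g (y + \<sigma> *\<^sub>R w) w"])
  qed
  have "(\<phi> has_real_derivative \<phi>' \<sigma>) (at \<sigma>)" if "0 \<le> \<sigma>" "\<sigma> \<le> h" for \<sigma>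
    unfolding \<phi>_def \<phi>'_def
    using DERIV_diff[OF der[OF assms(1), of "x + h *\<^sub>R v" \<sigma> u] der[OF assms(1), of x \<sigma> u]]
      S[OF that, of h] S[OF that, of 0] \<open>0 < h\<close> by (simp add: algebra_simps)
  then obtain \<sigma> where \<sigma>: "0 < \<sigma>" "\<sigma> < h" "\<phi> h - \<phi> 0 = (h - 0) * \<phi>' \<sigma>"
    using MVT2[OF \<open>0 < h\<close>, of \<phi> \<phi>'] by blast
  have "((\<lambda>\<tau>. Diff f (x + \<sigma> *\<^sub>R u + \<tau> *\<^sub>R v) u) has_real_derivative
      Diff (\<lambda>y. Diff f y u) (x + \<sigma> *\<^sub>R u + \<tau> *\<^sub>R v) v) (at \<tau>)" if "0 \<le> \<tau>" "\<tau> \<le> h" for \<tau>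
    using der[OF smooth_on_Diff_const[OF assms(1)], of "x + \<sigma> *\<^sub>R u" \<tau> v] S[of \<sigma> \<tau>] \<sigma> that by simp
  then obtain \<tau> where \<tau>: "0 < \<tau>" "\<tau> < h" "\<phi>' \<sigma> = h * Diff (\<lambda>y. Diff f y u) (x + \<sigma> *\<^sub>R u + \<tau> *\<^sub>R v) v"
    using MVT2[OF \<open>0 < h\<close>, of "\<lambda>\<tau>. Diff f (x + \<sigma> *\<^sub>R u + \<tau> *\<^sub>R v) u"
        "\<lambda>\<tau>. Diff (\<lambda>y. Diff f y u) (x + \<sigma> *\<^sub>R u + \<tau> *\<^sub>R v) v"] by (auto simp: \<phi>'_def)
  show thesis
    by (rule that[OF \<sigma>(1,2) \<tau>(1,2)]) (use \<sigma>(3) \<tau>(3) in \<open>simp add: \<phi>_def\<close>)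
qed

text \<open>The second difference of \<open>second_difference_mean_value\<close> is symmetric in
  \<open>u\<close> and \<open>v\<close>, so the two mixed derivatives agree at two points near
  \<open>x\<close>, and continuity carries this to \<open>x\<close>. As \<open>u\<close> and
  \<open>v\<close> are arbitrary, an inequality up to \<open>e\<close> is enough.\<close>

lemma Diff_Diff_commute_real:
  fixes f :: "'a::real_normed_vector \<Rightarrow> real"
  assumes "open S" "smooth_on S f" "x \<in> S"
  shows "Diff (\<lambda>y. Diff f y u) x v = Diff (\<lambda>y. Diff f y v) x u"
proof (rule field_le_epsilon[THEN antisym])
  have main: "Diff (\<lambda>y. Diff f y u) x v \<le> Diff (\<lambda>y. Diff f y v) x u + e" if "0 < e" for u v e
  proof -
    let ?A = "\<lambda>y. Diff (\<lambda>y. Diff f y u) y v" and ?B = "\<lambda>y. Diff (\<lambda>y. Diff f y v) y u"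
    have "continuous_on S ?A" "continuous_on S ?B"
      by (intro smooth_on_continuous_on smooth_on_Diff_const assms)+
    note cont = this
    have "0 < e/2" using that by simp
    have near: "\<exists>d>0. \<forall>y\<in>S. dist y x < d \<longrightarrow> dist (g y) (g x) < e/2" if "continuous_on S g" for g :: "'a \<Rightarrow> real"
      using that assms(3) \<open>0 < e/2\<close> unfolding continuous_on_iff by blast
    obtain d1 where d1: "0 < d1" "\<And>y. y \<in> S \<Longrightarrow> dist y x < d1 \<Longrightarrow> dist (?A y) (?A x) < e/2"
      using near[OF cont(1)] by (elim exE conjE) (drule (1) bspec | assumption | simp)+
    obtain d2 where d2: "0 < d2" "\<And>y. y \<in> S \<Longrightarrow> dist y x < d2 \<Longrightarrow> dist (?B y) (?B x) < e/2"
      using near[OF cont(2)] by (elim exE conjE) (drule (1) bspec | assumption | simp)+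
    note d = d1(1) d2(1) d1(2) d2(2)
    obtain d3 where d3: "0 < d3" "ball x d3 \<subseteq> S" using assms(1,3) openE by blast
    define d where "d = Min {d1, d2, d3}"
    \<comment> \<open>This step keeps the parallelogram spanned by \<open>h *\<^sub>R u\<close> and
      \<open>h *\<^sub>R v\<close> at \<open>x\<close> within distance \<open>d\<close>; the summand
      1 keeps the denominator positive for \<open>u = v = 0\<close>.\<close>
    define h where "h = d / (2 * (norm u + norm v + 1))"
    have "0 < d" using d d3 by (simp add: d_def)
    then have "0 < h" by (simp add: h_def add_nonneg_pos)
    have near: "dist (x + \<sigma> *\<^sub>R u + \<tau> *\<^sub>R v) x < d" if "0 \<le> \<sigma>" "\<sigma> \<le> h" "0 \<le> \<tau>" "\<tau> \<le> h" for \<sigma> \<tau>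
    proof -
      have "dist (x + \<sigma> *\<^sub>R u + \<tau> *\<^sub>R v) x \<le> \<sigma> * norm u + \<tau> * norm v"
        using norm_triangle_ineq[of "\<sigma> *\<^sub>R u" "\<tau> *\<^sub>R v"] that by (simp add: dist_norm add.assoc)
      also have "\<dots> \<le> h * norm u + h * norm v"
        using that by (intro add_mono mult_right_mono) auto
      also have "\<dots> < h * (2 * (norm u + norm v + 1))"
        using \<open>0 < h\<close> by (simp add: distrib_left add_pos_nonneg add_nonneg_pos)
      also have "\<dots> = d"
      proof -
        have "norm u + norm v + 1 \<noteq> 0" using norm_ge_zero[of u] norm_ge_zero[of v] by linarith
        then show ?thesis unfolding h_def by simp
      qed
      finally show ?thesis .
    qed
    have inS: "y \<in> S" if "dist y x < d" for y
      using that d3 by (auto simp: d_def dist_commute)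
    obtain \<sigma>1 \<tau>1 where 1: "0 < \<sigma>1" "\<sigma>1 < h" "0 < \<tau>1" "\<tau>1 < h"
      "f (x + h *\<^sub>R u + h *\<^sub>R v) - f (x + h *\<^sub>R u) - f (x + h *\<^sub>R v) + f x =
       h * h * ?A (x + \<sigma>1 *\<^sub>R u + \<tau>1 *\<^sub>R v)"
      by (rule second_difference_mean_value[OF assms(2) \<open>0 < h\<close>, of x u v]) (blast intro: near inS)+
    have near': "x + \<sigma> *\<^sub>R v + \<tau> *\<^sub>R u \<in> S" if "0 \<le> \<sigma>" "\<sigma> \<le> h" "0 \<le> \<tau>" "\<tau> \<le> h" for \<sigma> \<tau>
      using near[of \<tau> \<sigma>] that inS by (simp add: algebra_simps)
    obtain \<sigma>2 \<tau>2 where 2: "0 < \<sigma>2" "\<sigma>2 < h" "0 < \<tau>2" "\<tau>2 < h"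
      "f (x + h *\<^sub>R v + h *\<^sub>R u) - f (x + h *\<^sub>R v) - f (x + h *\<^sub>R u) + f x =
       h * h * ?B (x + \<sigma>2 *\<^sub>R v + \<tau>2 *\<^sub>R u)"
      by (rule second_difference_mean_value[OF assms(2) \<open>0 < h\<close>, of x v u]) (blast intro: near')+
    let ?y1 = "x + \<sigma>1 *\<^sub>R u + \<tau>1 *\<^sub>R v" and ?y2 = "x + \<sigma>2 *\<^sub>R v + \<tau>2 *\<^sub>R u"
    have "h * h * ?A ?y1 = h * h * ?B ?y2"
      using 1(5) 2(5) by (simp add: algebra_simps)
    then have "?A ?y1 = ?B ?y2" using \<open>0 < h\<close> by simp
    moreover have y: "dist ?y1 x < d" "dist ?y2 x < d"
      using near[of \<sigma>1 \<tau>1] near[of \<tau>2 \<sigma>2] 1 2 by (simp_all add: algebra_simps)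
    moreover have "dist (?A ?y1) (?A x) < e/2" "dist (?B ?y2) (?B x) < e/2"
      using d(3)[OF inS[OF y(1)]] d(4)[OF inS[OF y(2)]] y by (simp_all add: d_def)
    ultimately show ?thesis by (simp add: dist_real_def abs_if split: if_splits)
  qed
  show "\<And>e. 0 < e \<Longrightarrow> Diff (\<lambda>y. Diff f y u) x v \<le> Diff (\<lambda>y. Diff f y v) x u + e"
    "Diff (\<lambda>y. Diff f y v) x u \<le> Diff (\<lambda>y. Diff f y u) x v"
    using main by (auto intro: field_le_epsilon)
qed

lemma Diff_Diff_commute:
  fixes f :: "'a::real_normed_vector \<Rightarrow> 'b::euclidean_space"
  assumes "open S" "smooth_on S f" "x \<in> S"
  shows "Diff (\<lambda>y. Diff f y u) x v = Diff (\<lambda>y. Diff f y v) x u"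
proof (rule euclidean_eqI)
  fix b :: 'b
  have *: "Diff (\<lambda>y. Diff f y u) x v \<bullet> b = Diff (\<lambda>y. Diff (\<lambda>z. f z \<bullet> b) y u) x v" for u v
  proof -
    have "Diff (\<lambda>y. Diff f y u \<bullet> b) x v = Diff (\<lambda>y. Diff f y u) x v \<bullet> b"
      by (intro Diff_linear_compose bounded_linear_inner_left smooth_on_differentiable[OF smooth_on_Diff_const[OF assms(2)] assms(3)])
    moreover have "Diff (\<lambda>y. Diff f y u \<bullet> b) x = Diff (\<lambda>y. Diff (\<lambda>z. f z \<bullet> b) y u) x"
      by (rule Diff_cong_open[OF assms(1,3)])
        (intro ext Diff_linear_compose[symmetric] bounded_linear_inner_left smooth_on_differentiable[OF assms(2)])
    ultimately show ?thesis by simp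
  qed
  have "smooth_on S (\<lambda>z. f z \<bullet> b)"
    by (rule smooth_on_linear_compose[OF assms(1) bounded_linear_inner_left assms(2)])
  then show "Diff (\<lambda>y. Diff f y u) x v \<bullet> b = Diff (\<lambda>y. Diff f y v) x u \<bullet> b"
    unfolding * by (rule Diff_Diff_commute_real[OF assms(1) _ assms(3)])
qed

section \<open>Smooth inverse functions and submersions\<close>

lemma smooth_on_det:
  fixes A :: "'a::real_normed_vector \<Rightarrow> real^'n^'n"
  assumes "open S" "\<And>i j. smooth_on S (\<lambda>x. A x $ i $ j)"
  shows "smooth_on S (\<lambda>x. det (A x))"
  unfolding det_def by (intro smooth_on_sum smooth_on_mult smooth_on_const smooth_on_prod assms)

text \<open>By Cramer's rule the components of the inverse are quotients of determinants, which are
  polynomials in the matrix entries.\<close>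

lemma smooth_on_inv_linear:
  fixes F :: "'a::real_normed_vector \<Rightarrow> real^'n \<Rightarrow> real^'n"
  assumes "open S" "\<And>x. x \<in> S \<Longrightarrow> linear (F x)" "\<And>x. x \<in> S \<Longrightarrow> bij (F x)" "\<And>v. smooth_on S (\<lambda>x. F x v)"
  shows "smooth_on S (\<lambda>x. inv (F x) v)"
proof -
  define A where "A x = matrix (F x)" for x
  have A: "smooth_on S (\<lambda>x. A x $ i $ j)" for i j
    unfolding A_def matrix_def using smooth_on_vec_nth[OF assms(1) assms(4)] by simp
  have det: "det (A x) \<noteq> 0" if "x \<in> S" for x
    using assms(2,3)[OF that] by (auto simp: A_def det_nz_iff_inj bij_is_inj matrix_works linear_matrix_vector_mul_eq)
  have "smooth_on S (\<lambda>x. \<chi> k. det (\<chi> i j. if j = k then v$i else A x$i$j) / det (A x))"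
  proof (intro smooth_on_vec_lambda smooth_on_divide smooth_on_det assms(1) det A)
    show "smooth_on S (\<lambda>x. (\<chi> i j. if j = k then v$i else A x$i$j) $ i $ j)" for k i j
      by (cases "j = k") (simp_all add: A smooth_on_const assms(1))
  qed
  then show ?thesis
  proof (rule smooth_on_cong[OF assms(1)])
    fix x assume x: "x \<in> S"
    have "A x *v inv (F x) v = v"
      using assms(2,3)[OF x] by (simp add: A_def matrix_works linear_matrix_vector_mul_eq surj_f_inv_f bij_is_surj)
    then show "(\<chi> k. det (\<chi> i j. if j = k then v$i else A x$i$j) / det (A x)) = inv (F x) v"
      by (rule iffD1[OF cramer[OF det[OF x]], symmetric])
  qed
qed

text \<open>The inverse function theorem gives a differentiable \<open>g\<close> whose derivative at
  \<open>y\<close> is the inverse of \<open>Diff f (g y)\<close>. If \<open>g\<close> is k times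
  differentiable, so is this expression, and then \<open>g\<close> is k + 1 times
  differentiable.\<close>

lemma smooth_inverse_function:
  fixes f :: "real^'n \<Rightarrow> real^'n"
  assumes "open U" "smooth_on U f" "x0 \<in> U" "inj (Diff f x0)"
  obtains U' V g where "open U'" "U' \<subseteq> U" "x0 \<in> U'" "open V" "f x0 \<in> V" "homeomorphism U' V f g"
    "smooth_on V g" "\<And>x. x \<in> U' \<Longrightarrow> bij (Diff f x)"
proof -
  have bl: "bounded_linear (Diff f x)" if "x \<in> U" for x
    using smooth_on_linear_Diff[OF assms(2) that] linear_conv_bounded_linear by blast
  \<comment> \<open>The theorem wants the derivative to be continuous as a map into the bounded
    linear maps; in finite dimensions it suffices to check this on fixed vectors.\<close>
  define f' where "f' x = Blinfun (Diff f x)" for x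
  have f': "blinfun_apply (f' x) = Diff f x" if "x \<in> U" for x
    unfolding f'_def by (rule bounded_linear_Blinfun_apply[OF bl[OF that]])
  have cont: "continuous_on U f'"
  proof (rule continuous_on_blinfun_componentwise)
    fix i
    have "continuous_on U (\<lambda>x. Diff f x i)"
      by (rule smooth_on_continuous_on[OF smooth_on_Diff_const[OF assms(2)]])
    then show "continuous_on U (\<lambda>x. blinfun_apply (f' x) i)"
      by (rule continuous_on_eq) (simp add: f')
  qed
  obtain h where h: "linear h" "\<And>x. h (Diff f x0 x) = x"
    using linear_injective_isomorphism[OF smooth_on_linear_Diff[OF assms(2,3)] assms(4)] by blast
  have inv: "Blinfun h o\<^sub>L f' x0 = id_blinfun"
    by (rule blinfun_eqI) (use h in \<open>simp add: f' assms(3) bounded_linear_Blinfun_apply linear_conv_bounded_linear\<close>)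
  obtain U' V g g' where *: "open U'" "U' \<subseteq> U" "x0 \<in> U'" "open V" "f x0 \<in> V" "homeomorphism U' V f g"
    "\<And>y. y \<in> V \<Longrightarrow> (g has_derivative (g' y)) (at y)"
    "\<And>y. y \<in> V \<Longrightarrow> g' y = inv (blinfun_apply (f'(g y)))"
    "\<And>y. y \<in> V \<Longrightarrow> bij (blinfun_apply (f'(g y)))"
    using inverse_function_theorem[OF assms(1) _ cont assms(3) inv, of f]
      smooth_on_has_derivative[OF assms(2)] f' by metis
  have gU: "g ` V = U'" "\<And>x. x \<in> U' \<Longrightarrow> f x \<in> V \<and> g (f x) = x"
    using *(6) by (auto simp: homeomorphism_def)
  have bij: "bij (Diff f x)" if "x \<in> U'" for x
    using *(9)[of "f x"] gU(2)[OF that] f'[of x] *(2) that by auto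
  have "times_differentiable_on k V g" for k
  proof (induction k)
    case 0
    then show ?case using *(6) by (simp add: homeomorphism_def)
  next
    case (Suc k)
    show ?case
    proof (rule times_differentiable_on_SucI[OF *(4,7)])
      fix v
      have "smooth_on U' (\<lambda>x. inv (Diff f x) v)"
        by (intro smooth_on_inv_linear *(1) bij smooth_on_subset[OF smooth_on_Diff_const[OF assms(2)] *(2)])
          (use smooth_on_linear_Diff[OF assms(2)] *(2) in auto)
      then have "times_differentiable_on k V (\<lambda>y. inv (Diff f (g y)) v)"
        using times_differentiable_on_compose[OF *(4,1) _ Suc, of "\<lambda>x. inv (Diff f x) v"] gU(1)
        by (simp add: smooth_on_def)
      then show "times_differentiable_on k V (\<lambda>y. g' y v)"
        by (rule times_differentiable_on_cong[OF *(4), rotated])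
          (use *(2,8) gU(1) f' in \<open>metis imageI subsetD\<close>)
    qed
  qed
  then have "smooth_on V g" by (simp add: smooth_on_def)
  with * bij show thesis by (intro that)
qed

text \<open>The chart in \<open>null_surface_chart\<close> takes values in the product of a plane
  and a line. A linear isomorphism with \<open>real^'n\<close> reduces this case to the preceding
  one.\<close>

lemma smooth_inverse_function_to_euclidean:
  fixes f :: "real^'n \<Rightarrow> 'b::euclidean_space"
  assumes "open U" "smooth_on U f" "x0 \<in> U" "inj (Diff f x0)" "DIM('b) = CARD('n)"
  obtains U' V g where "open U'" "U' \<subseteq> U" "x0 \<in> U'" "open V" "f x0 \<in> V" "homeomorphism U' V f g"
    "smooth_on V g" "\<And>x. x \<in> U' \<Longrightarrow> bij (Diff f x)"
proof -
  have "DIM('b) = DIM(real^'n)" using assms(5) by simp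
  then obtain T :: "'b \<Rightarrow> real^'n" and T' where T: "linear T" "linear T'" "\<And>x. T' (T x) = x" "\<And>y. T (T' y) = y"
    using isomorphisms_UNIV_UNIV by metis
  have bT: "bounded_linear T" "bounded_linear T'" using T linear_conv_bounded_linear by blast+
  have DT: "Diff (\<lambda>x. T (f x)) x v = T (Diff f x v)" if "x \<in> U" for x v
    by (rule Diff_linear_compose[OF bT(1) smooth_on_differentiable[OF assms(2) that]])
  have "inj (Diff (\<lambda>x. T (f x)) x0)"
    using assms(4) unfolding inj_def DT[OF assms(3)] by (metis T(3))
  from smooth_inverse_function[OF assms(1) smooth_on_linear_compose[OF assms(1) bT(1) assms(2)] assms(3) this]
  obtain U' V g where *: "open U'" "U' \<subseteq> U" "x0 \<in> U'" "open V" "T (f x0) \<in> V" "homeomorphism U' V (\<lambda>x. T (f x)) g"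
    "smooth_on V g" "\<And>x. x \<in> U' \<Longrightarrow> bij (Diff (\<lambda>x. T (f x)) x)" by metis
  have op: "open (T -` V)" by (rule open_vimage[OF *(4)]) (simp add: T(1) linear_continuous_on bT)
  have h: "homeomorphism U' (T -` V) f (\<lambda>y. g (T y))"
  proof (rule homeomorphismI)
    show "continuous_on U' f"
      by (rule smooth_on_continuous_on[OF smooth_on_subset[OF assms(2) *(2)]])
    show "continuous_on (T -` V) (\<lambda>y. g (T y))"
      by (rule continuous_on_compose2[OF homeomorphism_cont2[OF *(6)]])
        (use T(1) bT in \<open>auto simp: linear_continuous_on\<close>)
    show "f ` U' \<subseteq> T -` V" "(\<lambda>y. g (T y)) ` (T -` V) \<subseteq> U'" "\<And>x. x \<in> U' \<Longrightarrow> g (T (f x)) = x"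
      using *(6) by (auto simp: homeomorphism_def)
    show "f (g (T y)) = y" if "y \<in> T -` V" for y
      using that *(6) T(3) by (metis homeomorphism_apply2 vimageD)
  qed
  have bij: "bij (Diff f x)" if "x \<in> U'" for x
  proof -
    have "Diff f x = T' \<circ> Diff (\<lambda>x. T (f x)) x"
      using DT that *(2) T(3) by (auto simp: fun_eq_iff)
    moreover have "bij T'" using T by (metis bijI')
    ultimately show ?thesis using *(8)[OF that] by (simp add: bij_comp)
  qed
  have "smooth_on (T -` V) (\<lambda>y. g (T y))"
    by (rule smooth_on_compose[OF op *(4) _ *(7)]) (auto intro: smooth_on_bounded_linear op bT)
  with * h op bij show thesis by (intro that[of U' "T -` V" "\<lambda>y. g (T y)"]) auto
qed

text \<open>With \<open>R\<close> a right inverse of \<open>L = Dq(w\<^sub>0)\<close>, the map \<open>w \<mapsto> w + R (q w - L w)\<close> is a local diffeomorphism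
  with \<open>L (w + R (q w - L w)) = q w\<close>; in the chart it provides, \<open>q\<close> is linear.\<close>

lemma submersion_chart:
  fixes q :: "real^'n \<Rightarrow> 'b::euclidean_space"
  assumes "open W" "smooth_on W q" "w0 \<in> W" "surj (Diff q w0)"
  obtains L and R :: "'b \<Rightarrow> real^'n" and v0 :: "real^'n" and r N f g where "linear L" "linear R" "\<And>y. L (R y) = y" "0 < r" "open N" "w0 \<in> N" "N \<subseteq> W"
    "homeomorphism N (ball v0 r) f g" "f w0 = v0" "smooth_on (ball v0 r) g"
    "\<And>v. v \<in> ball v0 r \<Longrightarrow> q (g v) = L v" "\<And>v. v \<in> ball v0 r \<Longrightarrow> bij (Diff g v)"
proof -
  define L where "L = Diff q w0"
  have L: "linear L" unfolding L_def by (rule smooth_on_linear_Diff[OF assms(2,3)])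
  obtain R where R: "linear R" "L \<circ> R = id"
    using linear_surjective_right_inverse[OF L] assms(4) L_def by auto
  have LR: "L (R y) = y" for y using R(2) by (metis comp_apply id_apply)
  define F where "F w = w + R (q w - L w)" for w
  have smF: "smooth_on W F"
    unfolding F_def by (intro smooth_on_add smooth_on_ident assms smooth_on_linear_compose'[OF _ R(1)]
      smooth_on_diff smooth_on_linear L)
  have LF: "L (F w) = q w" for w
    using L by (simp add: F_def linear_add LR)
  have "(F has_derivative (\<lambda>v. v + R (Diff q w0 v - L v))) (at w0)"
    unfolding F_def
    by (intro has_derivative_add has_derivative_ident has_derivative_diff smooth_on_has_derivative[OF assms(2,3)]
        bounded_linear.has_derivative[of R] bounded_linear_imp_has_derivative)
      (use L R linear_conv_bounded_linear in blast)+
  then have "Diff F w0 = (\<lambda>v. v)"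
    using R(1) by (simp add: Diff_eq L_def linear_0)
  then have "inj (Diff F w0)" by (simp add: inj_def)
  from smooth_inverse_function[OF assms(1) smF assms(3) this]
  obtain N' V g where *: "open N'" "N' \<subseteq> W" "w0 \<in> N'" "open V" "F w0 \<in> V" "homeomorphism N' V F g"
    "smooth_on V g" "\<And>x. x \<in> N' \<Longrightarrow> bij (Diff F x)" by metis
  \<comment> \<open>A ball is convex: two of its points with the same image under \<open>L\<close>
    are joined by a segment of such points. All later arguments along fibres of \<open>q\<close>
    move on these segments.\<close>
  obtain r where r: "0 < r" "ball (F w0) r \<subseteq> V" using *(4,5) openE by blast
  define N where "N = N' \<inter> F -` ball (F w0) r"
  have opN: "open N"
    unfolding N_def by (rule continuous_open_preimage[OF _ *(1) open_ball])
      (use smF *(2) smooth_on_continuous_on smooth_on_subset in blast)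
  have gF: "g y \<in> N'" "F (g y) = y" if "y \<in> V" for y
    using *(6) that by (auto simp: homeomorphism_def)
  have gF': "g (F x) = x" if "x \<in> N'" for x
    using *(6) that by (auto simp: homeomorphism_def)
  have hom: "homeomorphism N (ball (F w0) r) F g"
    using r(2) gF gF' homeomorphism_cont1[OF *(6)] homeomorphism_cont2[OF *(6)]
    by (intro homeomorphismI) (auto simp: N_def intro: continuous_on_subset)
  have sg: "smooth_on (ball (F w0) r) g" by (rule smooth_on_subset[OF *(7) r(2)])
  show thesis
  proof (rule that[OF L R(1) _ r(1) opN _ _ hom _ sg])
    show "F w0 = F w0" "\<And>y. L (R y) = y" by (simp_all add: LR)
    show "w0 \<in> N" "N \<subseteq> W" using * r(1) by (auto simp: N_def)
    fix v assume v: "v \<in> ball (F w0) r"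
    then have vV: "v \<in> V" using r by auto
    show "q (g v) = L v" using LF[of "g v"] gF vV by simp
    have "Diff F (g v) (Diff g v u) = u" for u
    proof -
      have "Diff (\<lambda>v. F (g v)) v u = Diff F (g v) (Diff g v u)"
        by (intro Diff_compose smooth_on_differentiable[OF sg] v smooth_on_differentiable[OF smF])
          (use gF vV *(2) in auto)
      moreover have "Diff (\<lambda>v. F (g v)) v = Diff (\<lambda>v. v) v"
        by (rule Diff_cong_open[OF *(4) vV]) (simp add: gF)
      ultimately show ?thesis by simp
    qed
    then have "inj (Diff g v)" by (metis injI)
    then show "bij (Diff g v)"
      using linear_injective_imp_surjective[OF smooth_on_linear_Diff[OF sg v]] by (simp add: bij_def)
  qed
qed

section \<open>Differential forms\<close>

lemma form1_on_linear: "form1_on U \<alpha> \<Longrightarrow> p \<in> U \<Longrightarrow> linear (\<alpha> p)"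
  by (simp add: form1_on_def)

lemma form1_on_smooth: "form1_on U \<alpha> \<Longrightarrow> smooth_on U (\<lambda>p. \<alpha> p v)"
  by (simp add: form1_on_def)

lemma form1_expand:
  assumes "form1_on U \<alpha>" "p \<in> U"
  shows "\<alpha> p v = (\<Sum>b\<in>Basis. (v \<bullet> b) * \<alpha> p b)"
proof -
  interpret linear "\<alpha> p" by (rule form1_on_linear[OF assms])
  have "\<alpha> p (\<Sum>b\<in>Basis. (v \<bullet> b) *\<^sub>R b) = (\<Sum>b\<in>Basis. (v \<bullet> b) * \<alpha> p b)"
    by (simp add: sum scaleR)
  then show ?thesis by (simp add: euclidean_representation)
qed

lemma form1_Diff_linear:
  assumes "open U" "form1_on U \<alpha>" "p \<in> U"
  shows "linear (\<lambda>Y. Diff (\<lambda>y. \<alpha> y Y) p X)"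
proof (rule linearI)
  have d: "((\<lambda>y. \<alpha> y Y) has_derivative Diff (\<lambda>y. \<alpha> y Y) p) (at p)" for Y
    by (rule smooth_on_has_derivative[OF form1_on_smooth[OF assms(2)] assms(3)])
  fix Y Y' and r :: real
  have "Diff (\<lambda>y. \<alpha> y (Y + Y')) p = Diff (\<lambda>y. \<alpha> y Y + \<alpha> y Y') p"
    by (rule Diff_cong_open[OF assms(1,3)]) (rule linear_add[OF form1_on_linear[OF assms(2)]])
  then show "Diff (\<lambda>y. \<alpha> y (Y + Y')) p X = Diff (\<lambda>y. \<alpha> y Y) p X + Diff (\<lambda>y. \<alpha> y Y') p X"
    using Diff_eq[OF has_derivative_add[OF d d]] by simp
  have "Diff (\<lambda>y. \<alpha> y (r *\<^sub>R Y)) p = Diff (\<lambda>y. r *\<^sub>R \<alpha> y Y) p"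
    by (rule Diff_cong_open[OF assms(1,3)]) (rule linear_scale[OF form1_on_linear[OF assms(2)]])
  then show "Diff (\<lambda>y. \<alpha> y (r *\<^sub>R Y)) p X = r *\<^sub>R Diff (\<lambda>y. \<alpha> y Y) p X"
    using Diff_eq[OF has_derivative_scaleR_right[OF d]] by simp
qed

text \<open>A product rule in which base point and argument both move. Forms are smooth on fixed
  vectors, so the moving argument \<open>h\<close> is expanded in the basis and the sum is
  differentiated term by term.\<close>

lemma form1_has_derivative:
  assumes U: "open U" "form1_on U \<alpha>" and S: "open S" "x \<in> S" "f ` S \<subseteq> U"
    and f: "(f has_derivative f') (at x)" and h: "(h has_derivative h') (at x)"
  shows "((\<lambda>x. \<alpha> (f x) (h x)) has_derivative
    (\<lambda>v. Diff (\<lambda>p. \<alpha> p (h x)) (f x) (f' v) + \<alpha> (f x) (h' v))) (at x)"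
proof -
  have fx: "f x \<in> U" using S by auto
  have d: "((\<lambda>y. \<alpha> (f y) b) has_derivative (\<lambda>v. Diff (\<lambda>p. \<alpha> p b) (f x) (f' v))) (at x)" for b
    by (rule has_derivative_compose[OF f smooth_on_has_derivative[OF form1_on_smooth[OF U(2)] fx]])
  have "((\<lambda>y. \<Sum>b\<in>Basis. (h y \<bullet> b) * \<alpha> (f y) b) has_derivative
      (\<lambda>v. \<Sum>b\<in>Basis. (h x \<bullet> b) * Diff (\<lambda>p. \<alpha> p b) (f x) (f' v) + (h' v \<bullet> b) * \<alpha> (f x) b)) (at x)"
    by (intro has_derivative_sum has_derivative_mult bounded_linear.has_derivative[OF bounded_linear_inner_left h] d)
  moreover have "(\<Sum>b\<in>Basis. (h x \<bullet> b) * Diff (\<lambda>p. \<alpha> p b) (f x) (f' v) + (h' v \<bullet> b) * \<alpha> (f x) b)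
      = Diff (\<lambda>p. \<alpha> p (h x)) (f x) (f' v) + \<alpha> (f x) (h' v)" for v
  proof -
    interpret linear "\<lambda>Y. Diff (\<lambda>y. \<alpha> y Y) (f x) (f' v)" by (rule form1_Diff_linear[OF U fx])
    have "Diff (\<lambda>y. \<alpha> y (\<Sum>b\<in>Basis. (h x \<bullet> b) *\<^sub>R b)) (f x) (f' v) =
        (\<Sum>b\<in>Basis. (h x \<bullet> b) * Diff (\<lambda>p. \<alpha> p b) (f x) (f' v))"
      by (simp add: sum scaleR)
    then show ?thesis
      by (simp add: euclidean_representation sum.distrib form1_expand[OF U(2) fx, of "h' v"])
  qed
  ultimately have "((\<lambda>y. \<Sum>b\<in>Basis. (h y \<bullet> b) * \<alpha> (f y) b) has_derivative
      (\<lambda>v. Diff (\<lambda>p. \<alpha> p (h x)) (f x) (f' v) + \<alpha> (f x) (h' v))) (at x)"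
    by simp
  then show ?thesis
    by (rule has_derivative_transform_within_open[OF _ S(1,2)])
      (use S(3) form1_expand[OF U(2)] in \<open>auto simp: image_subset_iff\<close>)
qed

lemma form1_smooth_on_compose:
  assumes U: "open U" "form1_on U \<alpha>" and S: "open S" "f ` S \<subseteq> U" "smooth_on S f" "smooth_on S h"
  shows "smooth_on S (\<lambda>x. \<alpha> (f x) (h x))"
proof -
  have "smooth_on S (\<lambda>x. \<Sum>b\<in>Basis. (h x \<bullet> b) * \<alpha> (f x) b)"
    by (intro smooth_on_sum smooth_on_mult S(1) smooth_on_linear_compose[OF S(1) bounded_linear_inner_left S(4)]
        smooth_on_compose[OF S(1) U(1) S(2) form1_on_smooth[OF U(2)] S(3)])
  then show ?thesis
    by (rule smooth_on_cong[OF S(1)]) (use S(2) form1_expand[OF U(2)] in \<open>auto simp: image_subset_iff\<close>)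
qed

lemma form1_on_pullback:
  assumes "open U" "form1_on U \<alpha>" "open S" "f ` S \<subseteq> U" "smooth_on S f"
  shows "form1_on S (pullback f \<alpha>)"
  unfolding form1_on_def pullback_def
proof (intro conjI ballI allI)
  fix x assume x: "x \<in> S"
  have "linear (\<alpha> (f x) \<circ> Diff f x)"
    by (intro linear_compose smooth_on_linear_Diff[OF assms(5) x] form1_on_linear[OF assms(2)]) (use x assms(4) in auto)
  then show "linear (\<lambda>v. \<alpha> (f x) (Diff f x v))" by (simp add: o_def)
next
  fix v show "smooth_on S (\<lambda>x. \<alpha> (f x) (Diff f x v))"
    by (rule form1_smooth_on_compose[OF assms(1-5) smooth_on_Diff_const[OF assms(5)]])
qed

text \<open>Differentiating the pull-back produces a second derivative of \<open>f\<close> in each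
  of the two terms of \<open>ext_d\<close>; these cancel by symmetry.\<close>

lemma ext_d_pullback:
  assumes U: "open U" "form1_on U \<alpha>" and S: "open S" "f ` S \<subseteq> U" "smooth_on S f" and x: "x \<in> S"
  shows "ext_d (pullback f \<alpha>) x u v = ext_d \<alpha> (f x) (Diff f x u) (Diff f x v)"
proof -
  have "Diff (\<lambda>y. pullback f \<alpha> y v) x u =
      Diff (\<lambda>p. \<alpha> p (Diff f x v)) (f x) (Diff f x u) + \<alpha> (f x) (Diff (\<lambda>y. Diff f y v) x u)" for u v
    unfolding pullback_def
    by (rule Diff_eq[THEN fun_cong], rule form1_has_derivative[OF U S(1) x S(2)])
      (intro smooth_on_has_derivative[OF _ x] smooth_on_Diff_const S(3))+
  then show ?thesis
    unfolding ext_d_def using Diff_Diff_commute[OF S(1,3) x, of u v] by simp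
qed

lemma ext_d_skew: "ext_d \<alpha> p Y X = - ext_d \<alpha> p X Y"
  by (simp add: ext_d_def)

lemma form1_on_add [smooth_intros]:
  assumes "open U" "form1_on U \<alpha>" "form1_on U \<beta>"
  shows "form1_on U (\<lambda>p v. \<alpha> p v + \<beta> p v)"
  using assms by (auto simp: form1_on_def intro!: linear_compose_add smooth_on_add)

lemma form1_on_scale [smooth_intros]:
  assumes "open U" "smooth_on U f" "form1_on U \<alpha>"
  shows "form1_on U (\<lambda>p v. f p * \<alpha> p v)"
  using assms linear_compose_scale_right[of "\<alpha> _" "f _"]
  by (auto simp: form1_on_def intro!: smooth_on_mult)

lemma ext_d_add:
  assumes "form1_on U \<alpha>" "form1_on U \<beta>" "p \<in> U"
  shows "ext_d (\<lambda>p v. \<alpha> p v + \<beta> p v) p X Y = ext_d \<alpha> p X Y + ext_d \<beta> p X Y"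
proof -
  have "Diff (\<lambda>p. \<alpha> p v + \<beta> p v) p u = Diff (\<lambda>p. \<alpha> p v) p u + Diff (\<lambda>p. \<beta> p v) p u" for u v
    by (intro Diff_eq[THEN fun_cong] has_derivative_add smooth_on_has_derivative[OF form1_on_smooth]; rule assms)
  then show ?thesis by (simp add: ext_d_def)
qed

lemma form1_on_diff [smooth_intros]:
  assumes "open U" "form1_on U \<alpha>" "form1_on U \<beta>"
  shows "form1_on U (\<lambda>p v. \<alpha> p v - \<beta> p v)"
  using assms by (auto simp: form1_on_def intro!: linear_compose_sub smooth_on_diff)

lemma ext_d_diff:
  assumes "form1_on U \<alpha>" "form1_on U \<beta>" "p \<in> U"
  shows "ext_d (\<lambda>p v. \<alpha> p v - \<beta> p v) p X Y = ext_d \<alpha> p X Y - ext_d \<beta> p X Y"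
proof -
  have "Diff (\<lambda>p. \<alpha> p v - \<beta> p v) p u = Diff (\<lambda>p. \<alpha> p v) p u - Diff (\<lambda>p. \<beta> p v) p u" for u v
    by (intro Diff_eq[THEN fun_cong] has_derivative_diff smooth_on_has_derivative[OF form1_on_smooth]; rule assms)
  then show ?thesis by (simp add: ext_d_def)
qed

lemma Diff_mult_real:
  fixes f g :: "'a::real_normed_vector \<Rightarrow> real"
  assumes "smooth_on U f" "smooth_on U g" "p \<in> U"
  shows "Diff (\<lambda>p. f p * g p) p u = f p * Diff g p u + Diff f p u * g p"
  by (intro Diff_eq[THEN fun_cong] has_derivative_mult smooth_on_has_derivative[OF _ assms(3)] assms(1,2))

lemma ext_d_scale:
  assumes "smooth_on U f" "form1_on U \<alpha>" "p \<in> U"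
  shows "ext_d (\<lambda>p v. f p * \<alpha> p v) p X Y = Diff f p X * \<alpha> p Y - Diff f p Y * \<alpha> p X + f p * ext_d \<alpha> p X Y"
  by (simp add: ext_d_def Diff_mult_real[OF assms(1) form1_on_smooth[OF assms(2)] assms(3)] algebra_simps)

section \<open>Exterior derivative of 2-forms\<close>

definition smooth_form2_on :: "'a::euclidean_space set \<Rightarrow> ('a \<Rightarrow> 'a \<Rightarrow> 'a \<Rightarrow> real) \<Rightarrow> bool" where
  "smooth_form2_on U \<Omega> \<longleftrightarrow> (\<forall>u v. smooth_on U (\<lambda>p. \<Omega> p u v))"

text \<open>The invariant formula for the exterior derivative of a 2-form, taken on constant vector
  fields, so that all bracket terms vanish.\<close>

definition ext_d2 :: "('a::euclidean_space \<Rightarrow> 'a \<Rightarrow> 'a \<Rightarrow> real) \<Rightarrow> 'a \<Rightarrow> 'a \<Rightarrow> 'a \<Rightarrow> 'a \<Rightarrow> real" where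
  "ext_d2 \<Omega> p X Y Z =
     Diff (\<lambda>q. \<Omega> q Y Z) p X + Diff (\<lambda>q. \<Omega> q Z X) p Y + Diff (\<lambda>q. \<Omega> q X Y) p Z"

lemma smooth_form2_on_wedge [smooth_intros]:
  "open U \<Longrightarrow> form1_on U \<alpha> \<Longrightarrow> form1_on U \<beta> \<Longrightarrow> smooth_form2_on U (wedge \<alpha> \<beta>)"
  by (simp add: smooth_form2_on_def wedge_def form1_on_def smooth_on_diff smooth_on_mult)

lemma smooth_form2_on_add [smooth_intros]:
  "open U \<Longrightarrow> smooth_form2_on U \<Omega> \<Longrightarrow> smooth_form2_on U \<Xi> \<Longrightarrow> smooth_form2_on U (\<lambda>p u v. \<Omega> p u v + \<Xi> p u v)"
  by (simp add: smooth_form2_on_def smooth_on_add)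

lemma smooth_form2_on_scale [smooth_intros]:
  "open U \<Longrightarrow> smooth_on U f \<Longrightarrow> smooth_form2_on U \<Omega> \<Longrightarrow> smooth_form2_on U (\<lambda>p u v. f p * \<Omega> p u v)"
  by (simp add: smooth_form2_on_def smooth_on_mult)

lemma ext_d2_add:
  assumes "smooth_form2_on U \<Omega>" "smooth_form2_on U \<Xi>" "p \<in> U"
  shows "ext_d2 (\<lambda>p u v. \<Omega> p u v + \<Xi> p u v) p X Y Z = ext_d2 \<Omega> p X Y Z + ext_d2 \<Xi> p X Y Z"
proof -
  have "Diff (\<lambda>p. \<Omega> p u v + \<Xi> p u v) p w = Diff (\<lambda>p. \<Omega> p u v) p w + Diff (\<lambda>p. \<Xi> p u v) p w" for u v w
    by (intro Diff_eq[THEN fun_cong] has_derivative_add smooth_on_has_derivative[OF _ assms(3)])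
      (use assms in \<open>auto simp: smooth_form2_on_def\<close>)
  then show ?thesis by (simp add: ext_d2_def)
qed

lemma smooth_form2_on_diff [smooth_intros]:
  "open U \<Longrightarrow> smooth_form2_on U \<Omega> \<Longrightarrow> smooth_form2_on U \<Xi> \<Longrightarrow> smooth_form2_on U (\<lambda>p u v. \<Omega> p u v - \<Xi> p u v)"
  by (simp add: smooth_form2_on_def smooth_on_diff)

lemma ext_d2_diff:
  assumes "smooth_form2_on U \<Omega>" "smooth_form2_on U \<Xi>" "p \<in> U"
  shows "ext_d2 (\<lambda>p u v. \<Omega> p u v - \<Xi> p u v) p X Y Z = ext_d2 \<Omega> p X Y Z - ext_d2 \<Xi> p X Y Z"
proof -
  have "Diff (\<lambda>p. \<Omega> p u v - \<Xi> p u v) p w = Diff (\<lambda>p. \<Omega> p u v) p w - Diff (\<lambda>p. \<Xi> p u v) p w" for u v w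
    by (intro Diff_eq[THEN fun_cong] has_derivative_diff smooth_on_has_derivative[OF _ assms(3)])
      (use assms in \<open>auto simp: smooth_form2_on_def\<close>)
  then show ?thesis by (simp add: ext_d2_def)
qed

lemma ext_d2_scale:
  assumes "smooth_on U f" "smooth_form2_on U \<Omega>" "p \<in> U"
  shows "ext_d2 (\<lambda>p u v. f p * \<Omega> p u v) p X Y Z =
    Diff f p X * \<Omega> p Y Z + Diff f p Y * \<Omega> p Z X + Diff f p Z * \<Omega> p X Y + f p * ext_d2 \<Omega> p X Y Z"
proof -
  have "Diff (\<lambda>q. f q * \<Omega> q u v) p w = f p * Diff (\<lambda>q. \<Omega> q u v) p w + Diff f p w * \<Omega> p u v" for u v w
    by (rule Diff_mult_real[OF assms(1) _ assms(3)]) (use assms(2) in \<open>simp add: smooth_form2_on_def\<close>)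
  then show ?thesis by (simp add: ext_d2_def algebra_simps)
qed

lemma ext_d2_wedge:
  assumes "open U" "form1_on U \<alpha>" "form1_on U \<beta>" "p \<in> U"
  shows "ext_d2 (wedge \<alpha> \<beta>) p X Y Z =
    ext_d \<alpha> p X Y * \<beta> p Z + ext_d \<alpha> p Y Z * \<beta> p X + ext_d \<alpha> p Z X * \<beta> p Y
    - \<alpha> p X * ext_d \<beta> p Y Z - \<alpha> p Y * ext_d \<beta> p Z X - \<alpha> p Z * ext_d \<beta> p X Y"
proof -
  have s: "smooth_on U (\<lambda>q. \<alpha> q u)" "smooth_on U (\<lambda>q. \<beta> q u)" for u
    using assms(2,3) by (auto simp: form1_on_def)
  have "Diff (\<lambda>q. wedge \<alpha> \<beta> q u v) p w =
      (\<alpha> p u * Diff (\<lambda>q. \<beta> q v) p w + Diff (\<lambda>q. \<alpha> q u) p w * \<beta> p v)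
      - (\<alpha> p v * Diff (\<lambda>q. \<beta> q u) p w + Diff (\<lambda>q. \<alpha> q v) p w * \<beta> p u)" for u v w
    unfolding wedge_def
    by (intro Diff_eq[THEN fun_cong] has_derivative_diff has_derivative_mult smooth_on_has_derivative[OF _ assms(4)] s)
  note D = this
  show ?thesis unfolding ext_d2_def ext_d_def D by (simp add: algebra_simps)
qed

lemma ext_d2_cong:
  assumes "open U" "p \<in> U" "\<And>q u v. q \<in> U \<Longrightarrow> \<Omega> q u v = \<Xi> q u v"
  shows "ext_d2 \<Omega> p X Y Z = ext_d2 \<Xi> p X Y Z"
  unfolding ext_d2_def using Diff_cong_open[OF assms(1,2), of "\<lambda>q. \<Omega> q _ _" "\<lambda>q. \<Xi> q _ _"] assms(3) by simp

lemma ext_d2_ext_d: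
  assumes "open U" "form1_on U \<alpha>" "p \<in> U"
  shows "ext_d2 (ext_d \<alpha>) p X Y Z = 0"
proof -
  have s: "smooth_on U (\<lambda>q. \<alpha> q u)" for u using assms(2) by (auto simp: form1_on_def)
  have "Diff (\<lambda>q. ext_d \<alpha> q u v) p w =
      Diff (\<lambda>q. Diff (\<lambda>y. \<alpha> y v) q u) p w - Diff (\<lambda>q. Diff (\<lambda>y. \<alpha> y u) q v) p w" for u v w
    unfolding ext_d_def
    by (intro Diff_eq[THEN fun_cong] has_derivative_diff smooth_on_has_derivative[OF _ assms(3)]
        smooth_on_Diff_const s)
  then show ?thesis
    using Diff_Diff_commute[OF assms(1) s assms(3)] by (simp add: ext_d2_def)
qed

section \<open>The structure equations for vanishing \<open>a\<^sub>6\<close>\<close>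

locale cayley_coframe =
  fixes U :: "(real^8) set" and w0 w1 w2 w3 \<theta>1 \<theta>2 \<phi>0 \<phi>1 :: "(real^8) form1"
    and a1 a2 a3 a4 a5 :: "real^8 \<Rightarrow> real"
  assumes U: "open U"
    and forms: "form1_on U w0" "form1_on U w1" "form1_on U w2" "form1_on U w3"
      "form1_on U \<theta>1" "form1_on U \<theta>2" "form1_on U \<phi>0" "form1_on U \<phi>1"
    and coeffs: "smooth_on U a1" "smooth_on U a2" "smooth_on U a3" "smooth_on U a4" "smooth_on U a5"
    and coframe: "\<And>p. p \<in> U \<Longrightarrow> annihilator {w0, w1, w2, w3, \<theta>1, \<theta>2, \<phi>0, \<phi>1} p = {0}"
    and d_w0: "\<And>p X Y. p \<in> U \<Longrightarrow> ext_d w0 p X Y =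
      - wedge \<phi>0 w0 p X Y - wedge \<theta>2 w1 p X Y - wedge \<theta>1 w2 p X Y"
    and d_w1: "\<And>p X Y. p \<in> U \<Longrightarrow> ext_d w1 p X Y =
      - (wedge \<phi>0 w1 p X Y + wedge \<phi>1 w1 p X Y) - wedge \<theta>2 w2 p X Y - wedge \<theta>1 w3 p X Y"
    and d_w2: "\<And>p X Y. p \<in> U \<Longrightarrow> ext_d w2 p X Y =
      - (wedge \<phi>0 w2 p X Y + 2 * wedge \<phi>1 w2 p X Y) - wedge \<theta>2 w3 p X Y + a2 p * wedge w0 w3 p X Y"
    and d_w3: "\<And>p X Y. p \<in> U \<Longrightarrow> ext_d w3 p X Y =
      - (wedge \<phi>0 w3 p X Y + 3 * wedge \<phi>1 w3 p X Y) + a4 p * wedge w0 w3 p X Y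
      + a5 p * wedge w1 w2 p X Y + a3 p * wedge w1 w3 p X Y + a1 p * wedge w2 w3 p X Y"
begin

section \<open>Consequences of d(d\<omega>) = 0\<close>

text \<open>Eight forms without common kernel on an eight-dimensional space attain all values. The
  vectors obtained serve to read off single coefficients.\<close>

lemma dual_vector:
  assumes "p \<in> U"
  obtains e where "w0 p e = x0" "w1 p e = x1" "w2 p e = x2" "w3 p e = x3"
    "\<theta>1 p e = t1" "\<theta>2 p e = t2" "\<phi>0 p e = f0" "\<phi>1 p e = f1"
proof -
  define T where "T v = (w0 p v, w1 p v, w2 p v, w3 p v, \<theta>1 p v, \<theta>2 p v, \<phi>0 p v, \<phi>1 p v)" for v
  note lin = forms[THEN form1_on_linear, OF assms]
  have T: "linear T"
    unfolding T_def by (rule linearI) (simp_all add: lin[THEN linear_add] lin[THEN linear_scale])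
  have "v = 0" if "T v = 0" for v
    using that coframe[OF assms] by (auto simp: T_def annihilator_def prod_eq_iff)
  then have "inj T" using T linear_injective_0 by blast
  then have "dim (range T) = 8"
    using dim_image_eq[OF T, of UNIV] by (simp add: inj_on_subset)
  then have "range T = UNIV"
    using dim_eq_full[of "range T"] linear_subspace_image[OF T subspace_UNIV] by (simp add: span_eq_iff[THEN iffD2])
  then obtain e where e: "T e = (x0, x1, x2, x3, t1, t2, f0, f1)" by (metis surjD)
  show thesis by (rule that[of e]) (use e in \<open>simp_all add: T_def\<close>)
qed

text \<open>The derivatives of the wedge products stay unexpanded on purpose: they are worked out
  only after special vectors have been inserted, where most of their terms vanish.\<close>

lemma d2_w2:
  assumes "p \<in> U"
  shows "- ext_d2 (wedge \<phi>0 w2) p X Y Z - 2 * ext_d2 (wedge \<phi>1 w2) p X Y Z - ext_d2 (wedge \<theta>2 w3) p X Y Z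
    + Diff a2 p X * wedge w0 w3 p Y Z + Diff a2 p Y * wedge w0 w3 p Z X + Diff a2 p Z * wedge w0 w3 p X Y
    + a2 p * ext_d2 (wedge w0 w3) p X Y Z = 0"
proof -
  let ?R = "\<lambda>p u v. a2 p * wedge w0 w3 p u v - wedge \<phi>0 w2 p u v - 2 * wedge \<phi>1 w2 p u v - wedge \<theta>2 w3 p u v"
  have "ext_d2 ?R p X Y Z = ext_d2 (ext_d w2) p X Y Z"
    by (rule ext_d2_cong[OF U assms]) (simp add: d_w2)
  also have "\<dots> = 0" by (rule ext_d2_ext_d[OF U forms(3) assms])
  finally show ?thesis
    using U forms coeffs assms
    by (simp add: ext_d2_add[of U] ext_d2_diff[of U] ext_d2_scale[of U] smooth_intros)
qed

lemma d2_w3: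
  assumes "p \<in> U"
  shows "- ext_d2 (wedge \<phi>0 w3) p X Y Z - 3 * ext_d2 (wedge \<phi>1 w3) p X Y Z
    + Diff a4 p X * wedge w0 w3 p Y Z + Diff a4 p Y * wedge w0 w3 p Z X + Diff a4 p Z * wedge w0 w3 p X Y
    + a4 p * ext_d2 (wedge w0 w3) p X Y Z
    + Diff a5 p X * wedge w1 w2 p Y Z + Diff a5 p Y * wedge w1 w2 p Z X + Diff a5 p Z * wedge w1 w2 p X Y
    + a5 p * ext_d2 (wedge w1 w2) p X Y Z
    + Diff a3 p X * wedge w1 w3 p Y Z + Diff a3 p Y * wedge w1 w3 p Z X + Diff a3 p Z * wedge w1 w3 p X Y
    + a3 p * ext_d2 (wedge w1 w3) p X Y Z
    + Diff a1 p X * wedge w2 w3 p Y Z + Diff a1 p Y * wedge w2 w3 p Z X + Diff a1 p Z * wedge w2 w3 p X Y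
    + a1 p * ext_d2 (wedge w2 w3) p X Y Z = 0"
proof -
  let ?R = "\<lambda>p u v. a4 p * wedge w0 w3 p u v + (a5 p * wedge w1 w2 p u v + (a3 p * wedge w1 w3 p u v
    + a1 p * wedge w2 w3 p u v)) - wedge \<phi>0 w3 p u v - 3 * wedge \<phi>1 w3 p u v"
  have "ext_d2 ?R p X Y Z = ext_d2 (ext_d w3) p X Y Z"
    by (rule ext_d2_cong[OF U assms]) (simp add: d_w3)
  also have "\<dots> = 0" by (rule ext_d2_ext_d[OF U forms(4) assms])
  finally show ?thesis
    using U forms coeffs assms
    by (simp add: ext_d2_add[of U] ext_d2_diff[of U] ext_d2_scale[of U] smooth_intros)
qed

lemmas structure_simps = ext_d2_wedge[OF U] forms d_w0 d_w1 d_w2 d_w3 wedge_def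

text \<open>For \<open>X\<close>, \<open>Y\<close> tangent to a leaf, inserting the vector dual to
  \<open>w2\<close> or \<open>w3\<close> as third argument isolates the coefficient of
  \<open>w2\<close> or \<open>w3\<close> in the identities \<open>d2_w2\<close> and
  \<open>d2_w3\<close>. The term a5 w1 \<and> w2 of dw3 is the source of every a5 in the two
  equations for \<phi>0 and \<phi>1. The derivative of a5 is determined modulo \<open>w1\<close>
  only.\<close>

lemma
  assumes p: "p \<in> U" and X: "w2 p X = 0" "w3 p X = 0" and Y: "w2 p Y = 0" "w3 p Y = 0"
  shows d_phi0_2phi1: "ext_d \<phi>0 p X Y + 2 * ext_d \<phi>1 p X Y =
      a5 p * ((\<theta>2 p X - a2 p * w0 p X) * w1 p Y - (\<theta>2 p Y - a2 p * w0 p Y) * w1 p X)"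
    and d_theta2: "ext_d \<theta>2 p X Y = wedge \<phi>1 \<theta>2 p X Y
      + (Diff a2 p X - a2 p * (\<phi>0 p X + \<phi>1 p X) + a4 p * \<theta>2 p X + a2 p * a3 p * w1 p X) * w0 p Y
      - (Diff a2 p Y - a2 p * (\<phi>0 p Y + \<phi>1 p Y) + a4 p * \<theta>2 p Y + a2 p * a3 p * w1 p Y) * w0 p X
      + (a3 p - a2 p) * wedge \<theta>2 w1 p X Y"
    and d_phi0_3phi1: "ext_d \<phi>0 p X Y + 3 * ext_d \<phi>1 p X Y =
      Diff a4 p X * w0 p Y - Diff a4 p Y * w0 p X + a4 p * ext_d w0 p X Y
      + Diff a3 p X * w1 p Y - Diff a3 p Y * w1 p X + a3 p * ext_d w1 p X Y
      - a5 p * ((\<theta>2 p X - a2 p * w0 p X) * w1 p Y - (\<theta>2 p Y - a2 p * w0 p Y) * w1 p X)"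
    and d_a5: "Diff a5 p X * w1 p Y - Diff a5 p Y * w1 p X =
      a5 p * ((\<phi>0 p X + a4 p * w0 p X) * w1 p Y - (\<phi>0 p Y + a4 p * w0 p Y) * w1 p X)"
proof -
  obtain e2 where e2: "w0 p e2 = 0" "w1 p e2 = 0" "w2 p e2 = 1" "w3 p e2 = 0"
    "\<theta>1 p e2 = 0" "\<theta>2 p e2 = 0" "\<phi>0 p e2 = 0" "\<phi>1 p e2 = 0" by (rule dual_vector[OF p])
  obtain e3 where e3: "w0 p e3 = 0" "w1 p e3 = 0" "w2 p e3 = 0" "w3 p e3 = 1"
    "\<theta>1 p e3 = 0" "\<theta>2 p e3 = 0" "\<phi>0 p e3 = 0" "\<phi>1 p e3 = 0" by (rule dual_vector[OF p])
  note s = structure_simps p X Y e2 e3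
  show "ext_d \<phi>0 p X Y + 2 * ext_d \<phi>1 p X Y =
      a5 p * ((\<theta>2 p X - a2 p * w0 p X) * w1 p Y - (\<theta>2 p Y - a2 p * w0 p Y) * w1 p X)"
    using d2_w2[OF p, of X Y e2] by (simp add: s) algebra
  show "ext_d \<theta>2 p X Y = wedge \<phi>1 \<theta>2 p X Y
      + (Diff a2 p X - a2 p * (\<phi>0 p X + \<phi>1 p X) + a4 p * \<theta>2 p X + a2 p * a3 p * w1 p X) * w0 p Y
      - (Diff a2 p Y - a2 p * (\<phi>0 p Y + \<phi>1 p Y) + a4 p * \<theta>2 p Y + a2 p * a3 p * w1 p Y) * w0 p X
      + (a3 p - a2 p) * wedge \<theta>2 w1 p X Y"
    using d2_w2[OF p, of X Y e3] by (simp add: s) algebra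
  show "ext_d \<phi>0 p X Y + 3 * ext_d \<phi>1 p X Y =
      Diff a4 p X * w0 p Y - Diff a4 p Y * w0 p X + a4 p * ext_d w0 p X Y
      + Diff a3 p X * w1 p Y - Diff a3 p Y * w1 p X + a3 p * ext_d w1 p X Y
      - a5 p * ((\<theta>2 p X - a2 p * w0 p X) * w1 p Y - (\<theta>2 p Y - a2 p * w0 p Y) * w1 p X)"
    using d2_w3[OF p, of X Y e3] by (simp add: s) algebra
  show "Diff a5 p X * w1 p Y - Diff a5 p Y * w1 p X =
      a5 p * ((\<phi>0 p X + a4 p * w0 p X) * w1 p Y - (\<phi>0 p Y + a4 p * w0 p Y) * w1 p X)"
    using d2_w3[OF p, of X Y e2] by (simp add: s) algebra
qed

text \<open>The matrix \<open>(\<psi>0, \<eta>; \<kappa>, \<psi>1)\<close> is chosen so that its curvature on the leaves of \<open>{w2, w3}\<close> is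
  semibasic over the null surfaces. It is therefore the matrix of a linear connection on these
  surfaces with respect to the coframe \<open>(w0, w1)\<close>; its geodesics are tangent to \<open>w0 = \<eta> = 0\<close>,
  that is, to \<open>w0 = \<theta>2 = 0\<close>.\<close>

definition "\<psi>0 = (\<lambda>p v. \<phi>0 p v + ((2 * a4 p + 4 * a5 p) * w0 p v + (2 * a3 p) * w1 p v))"
definition "\<psi>1 = (\<lambda>p v. \<phi>0 p v + (\<phi>1 p v + ((a4 p + 4 * a5 p) * w0 p v + a3 p * w1 p v)))"
definition "\<eta> = (\<lambda>p v. \<theta>2 p v - a2 p * w0 p v)"
definition "\<kappa> = (\<lambda>p v. (- a5 p) * w1 p v)"

lemma coefficients_smooth:
  "smooth_on U (\<lambda>p. 2 * a4 p + 4 * a5 p)" "smooth_on U (\<lambda>p. 2 * a3 p)" "smooth_on U (\<lambda>p. a4 p + 4 * a5 p)"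
  "smooth_on U (\<lambda>p. - a5 p)"
  by (intro smooth_intros U coeffs)+

lemma connection_forms: "form1_on U \<psi>0" "form1_on U \<psi>1" "form1_on U \<eta>" "form1_on U \<kappa>"
  unfolding \<psi>0_def \<psi>1_def \<eta>_def \<kappa>_def by (intro smooth_intros U coeffs forms)+

lemma Diff_coefficients:
  assumes "p \<in> U"
  shows "Diff (\<lambda>p. 2 * a4 p + 4 * a5 p) p X = 2 * Diff a4 p X + 4 * Diff a5 p X"
    "Diff (\<lambda>p. 2 * a3 p) p X = 2 * Diff a3 p X" "Diff (\<lambda>p. a4 p + 4 * a5 p) p X = Diff a4 p X + 4 * Diff a5 p X"
    "Diff (\<lambda>p. - a5 p) p X = - Diff a5 p X"
  by (rule Diff_eq[THEN fun_cong], auto intro!: derivative_eq_intros smooth_on_has_derivative[OF _ assms] coeffs)+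

text \<open>A 2-form on a leaf that vanishes as soon as one argument is vertical is a multiple of w0
  \<and> w1. Evaluating with vertical \<open>X\<close> and arbitrary tangent \<open>Y\<close>
  therefore expresses exactly that torsion and curvature are semibasic.\<close>

lemma
  assumes p: "p \<in> U" and X: "w0 p X = 0" "w1 p X = 0" "w2 p X = 0" "w3 p X = 0"
    and Y: "w2 p Y = 0" "w3 p Y = 0"
  shows connection_w0: "ext_d w0 p X Y = - \<psi>0 p X * w0 p Y - \<eta> p X * w1 p Y"
    and connection_w1: "ext_d w1 p X Y = - \<kappa> p X * w0 p Y - \<psi>1 p X * w1 p Y"
    and curvature_psi0: "ext_d \<psi>0 p X Y = - wedge \<eta> \<kappa> p X Y"
    and curvature_eta: "ext_d \<eta> p X Y = - wedge \<psi>0 \<eta> p X Y - wedge \<eta> \<psi>1 p X Y"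
    and curvature_kappa: "ext_d \<kappa> p X Y = - wedge \<kappa> \<psi>0 p X Y - wedge \<psi>1 \<kappa> p X Y"
    and curvature_psi1: "ext_d \<psi>1 p X Y = - wedge \<kappa> \<eta> p X Y"
proof -
  obtain e1 where e1: "w1 p e1 = 1" "w2 p e1 = 0" "w3 p e1 = 0" by (rule dual_vector[OF p])
  \<comment> \<open>This makes the two terms with \<open>\<phi>0\<close> in the derivative of a5 w0
    cancel, so that only -a5 \<theta>2 \<and> w1 remains.\<close>
  have a5: "Diff a5 p X = a5 p * \<phi>0 p X"
    using d_a5[OF p X(3,4) e1(2,3)] X e1 by simp
  note rel = d_phi0_2phi1[OF p X(3,4) Y] d_theta2[OF p X(3,4) Y] d_phi0_3phi1[OF p X(3,4) Y]
  \<comment> \<open>The combinations with factors 2 and 3 in \<open>rel\<close> are solved for the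
    derivatives of \<open>\<phi>1\<close> and \<open>\<phi>0\<close> themselves.\<close>
  have phi1: "ext_d \<phi>1 p X Y = (ext_d \<phi>0 p X Y + 3 * ext_d \<phi>1 p X Y) - (ext_d \<phi>0 p X Y + 2 * ext_d \<phi>1 p X Y)"
    by simp
  have phi0: "ext_d \<phi>0 p X Y = 3 * (ext_d \<phi>0 p X Y + 2 * ext_d \<phi>1 p X Y) - 2 * (ext_d \<phi>0 p X Y + 3 * ext_d \<phi>1 p X Y)"
    by simp
  note rel' = phi0[unfolded rel] phi1[unfolded rel] rel(2)
  note ext = ext_d_add[where U=U, OF _ _ p] ext_d_diff[where U=U, OF _ _ p] ext_d_scale[where U=U, OF _ _ p] form1_on_add[OF U] form1_on_scale[OF U]
    coefficients_smooth coeffs forms Diff_coefficients[OF p]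
  show "ext_d w0 p X Y = - \<psi>0 p X * w0 p Y - \<eta> p X * w1 p Y"
    "ext_d w1 p X Y = - \<kappa> p X * w0 p Y - \<psi>1 p X * w1 p Y"
    by (simp_all add: structure_simps p X Y \<psi>0_def \<psi>1_def \<eta>_def \<kappa>_def algebra_simps)
  have "ext_d \<psi>0 p X Y = ext_d \<phi>0 p X Y + ((2 * Diff a4 p X + 4 * Diff a5 p X) * w0 p Y
      + (2 * a4 p + 4 * a5 p) * ext_d w0 p X Y + (2 * Diff a3 p X * w1 p Y + 2 * a3 p * ext_d w1 p X Y))"
    unfolding \<psi>0_def by (simp add: ext X)
  then show "ext_d \<psi>0 p X Y = - wedge \<eta> \<kappa> p X Y"
    unfolding rel' by (simp add: structure_simps p X Y \<eta>_def \<kappa>_def a5 algebra_simps)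
  have "ext_d \<psi>1 p X Y = ext_d \<phi>0 p X Y + (ext_d \<phi>1 p X Y + ((Diff a4 p X + 4 * Diff a5 p X) * w0 p Y
      + (a4 p + 4 * a5 p) * ext_d w0 p X Y + (Diff a3 p X * w1 p Y + a3 p * ext_d w1 p X Y)))"
    unfolding \<psi>1_def by (simp add: ext X)
  then show "ext_d \<psi>1 p X Y = - wedge \<kappa> \<eta> p X Y"
    unfolding rel' by (simp add: structure_simps p X Y \<eta>_def \<kappa>_def a5 algebra_simps)
  have "ext_d \<eta> p X Y = ext_d \<theta>2 p X Y - (Diff a2 p X * w0 p Y + a2 p * ext_d w0 p X Y)"
    unfolding \<eta>_def by (simp add: ext X)
  then show "ext_d \<eta> p X Y = - wedge \<psi>0 \<eta> p X Y - wedge \<eta> \<psi>1 p X Y"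
    unfolding rel' by (simp add: structure_simps p X Y \<psi>0_def \<psi>1_def \<eta>_def a5 algebra_simps)
  have "ext_d \<kappa> p X Y = - Diff a5 p X * w1 p Y + (- a5 p) * ext_d w1 p X Y"
    unfolding \<kappa>_def ext_d_scale[OF coefficients_smooth(4) forms(2) p] by (simp add: Diff_coefficients[OF p] X)
  then show "ext_d \<kappa> p X Y = - wedge \<kappa> \<psi>0 p X Y - wedge \<psi>1 \<kappa> p X Y"
    by (simp add: structure_simps p X Y \<psi>0_def \<psi>1_def \<kappa>_def a5 algebra_simps)
qed

end

section \<open>Leaf spaces\<close>

lemma leaf_spaceD:
  assumes "leaf_space W K q S"
  shows "open W" "open S" "smooth_on W q" "q ` W = S" "\<And>w. w \<in> W \<Longrightarrow> surj (Diff q w)"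
    "\<And>w v. w \<in> W \<Longrightarrow> Diff q w v = 0 \<longleftrightarrow> v \<in> K w" "\<And>s. s \<in> S \<Longrightarrow> connected {w \<in> W. q w = s}"
  using assms by (auto simp: leaf_space_def)

text \<open>The fibres of \<open>q\<close> are connected, so local constancy on them is enough, and
  this may be tested in charts in which \<open>q\<close> is linear. The values of \<open>h\<close>
  have an arbitrary type because the lemma serves smooth maps as well as set-valued fields of
  kernels.\<close>

lemma leaf_space_fibre_constant:
  fixes q :: "real^'n \<Rightarrow> 'b::euclidean_space" and h :: "real^'n \<Rightarrow> 'c"
  assumes leaf: "leaf_space W K q S" and w: "w \<in> W" "w' \<in> W" "q w = q w'"
    and chart: "\<And>(L :: real^'n \<Rightarrow> 'b) (R :: 'b \<Rightarrow> real^'n) (v0 :: real^'n) r g v v'.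
      linear L \<Longrightarrow> linear R \<Longrightarrow> (\<And>y. L (R y) = y) \<Longrightarrow> smooth_on (ball v0 r) g \<Longrightarrow> g ` ball v0 r \<subseteq> W \<Longrightarrow>
      (\<And>v. v \<in> ball v0 r \<Longrightarrow> q (g v) = L v) \<Longrightarrow> v \<in> ball v0 r \<Longrightarrow> v' \<in> ball v0 r \<Longrightarrow> L v = L v' \<Longrightarrow>
      h (g v) = h (g v')"
  shows "h w = h w'"
proof -
  note leafD = leaf_spaceD[OF leaf]
  let ?F = "{x \<in> W. q x = q w}"
  have "connected ?F" using leafD(4,7) w(1) by blast
  moreover have "\<forall>a\<in>?F. eventually (\<lambda>b. h a = h b) (at a within ?F)"
  proof
    fix a assume a: "a \<in> ?F"
    then have aW: "a \<in> W" by simp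
    obtain L :: "real^'n \<Rightarrow> 'b" and R v0 r N f g where c: "linear L" "linear R" "\<And>y. L (R y) = y" "0 < r"
      "open N" "a \<in> N" "N \<subseteq> W" "homeomorphism N (ball v0 r) f g" "f a = v0" "smooth_on (ball v0 r) g"
      "\<And>v. v \<in> ball v0 r \<Longrightarrow> q (g v) = L v" "\<And>v. v \<in> ball v0 r \<Longrightarrow> bij (Diff g v)"
      by (rule submersion_chart[OF leafD(1,3) aW leafD(5)[OF aW]]) (rule that; assumption)
    have gN: "g ` ball v0 r \<subseteq> W" using c(7,8) by (auto simp: homeomorphism_def)
    have "h a = h b" if b: "b \<in> N" "b \<in> ?F" for b
    proof -
      have fg: "f x \<in> ball v0 r" "g (f x) = x" "L (f x) = q x" if "x \<in> N" for x
        using c(8,11) that by (auto simp: homeomorphism_def)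
      have "L (f a) = L (f b)" using fg(3) a b c(6) by simp
      then have "h (g (f a)) = h (g (f b))"
        using chart[OF c(1-3,10) gN c(11) fg(1)[OF c(6)] fg(1)[OF b(1)]] by simp
      then show ?thesis using fg(2) b(1) c(6) by simp
    qed
    then show "eventually (\<lambda>b. h a = h b) (at a within ?F)"
      using c(5,6) by (auto simp: eventually_at_topological)
  qed
  ultimately show ?thesis using connected_local_const[of ?F w w' h] w by simp
qed

lemma leaf_space_section:
  fixes q :: "real^'n \<Rightarrow> 'b::euclidean_space"
  assumes leaf: "leaf_space W K q S" and "s \<in> S"
  obtains V t where "open V" "s \<in> V" "V \<subseteq> S" "smooth_on V t" "t ` V \<subseteq> W" "\<And>y. y \<in> V \<Longrightarrow> q (t y) = y"
proof -
  note leafD = leaf_spaceD[OF leaf]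
  obtain w where w: "w \<in> W" "q w = s" using leafD(4) assms(2) by auto
  obtain L :: "real^'n \<Rightarrow> 'b" and R v0 r N f g where chart: "linear L" "linear R" "\<And>y. L (R y) = y" "0 < r"
    "open N" "w \<in> N" "N \<subseteq> W" "homeomorphism N (ball v0 r) f g" "f w = v0" "smooth_on (ball v0 r) g"
    "\<And>v. v \<in> ball v0 r \<Longrightarrow> q (g v) = L v" "\<And>v. v \<in> ball v0 r \<Longrightarrow> bij (Diff g v)"
    by (rule submersion_chart[OF leafD(1,3) w(1) leafD(5)[OF w(1)]]) (rule that; assumption)
  note c = chart(1-4,7-9,6,10,11)
  \<comment> \<open>Since \<open>L v0 = s\<close>, this is the affine section of \<open>L\<close>
    through \<open>v0\<close>; \<open>g\<close> turns it into a section of \<open>q\<close>.\<close>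
  define i where "i y = v0 + R (y - s)" for y
  define V where "V = i -` ball v0 r"
  have si: "smooth_on T i" if "open T" for T
    unfolding i_def by (intro smooth_intros that smooth_on_linear_compose'[OF that c(2)])
  have op: "open V"
    unfolding V_def using smooth_on_continuous_on[OF si[OF open_UNIV]]
    by (simp add: continuous_on_open_vimage)
  have "L v0 = s"
    using c(10)[of v0] c(4,7) homeomorphism_apply1[OF c(6,8)] w(2) by simp
  then have qi: "q (g (i y)) = y" if "y \<in> V" for y
    using c(10)[of "i y"] that c(1,3) by (simp add: V_def i_def linear_add linear_diff)
  have gW: "g (i y) \<in> W" if "y \<in> V" for y
    using that c(5,6) by (auto simp: V_def homeomorphism_def)
  show thesis
  proof (rule that[of V "\<lambda>y. g (i y)"])
    show "s \<in> V" using c(2,4) by (simp add: V_def i_def linear_0)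
    show "V \<subseteq> S" using leafD(4) qi gW by (metis imageI subsetI)
    show "smooth_on V (\<lambda>y. g (i y))"
      by (rule smooth_on_compose[OF op open_ball _ c(9) si[OF op]]) (auto simp: V_def)
  qed (use op qi gW in auto)
qed

text \<open>The chain rule for a map that becomes linear in a chart. With the identity for
  \<open>L\<close> it says that the differential of a section, or of an inverse map, is a right
  inverse.\<close>

lemma Diff_linear_chart:
  fixes g :: "'a::euclidean_space \<Rightarrow> 'c::euclidean_space" and q :: "'c \<Rightarrow> 'b::euclidean_space"
  assumes "open B" "smooth_on W q" "smooth_on B g" "g ` B \<subseteq> W" "\<And>v. v \<in> B \<Longrightarrow> q (g v) = L v" "linear L" "x \<in> B"
  shows "Diff q (g x) (Diff g x y) = L y"
proof -
  have gx: "g x \<in> W" using assms(4,7) by auto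
  have "Diff (\<lambda>v. q (g v)) x y = Diff q (g x) (Diff g x y)"
    by (intro Diff_compose smooth_on_differentiable[OF assms(3,7)] smooth_on_differentiable[OF assms(2) gx])
  moreover have "Diff (\<lambda>v. q (g v)) x = Diff L x"
    by (rule Diff_cong_open[OF assms(1,7,5)])
  moreover have "Diff L x = L"
    by (rule Diff_eq[OF linear_imp_has_derivative[OF assms(6)]])
  ultimately show ?thesis by simp
qed

text \<open>In a submersion chart, points of the same fibre are joined by a segment whose image is
  tangent to \<open>K\<close>, and \<open>h\<close> has derivative zero along it. It is later
  applied to the base point in M.\<close>

lemma leaf_space_constant_of_Diff:
  fixes q :: "real^'n \<Rightarrow> 'b::euclidean_space" and h :: "real^'n \<Rightarrow> 'c::euclidean_space"
  assumes leaf: "leaf_space W K q S" and w: "w \<in> W" "w' \<in> W" "q w = q w'"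
    and h: "smooth_on W h" "\<And>x k. x \<in> W \<Longrightarrow> k \<in> K x \<Longrightarrow> Diff h x k = 0"
  shows "h w = h w'"
proof (rule leaf_space_fibre_constant[OF leaf w])
  fix L :: "real^'n \<Rightarrow> 'b" and R and v0 :: "real^'n" and r g v v'
  assume L: "linear L" and g: "smooth_on (ball v0 r) g" "g ` ball v0 r \<subseteq> W"
    "\<And>v. v \<in> ball v0 r \<Longrightarrow> q (g v) = L v" and v: "v \<in> ball v0 r" "v' \<in> ball v0 r" "L v = L v'"
  note leafD = leaf_spaceD[OF leaf]
  have zero: "Diff (\<lambda>v. h (g v)) x (v' - v) = 0" if x: "x \<in> ball v0 r" for x
  proof -
    have gx: "g x \<in> W" using x g by auto
    have "Diff q (g x) (Diff g x k) = L k" for k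
      by (rule Diff_linear_chart[OF open_ball leafD(3) g L x])
    then have "Diff q (g x) (Diff g x (v' - v)) = 0" using v(3) L by (simp add: linear_diff)
    then have "Diff h (g x) (Diff g x (v' - v)) = 0" using leafD(6)[OF gx] h(2)[OF gx] by simp
    then show ?thesis
      using Diff_compose[OF smooth_on_differentiable[OF g(1) x] smooth_on_differentiable[OF h(1) gx]] by simp
  qed
  have sm: "smooth_on (ball v0 r) (\<lambda>v. h (g v))"
    by (rule smooth_on_compose[OF open_ball leafD(1) g(2) h(1) g(1)])
  define c where "c t = v + t *\<^sub>R (v' - v)" for t :: real
  have c: "c t \<in> ball v0 r" if "t \<in> {0..1}" for t
    using convexD_alt[OF convex_ball v(1,2), of t] that by (simp add: c_def algebra_simps)
  have "((\<lambda>t. h (g (c t))) has_derivative (\<lambda>x. 0)) (at t within {0..1})" if "t \<in> {0..1}" for t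
  proof -
    have "(c has_derivative (\<lambda>x. x *\<^sub>R (v' - v))) (at t)"
      unfolding c_def by (auto intro!: derivative_eq_intros)
    from has_derivative_compose[OF this smooth_on_has_derivative[OF sm c[OF that]]]
    show ?thesis
      using zero[OF c[OF that]] linear_scale[OF smooth_on_linear_Diff[OF sm c[OF that]]]
      by (simp add: has_derivative_at_withinI)
  qed
  from has_derivative_zero_unique[OF convex_real_interval(5) this, of 0 1]
  show "h (g v) = h (g v')" by (simp add: c_def)
qed

section \<open>Connection forms\<close>

text \<open>The structure equations of a linear connection with matrix \<open>(p0, e; k, p1)\<close> relative to \<open>(w0, w1)\<close>,
  as far as they involve a vector \<open>X\<close> tangent to the fibres \<open>w0 = w1 = 0\<close>.\<close>

locale connection_forms =
  fixes W :: "'a::euclidean_space set" and w0 w1 p0 e k p1 :: "'a form1"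
  assumes W: "open W"
    and forms: "form1_on W w0" "form1_on W w1" "form1_on W p0" "form1_on W e" "form1_on W k" "form1_on W p1"
    and d_w0: "\<And>x X Y. x \<in> W \<Longrightarrow> w0 x X = 0 \<Longrightarrow> w1 x X = 0 \<Longrightarrow>
      ext_d w0 x X Y = - p0 x X * w0 x Y - e x X * w1 x Y"
    and d_w1: "\<And>x X Y. x \<in> W \<Longrightarrow> w0 x X = 0 \<Longrightarrow> w1 x X = 0 \<Longrightarrow>
      ext_d w1 x X Y = - k x X * w0 x Y - p1 x X * w1 x Y"
    and d_p0: "\<And>x X Y. x \<in> W \<Longrightarrow> w0 x X = 0 \<Longrightarrow> w1 x X = 0 \<Longrightarrow> ext_d p0 x X Y = - wedge e k x X Y"
    and d_e: "\<And>x X Y. x \<in> W \<Longrightarrow> w0 x X = 0 \<Longrightarrow> w1 x X = 0 \<Longrightarrow>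
      ext_d e x X Y = - wedge p0 e x X Y - wedge e p1 x X Y"
    and d_k: "\<And>x X Y. x \<in> W \<Longrightarrow> w0 x X = 0 \<Longrightarrow> w1 x X = 0 \<Longrightarrow>
      ext_d k x X Y = - wedge k p0 x X Y - wedge p1 k x X Y"
    and d_p1: "\<And>x X Y. x \<in> W \<Longrightarrow> w0 x X = 0 \<Longrightarrow> w1 x X = 0 \<Longrightarrow> ext_d p1 x X Y = - wedge k e x X Y"
    and k_vertical: "\<And>x X. x \<in> W \<Longrightarrow> w0 x X = 0 \<Longrightarrow> w1 x X = 0 \<Longrightarrow> k x X = 0"
begin

lemma pullback:
  fixes f :: "'b::euclidean_space \<Rightarrow> 'a"
  assumes V: "open V" "f ` V \<subseteq> W" "smooth_on V f"
  shows "connection_forms V (pullback f w0) (pullback f w1) (pullback f p0) (pullback f e) (pullback f k) (pullback f p1)"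
proof
  note d = forms[THEN ext_d_pullback[OF W _ V]]
  have fW: "f x \<in> W" if "x \<in> V" for x using V(2) that by auto
  show "open V" by fact
  show "form1_on V (pullback f w0)" "form1_on V (pullback f w1)" "form1_on V (pullback f p0)"
    "form1_on V (pullback f e)" "form1_on V (pullback f k)" "form1_on V (pullback f p1)"
    by (rule forms[THEN form1_on_pullback[OF W _ V]])+
  fix x X Y assume x: "x \<in> V" and X: "pullback f w0 x X = 0" "pullback f w1 x X = 0"
  note * = fW[OF x] X[unfolded pullback_def]
  note wedge_pullback = wedge_def pullback_def
  show "ext_d (pullback f w0) x X Y = - pullback f p0 x X * pullback f w0 x Y - pullback f e x X * pullback f w1 x Y"
    unfolding d(1)[OF x] d_w0[OF *] by (simp add: pullback_def)
  show "ext_d (pullback f w1) x X Y = - pullback f k x X * pullback f w0 x Y - pullback f p1 x X * pullback f w1 x Y"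
    unfolding d(2)[OF x] d_w1[OF *] by (simp add: pullback_def)
  show "ext_d (pullback f p0) x X Y = - wedge (pullback f e) (pullback f k) x X Y"
    unfolding d(3)[OF x] d_p0[OF *] by (simp add: wedge_pullback)
  show "ext_d (pullback f e) x X Y = - wedge (pullback f p0) (pullback f e) x X Y - wedge (pullback f e) (pullback f p1) x X Y"
    unfolding d(4)[OF x] d_e[OF *] by (simp add: wedge_pullback)
  show "ext_d (pullback f k) x X Y = - wedge (pullback f k) (pullback f p0) x X Y - wedge (pullback f p1) (pullback f k) x X Y"
    unfolding d(5)[OF x] d_k[OF *] by (simp add: wedge_pullback)
  show "ext_d (pullback f p1) x X Y = - wedge (pullback f k) (pullback f e) x X Y"
    unfolding d(6)[OF x] d_p1[OF *] by (simp add: wedge_pullback)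
  show "pullback f k x X = 0"
    using k_vertical[OF *] by (simp add: pullback_def)
qed

end

section \<open>Transport of kernels along the fibres\<close>

text \<open>With an antiderivative \<open>g\<close> of \<open>\<mu>\<close>, the integrating factor
  exp(-g) makes f exp(-g) constant.\<close>

lemma linear_ode_zero:
  fixes f \<mu> :: "real \<Rightarrow> real"
  assumes f: "\<And>t. t \<in> {0..1} \<Longrightarrow> (f has_real_derivative \<mu> t * f t) (at t)"
    and "continuous_on {0..1} \<mu>" "f 0 = 0"
  shows "f 1 = 0"
proof -
  obtain g where g: "\<And>t. t \<in> {0..1} \<Longrightarrow> (g has_vector_derivative \<mu> t) (at t within {0..1})"
    using antiderivative_continuous[OF assms(2)] by blast
  have "((\<lambda>t. f t * exp (- g t)) has_derivative (\<lambda>h. 0)) (at t within {0..1})" if t: "t \<in> {0..1}" for t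
  proof -
    have "(g has_real_derivative \<mu> t) (at t within {0..1})"
      using g[OF t] by (simp add: has_real_derivative_iff_has_vector_derivative)
    from DERIV_mult[OF has_field_derivative_at_within[OF f[OF t]] DERIV_chain2[OF DERIV_exp DERIV_minus[OF this]]]
    have "((\<lambda>t. f t * exp (- g t)) has_real_derivative 0) (at t within {0..1})"
      by (simp add: algebra_simps)
    then show ?thesis
      unfolding has_field_derivative_def by (rule has_derivative_eq_rhs) auto
  qed
  from has_derivative_zero_unique[OF convex_real_interval(5) this, of 0 1] show ?thesis
    using assms(3) by simp
qed

text \<open>By Cartan's formula, the Lie derivative of \<open>\<alpha>\<close> along a constant
  field in its kernel is the contraction of its exterior derivative, here a multiple of
  \<open>\<alpha>\<close>. So the value of \<open>\<alpha>\<close> on a fixed \<open>y\<close>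
  solves a homogeneous linear equation along the segment, and a zero persists.\<close>

lemma form_kernel_transport:
  fixes \<alpha> \<mu> :: "'a::euclidean_space form1"
  assumes B: "open B" "convex B" and forms: "form1_on B \<alpha>" "form1_on B \<mu>"
    and v: "v \<in> B" "v' \<in> B" and k: "\<And>x. x \<in> B \<Longrightarrow> \<alpha> x (v' - v) = 0"
    and d: "\<And>x. x \<in> B \<Longrightarrow> ext_d \<alpha> x (v' - v) y = \<mu> x (v' - v) * \<alpha> x y"
    and "\<alpha> v y = 0"
  shows "\<alpha> v' y = 0"
proof -
  define c where "c t = v + t *\<^sub>R (v' - v)" for t :: real
  have c: "c t \<in> B" if "t \<in> {0..1}" for t
    using convexD_alt[OF B(2) v, of t] that by (simp add: c_def algebra_simps)
  \<comment> \<open>The second term of \<open>ext_d\<close> drops out because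
    \<open>\<alpha>\<close> vanishes on \<open>v' - v\<close> on all of \<open>B\<close>, not only
    at \<open>x\<close>.\<close>
  have D: "Diff (\<lambda>x. \<alpha> x y) x (v' - v) = \<mu> x (v' - v) * \<alpha> x y" if "x \<in> B" for x
  proof -
    have "Diff (\<lambda>x. \<alpha> x (v' - v)) x = Diff (\<lambda>x. 0) x"
      by (rule Diff_cong_open[OF B(1) that k])
    then show ?thesis using d[OF that] by (simp add: ext_d_def)
  qed
  have "((\<lambda>t. \<alpha> (c t) y) has_real_derivative \<mu> (c t) (v' - v) * \<alpha> (c t) y) (at t)" if "t \<in> {0..1}" for t
  proof -
    have "(c has_derivative (\<lambda>x. x *\<^sub>R (v' - v))) (at t)"
      unfolding c_def by (auto intro!: derivative_eq_intros)
    from has_derivative_compose[OF this smooth_on_has_derivative[OF form1_on_smooth[OF forms(1)] c[OF that], of y]]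
    show ?thesis
      using D[OF c[OF that]] linear_scale[OF smooth_on_linear_Diff[OF form1_on_smooth[OF forms(1)] c[OF that]]]
      by (simp add: has_field_derivative_def mult_commute_abs)
  qed
  moreover have "continuous_on {0..1} (\<lambda>t. \<mu> (c t) (v' - v))"
    by (rule continuous_on_compose2[OF smooth_on_continuous_on[OF form1_on_smooth[OF forms(2)]]])
      (auto simp: c_def intro!: continuous_intros c[unfolded c_def])
  ultimately show ?thesis
    using linear_ode_zero[of "\<lambda>t. \<alpha> (c t) y" "\<lambda>t. \<mu> (c t) (v' - v)"] assms(9) by (simp add: c_def)
qed

context connection_forms
begin

text \<open>In directions killed by \<open>w0\<close>, \<open>w1\<close> and \<open>e\<close>, the
  structure equations reduce to multiples of the form itself, with factors -p0, -p1 and p1 - p0. For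
  \<open>w1\<close> this rests on \<open>k_vertical\<close>, which removes the term with
  \<open>w0\<close>. So each kernel separately is preserved, not only the common one.\<close>

lemma kernel_transport:
  assumes "convex W" and v: "v \<in> W" "v' \<in> W"
    and k: "\<And>x. x \<in> W \<Longrightarrow> w0 x (v' - v) = 0 \<and> w1 x (v' - v) = 0 \<and> e x (v' - v) = 0"
  shows "w0 v y = 0 \<Longrightarrow> w0 v' y = 0" "w1 v y = 0 \<Longrightarrow> w1 v' y = 0" "e v y = 0 \<Longrightarrow> e v' y = 0"
proof -
  have m: "form1_on W (\<lambda>x v. - 1 * p0 x v)" "form1_on W (\<lambda>x v. - 1 * p1 x v)" "form1_on W (\<lambda>x v. p1 x v - p0 x v)"
    by (intro smooth_intros W forms)+
  show "w0 v y = 0 \<Longrightarrow> w0 v' y = 0"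
    by (rule form_kernel_transport[OF W assms(1) forms(1) m(1) v]) (use k d_w0 in auto)
  show "w1 v y = 0 \<Longrightarrow> w1 v' y = 0"
    by (rule form_kernel_transport[OF W assms(1) forms(2) m(2) v]) (use k d_w1 k_vertical in auto)
  have "ext_d e x (v' - v) y = (p1 x (v' - v) - p0 x (v' - v)) * e x y" if "x \<in> W" for x
    using d_e[OF that, of "v' - v" y] k[OF that] by (simp add: wedge_def algebra_simps)
  then show "e v y = 0 \<Longrightarrow> e v' y = 0"
    by (intro form_kernel_transport[OF W assms(1) forms(4) m(3) v]) (use k in auto)
qed

end

text \<open>This is what makes the line fields on the leaf space well defined: the image of the
  kernel of \<open>\<alpha>\<close> is the same from every point of a fibre.\<close>

lemma leaf_space_kernels:
  fixes q :: "real^'n \<Rightarrow> 'b::euclidean_space"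
  assumes "connection_forms W w0 w1 p0 e k p1" and leaf: "leaf_space W (annihilator {w0, w1, e}) q S"
    and w: "w \<in> W" "w' \<in> W" "q w = q w'" and u: "Diff q w u = Diff q w' u'" and \<alpha>: "\<alpha> \<in> {w0, w1, e}"
  shows "\<alpha> w u = 0 \<longleftrightarrow> \<alpha> w' u' = 0"
proof -
  interpret connection_forms W w0 w1 p0 e k p1 by fact
  note leafD = leaf_spaceD[OF leaf]
  \<comment> \<open>The image of the kernel of \<open>\<alpha>\<close> in the tangent space of the
    leaf space. Membership of \<open>Diff q x v\<close> tests \<open>\<alpha>\<close> on
    \<open>v\<close> because the kernel of \<open>Diff q x\<close> lies in that of
    \<open>\<alpha>\<close>.\<close>
  define Z where "Z x = {Diff q x v | v. \<alpha> x v = 0}" for x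
  have \<alpha>_form: "form1_on W \<alpha>" using \<alpha> forms by auto
  have Z: "Diff q x v \<in> Z x \<longleftrightarrow> \<alpha> x v = 0" if x: "x \<in> W" for x v
  proof
    assume "Diff q x v \<in> Z x"
    then obtain v' where v': "Diff q x v = Diff q x v'" "\<alpha> x v' = 0" by (auto simp: Z_def)
    then have "Diff q x (v - v') = 0"
      using linear_diff[OF smooth_on_linear_Diff[OF leafD(3) x]] by simp
    then have "\<alpha> x (v - v') = 0" using leafD(6)[OF x] \<alpha> by (auto simp: annihilator_def)
    then show "\<alpha> x v = 0" using v'(2) linear_diff[OF form1_on_linear[OF \<alpha>_form x]] by simp
  qed (auto simp: Z_def)
  have "Z w = Z w'"
  proof (rule leaf_space_fibre_constant[OF leaf w])
    fix L :: "real^'n \<Rightarrow> 'b" and R and v0 :: "real^'n" and r g v v'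
    assume L: "linear L" and R: "linear R" "\<And>y. L (R y) = y" and g: "smooth_on (ball v0 r) g" "g ` ball v0 r \<subseteq> W"
      "\<And>v. v \<in> ball v0 r \<Longrightarrow> q (g v) = L v" and v: "v \<in> ball v0 r" "v' \<in> ball v0 r" "L v = L v'"
    interpret g: connection_forms "ball v0 r" "pullback g w0" "pullback g w1" "pullback g p0" "pullback g e"
      "pullback g k" "pullback g p1" by (rule pullback[OF open_ball g(2,1)])
    have Dqg: "Diff q (g x) (Diff g x y) = L y" if "x \<in> ball v0 r" for x y
      by (rule Diff_linear_chart[OF open_ball leafD(3) g L that])
    have zero: "pullback g w0 x y = 0 \<and> pullback g w1 x y = 0 \<and> pullback g e x y = 0"
      if "x \<in> ball v0 r" "L y = 0" for x y
    proof -
      have "g x \<in> W" using that(1) g(2) by auto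
      then show ?thesis
        using Dqg[OF that(1), of y] leafD(6)[of "g x" "Diff g x y"] that(2)
        by (simp add: pullback_def annihilator_def)
    qed
    have L0: "L (v' - v) = 0" "L (v - v') = 0" using v(3) L by (simp_all add: linear_diff)
    \<comment> \<open>In the chart the constant vector \<open>R y\<close> lifts \<open>y\<close> at
      both points, so the two sets are compared by evaluating \<open>\<alpha>\<close> on one vector;
      the segment is run through in both directions.\<close>
    have "pullback g \<alpha> v (R y) = 0 \<longleftrightarrow> pullback g \<alpha> v' (R y) = 0" for y
      using g.kernel_transport[OF convex_ball v(1,2), of "R y"] g.kernel_transport[OF convex_ball v(2,1), of "R y"]
        zero L0 \<alpha> by auto
    moreover have "y \<in> Z (g x) \<longleftrightarrow> pullback g \<alpha> x (R y) = 0" if "x \<in> ball v0 r" for x y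
    proof -
      have "g x \<in> W" using that g(2) by auto
      then show ?thesis
        using Z[of "g x" "Diff g x (R y)"] Dqg[OF that, of "R y"] R(2) by (simp add: pullback_def)
    qed
    ultimately show "Z (g v) = Z (g v')" using v by (auto intro!: set_eqI)
  qed
  then show ?thesis using Z[OF w(1), of u] Z[OF w(2), of u'] u by simp
qed

section \<open>The path geometry\<close>

text \<open>The situation on an open part of the leaf space after pulling back along a section: the
  directions common to the kernels of \<open>w0\<close>, \<open>w1\<close> and \<open>e\<close> have
  been divided out.\<close>

locale connection_coframe = connection_forms V w0 w1 p0 e k p1
  for V :: "'a::euclidean_space set" and w0 w1 p0 e k p1 :: "'a form1" +
  assumes coframe: "\<And>y v. y \<in> V \<Longrightarrow> w0 y v = 0 \<Longrightarrow> w1 y v = 0 \<Longrightarrow> e y v = 0 \<Longrightarrow> v = 0"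
begin

lemmas lin = forms[THEN form1_on_linear]

lemma coframe_eq:
  assumes "y \<in> V" "w0 y u = w0 y v" "w1 y u = w1 y v" "e y u = e y v"
  shows "u = v"
  using coframe[of y "u - v"] assms by (simp add: lin[THEN linear_diff])

end

text \<open>Differentiating the constant \<alpha>(X) moves the derivative from the field to the
  form. For two such fields this turns \<alpha> of their bracket into minus the exterior derivative
  of \<alpha>.\<close>

lemma form1_constant_along:
  assumes "open V" "form1_on V \<alpha>" "smooth_on V X" "y \<in> V" "\<And>x. x \<in> V \<Longrightarrow> \<alpha> x (X x) = c"
  shows "\<alpha> y (Diff X y v) = - Diff (\<lambda>x. \<alpha> x (X y)) y v"
proof -
  have 1: "((\<lambda>x. \<alpha> x (X x)) has_derivative (\<lambda>v. Diff (\<lambda>p. \<alpha> p (X y)) y v + \<alpha> y (Diff X y v))) (at y)"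
    by (rule form1_has_derivative[OF assms(1,2,1,4) _ has_derivative_ident smooth_on_has_derivative[OF assms(3,4)]]) auto
  have "Diff (\<lambda>x. \<alpha> x (X x)) y = Diff (\<lambda>x. c) y"
    by (rule Diff_cong_open[OF assms(1,4,5)])
  then have "Diff (\<lambda>x. \<alpha> x (X x)) y v = 0" by simp
  then show ?thesis unfolding Diff_eq[OF 1] by simp
qed

text \<open>The fields are dual to \<open>w1\<close> and \<open>e\<close>. The contact condition
  holds because dw0 contains -e \<and> w1, which gives \<open>w0\<close> the value -1 on their
  bracket.\<close>

lemma connection_coframe_path_geometry:
  fixes V :: "(real^3) set"
  assumes "connection_coframe V w0 w1 p0 e k p1"
    and l1: "\<And>y. y \<in> V \<Longrightarrow> l\<^sub>1 y = {v. w0 y v = 0 \<and> e y v = 0}"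
    and l2: "\<And>y. y \<in> V \<Longrightarrow> l\<^sub>2 y = {v. w0 y v = 0 \<and> w1 y v = 0}"
  obtains X\<^sub>1 X\<^sub>2 where "smooth_on V X\<^sub>1" "smooth_on V X\<^sub>2"
    "\<And>y. y \<in> V \<Longrightarrow> l\<^sub>1 y = span {X\<^sub>1 y} \<and> l\<^sub>2 y = span {X\<^sub>2 y} \<and> span {X\<^sub>1 y, X\<^sub>2 y, lie_bracket X\<^sub>1 X\<^sub>2 y} = UNIV"
proof -
  interpret connection_coframe V w0 w1 p0 e k p1 by fact
  define F where "F y v = (\<chi> i::3. if i = 1 then w0 y v else if i = 2 then w1 y v else e y v)" for y v
  have F_lin: "linear (F y)" if "y \<in> V" for y
    by (rule linearI) (simp_all add: F_def vec_eq_iff lin[OF that, THEN linear_add] lin[OF that, THEN linear_scale])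
  have F_bij: "bij (F y)" if "y \<in> V" for y
  proof -
    have "v = 0" if "F y v = 0" for v
      using that coframe[OF \<open>y \<in> V\<close>, of v] by (simp add: F_def vec_eq_iff forall_3)
    then have "inj (F y)" using F_lin[OF that] linear_injective_0 by blast
    then show ?thesis using linear_injective_imp_surjective[OF F_lin[OF that]] by (simp add: bij_def)
  qed
  have F_smooth: "smooth_on V (\<lambda>y. F y v)" for v
    unfolding F_def
  proof (rule smooth_on_vec_lambda[OF W])
    fix i :: 3
    show "smooth_on V (\<lambda>y. if i = 1 then w0 y v else if i = 2 then w1 y v else e y v)"
      using forms[THEN form1_on_smooth, of v] by (cases "i = 1"; cases "i = 2") auto
  qed
  define X1 where "X1 y = inv (F y) (axis 2 1)" for y
  define X2 where "X2 y = inv (F y) (axis 3 1)" for y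
  have sm: "smooth_on V X1" "smooth_on V X2"
    unfolding X1_def X2_def by (intro smooth_on_inv_linear W F_lin F_bij F_smooth; assumption)+
  have FX: "F y (X1 y) = axis 2 1" "F y (X2 y) = axis 3 1" if "y \<in> V" for y
    using F_bij[OF that] by (simp_all add: X1_def X2_def surj_f_inv_f bij_is_surj)
  have X1: "w0 y (X1 y) = 0" "w1 y (X1 y) = 1" "e y (X1 y) = 0" if "y \<in> V" for y
    using FX(1)[OF that] by (simp_all add: F_def vec_eq_iff forall_3 axis_def)
  have X2: "w0 y (X2 y) = 0" "w1 y (X2 y) = 0" "e y (X2 y) = 1" if "y \<in> V" for y
    using FX(2)[OF that] by (simp_all add: F_def vec_eq_iff forall_3 axis_def)
  have expand: "v = w1 y v *\<^sub>R X1 y + e y v *\<^sub>R X2 y" if "y \<in> V" "w0 y v = 0" for y v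
    using that by (intro coframe_eq[OF that(1)]) (simp_all add: lin[THEN linear_add] lin[THEN linear_scale] X1 X2)
  show thesis
  proof (rule that[OF sm], intro conjI)
    fix y assume y: "y \<in> V"
    show "l\<^sub>1 y = span {X1 y}"
    proof (intro set_eqI iffI)
      fix v assume v: "v \<in> l\<^sub>1 y"
      then have "v = w1 y v *\<^sub>R X1 y" using expand[OF y, of v] l1[OF y] by simp
      then show "v \<in> span {X1 y}" unfolding span_singleton by blast
    next
      fix v assume "v \<in> span {X1 y}"
      then obtain c where "v = c *\<^sub>R X1 y" unfolding span_singleton by blast
      then show "v \<in> l\<^sub>1 y" using X1[OF y] lin[OF y, THEN linear_scale] l1[OF y] by simp
    qed
    show "l\<^sub>2 y = span {X2 y}"
    proof (intro set_eqI iffI)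
      fix v assume v: "v \<in> l\<^sub>2 y"
      then have "v = e y v *\<^sub>R X2 y" using expand[OF y, of v] l2[OF y] by simp
      then show "v \<in> span {X2 y}" unfolding span_singleton by blast
    next
      fix v assume "v \<in> span {X2 y}"
      then obtain c where "v = c *\<^sub>R X2 y" unfolding span_singleton by blast
      then show "v \<in> l\<^sub>2 y" using X2[OF y] lin[OF y, THEN linear_scale] l2[OF y] by simp
    qed
    let ?Z = "lie_bracket X1 X2 y"
    have "w0 y ?Z = - ext_d w0 y (X1 y) (X2 y)"
      using form1_constant_along[OF W forms(1) sm(1) y X1(1), of "X2 y"]
        form1_constant_along[OF W forms(1) sm(2) y X2(1), of "X1 y"]
      by (simp add: lie_bracket_def ext_d_def lin[OF y, THEN linear_diff])
    \<comment> \<open>The equation \<open>d_w0\<close> requires a vertical first argument, and of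
      the two fields \<open>X2\<close> is the vertical one.\<close>
    also have "\<dots> = ext_d w0 y (X2 y) (X1 y)" by (simp add: ext_d_skew[of w0 y "X2 y" "X1 y"])
    also have "\<dots> = - 1" using d_w0[OF y X2(1,2)[OF y], of "X1 y"] X1[OF y] X2[OF y] by simp
    finally have Z: "w0 y ?Z = - 1" .
    have "v \<in> span {X1 y, X2 y, ?Z}" for v
    proof -
      \<comment> \<open>Since \<open>w0\<close> is -1 on the bracket, this sum has no
        \<open>w0\<close> component.\<close>
      let ?u = "v + w0 y v *\<^sub>R ?Z"
      have "w0 y ?u = 0" using lin(1)[OF y] Z by (simp add: linear_add linear_scale)
      from expand[OF y this] have "v = w1 y ?u *\<^sub>R X1 y + e y ?u *\<^sub>R X2 y - w0 y v *\<^sub>R ?Z"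
        by (metis add_diff_cancel_right')
      also have "\<dots> \<in> span {X1 y, X2 y, ?Z}"
        by (intro span_diff span_add span_scale span_base) auto
      finally show ?thesis .
    qed
    then show "span {X1 y, X2 y, ?Z} = UNIV" by auto
  qed
qed

section \<open>The linear connection on the null surface\<close>

lemma Diff_sum2:
  fixes f g h l :: "'c::real_normed_vector \<Rightarrow> real"
  assumes "smooth_on T f" "smooth_on T g" "smooth_on T h" "smooth_on T l" "x \<in> T"
  shows "Diff (\<lambda>p. - f p * g p - h p * l p) x v =
    - Diff f x v * g x - f x * Diff g x v - Diff h x v * l x - h x * Diff l x v"
  by (rule Diff_eq[THEN fun_cong])
    (auto intro!: derivative_eq_intros smooth_on_has_derivative[OF _ assms(5)] assms simp: algebra_simps)

lemma Diff_sum3: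
  fixes f g h l m :: "'c::real_normed_vector \<Rightarrow> real"
  assumes "smooth_on T m" "smooth_on T f" "smooth_on T g" "smooth_on T h" "smooth_on T l" "x \<in> T"
  shows "Diff (\<lambda>p. m p + f p * g p + h p * l p) x v =
    Diff m x v + Diff f x v * g x + f x * Diff g x v + Diff h x v * l x + h x * Diff l x v"
  by (rule Diff_eq[THEN fun_cong])
    (auto intro!: derivative_eq_intros smooth_on_has_derivative[OF _ assms(6)] assms simp: algebra_simps)

text \<open>A product chart whose projection to \<open>B\<close> divides out the directions w0 = w1
  = 0; \<open>B\<close> will be a coordinate domain of the null surface. At fixed \<open>b\<close>,
  the height runs through a curve of coframes of the plane. By \<open>slope\<close> the line w0 = 0
  in the plane never contains the first axis, so a finite number describes it.\<close>

locale connection_box = connection_coframe "B \<times> I" w0 w1 p0 e k p1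
  for B :: "(real^2) set" and I :: "real set" and w0 w1 p0 e k p1 :: "((real^2) \<times> real) form1" +
  fixes z0 :: real
  assumes B: "open B" and I: "open I" "convex I" "z0 \<in> I"
    and vertical: "\<And>x. x \<in> B \<times> I \<Longrightarrow> w0 x (0, 1) = 0" "\<And>x. x \<in> B \<times> I \<Longrightarrow> w1 x (0, 1) = 0"
    and slope: "\<And>x. x \<in> B \<times> I \<Longrightarrow> w0 x (axis 1 1, 0) \<noteq> 0"
begin

abbreviation "a1 \<equiv> axis 1 1 :: real^2"
abbreviation "a2 \<equiv> axis 2 1 :: real^2"

abbreviation "E0 x u \<equiv> w0 x (u, 0)"
abbreviation "E1 x u \<equiv> w1 x (u, 0)"

definition "Det x = E0 x a1 * E1 x a2 - E0 x a2 * E1 x a1"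

lemma horizontal:
  assumes "x \<in> B \<times> I"
  shows "w0 x (u, \<zeta>) = E0 x u" "w1 x (u, \<zeta>) = E1 x u"
proof -
  have "(u, \<zeta>) = (u, 0) + \<zeta> *\<^sub>R (0, 1)" by simp
  then show "w0 x (u, \<zeta>) = E0 x u" "w1 x (u, \<zeta>) = E1 x u"
    using lin[OF assms, THEN linear_add] lin[OF assms, THEN linear_scale] vertical[OF assms] by (metis add.right_neutral scale_zero_right)+
qed

lemma e_vertical: "x \<in> B \<times> I \<Longrightarrow> e x (0, 1) \<noteq> 0"
  using coframe[of x "(0, 1)"] vertical[of x] by (auto simp: zero_prod_def)

lemma E_linear: "x \<in> B \<times> I \<Longrightarrow> linear (E0 x)" "x \<in> B \<times> I \<Longrightarrow> linear (E1 x)"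
  by (rule linearI; use lin[of x, THEN linear_add, of "(_, 0)" "(_, 0)"] lin[of x, THEN linear_scale, of _ "(_, 0)"] in simp)+

lemma E_zero:
  assumes x: "x \<in> B \<times> I" and "E0 x u = 0" "E1 x u = 0"
  shows "u = 0"
proof -
  \<comment> \<open>The vertical summand cancels the \<open>e\<close> component and does not affect
    \<open>w0\<close> and \<open>w1\<close>.\<close>
  let ?v = "(u, 0) + (- e x (u, 0) / e x (0, 1)) *\<^sub>R (0, 1) :: (real^2) \<times> real"
  have "?v = 0"
    by (rule coframe[OF x])
      (use assms vertical[OF x] e_vertical[OF x] in \<open>simp_all only: lin[OF x, THEN linear_add] lin[OF x, THEN linear_scale], simp_all\<close>)
  then show ?thesis by (simp add: zero_prod_def)
qed

lemma Det_nonzero: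
  assumes x: "x \<in> B \<times> I"
  shows "Det x \<noteq> 0"
proof
  assume D: "Det x = 0"
  let ?u = "(E0 x a2) *\<^sub>R a1 - (E0 x a1) *\<^sub>R a2"
  have "?u = 0"
    by (rule E_zero[OF x])
      (use D in \<open>simp_all add: E_linear[OF x, THEN linear_diff] E_linear[OF x, THEN linear_scale] Det_def algebra_simps\<close>)
  then show False using slope[OF x] by (auto simp: vec_eq_iff forall_2 axis_def)
qed

text \<open>For a connection with matrix \<open>(p0, e; k, p1)\<close> in the coframe
  \<open>(E0, E1)\<close>, these are the coframe components of the covariant derivative along
  \<open>u\<close> of the constant field \<open>w\<close>. As \<open>w\<close> is constant, they are
  the components of the Christoffel term.\<close>

definition "G0 x u w = Diff (\<lambda>p. E0 p w) x (u, 0) + p0 x (u, 0) * E0 x w + e x (u, 0) * E1 x w"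
definition "G1 x u w = Diff (\<lambda>p. E1 p w) x (u, 0) + k x (u, 0) * E0 x w + p1 x (u, 0) * E1 x w"

text \<open>Cramer's rule for the vector with components \<open>G0\<close> and \<open>G1\<close>;
  \<open>E_christoffel\<close> is the defining property.\<close>

definition christoffel :: "(real^2) \<times> real \<Rightarrow> real^2 \<Rightarrow> real^2 \<Rightarrow> real^2" where
  "christoffel x u w = ((G0 x u w * E1 x a2 - G1 x u w * E0 x a2) / Det x) *\<^sub>R a1
     + ((E0 x a1 * G1 x u w - E1 x a1 * G0 x u w) / Det x) *\<^sub>R a2"

lemma E_christoffel:
  assumes x: "x \<in> B \<times> I"
  shows "E0 x (christoffel x u w) = G0 x u w" "E1 x (christoffel x u w) = G1 x u w"
  unfolding christoffel_def
  using Det_nonzero[OF x]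
  by (simp_all only: E_linear[OF x, THEN linear_add] E_linear[OF x, THEN linear_scale] real_scaleR_def)
    (simp_all add: field_simps, simp_all add: Det_def algebra_simps)

lemma forms_smooth:
  "smooth_on (B \<times> I) (\<lambda>x. w0 x v)" "smooth_on (B \<times> I) (\<lambda>x. w1 x v)" "smooth_on (B \<times> I) (\<lambda>x. p0 x v)"
  "smooth_on (B \<times> I) (\<lambda>x. e x v)" "smooth_on (B \<times> I) (\<lambda>x. k x v)" "smooth_on (B \<times> I) (\<lambda>x. p1 x v)"
  by (rule forms[THEN form1_on_smooth])+

lemma G_smooth: "smooth_on (B \<times> I) (\<lambda>x. G0 x u w)" "smooth_on (B \<times> I) (\<lambda>x. G1 x u w)"
  unfolding G0_def G1_def by (intro smooth_intros W forms_smooth smooth_on_Diff_const)+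

lemma christoffel_smooth: "smooth_on (B \<times> I) (\<lambda>x. christoffel x u w)"
proof -
  have "smooth_on (B \<times> I) Det" unfolding Det_def by (intro smooth_intros W forms_smooth)
  then show ?thesis
    unfolding christoffel_def
    by (intro smooth_on_add smooth_on_scaleR smooth_on_divide smooth_on_diff smooth_on_mult smooth_on_const
        W forms_smooth G_smooth Det_nonzero)
qed

lemma Diff_vertical:
  assumes x: "x \<in> B \<times> I"
  shows "Diff (\<lambda>p. w0 p v) x (0, 1) = - p0 x (0, 1) * w0 x v - e x (0, 1) * w1 x v"
    "Diff (\<lambda>p. w1 p v) x (0, 1) = - k x (0, 1) * w0 x v - p1 x (0, 1) * w1 x v"
proof -
  have "Diff (\<lambda>p. w0 p (0, 1)) x = Diff (\<lambda>p. 0) x" "Diff (\<lambda>p. w1 p (0, 1)) x = Diff (\<lambda>p. 0) x"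
    by (rule Diff_cong_open[OF W x]; simp add: vertical)+
  then show "Diff (\<lambda>p. w0 p v) x (0, 1) = - p0 x (0, 1) * w0 x v - e x (0, 1) * w1 x v"
    "Diff (\<lambda>p. w1 p v) x (0, 1) = - k x (0, 1) * w0 x v - p1 x (0, 1) * w1 x v"
    using d_w0[OF x vertical[OF x], of v] d_w1[OF x vertical[OF x], of v] by (simp_all add: ext_d_def)
qed

lemma Diff_vertical_connection:
  assumes x: "x \<in> B \<times> I"
  shows "Diff (\<lambda>p. p0 p v) x (0, 1) = Diff (\<lambda>p. p0 p (0, 1)) x v - wedge e k x (0, 1) v"
    "Diff (\<lambda>p. e p v) x (0, 1) = Diff (\<lambda>p. e p (0, 1)) x v - wedge p0 e x (0, 1) v - wedge e p1 x (0, 1) v"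
    "Diff (\<lambda>p. k p v) x (0, 1) = Diff (\<lambda>p. k p (0, 1)) x v - wedge k p0 x (0, 1) v - wedge p1 k x (0, 1) v"
    "Diff (\<lambda>p. p1 p v) x (0, 1) = Diff (\<lambda>p. p1 p (0, 1)) x v - wedge k e x (0, 1) v"
  using d_p0[OF x vertical[OF x], of v] d_e[OF x vertical[OF x], of v] d_k[OF x vertical[OF x], of v]
    d_p1[OF x vertical[OF x], of v] by (simp_all add: ext_d_def)

text \<open>The fibre derivative is commuted past the horizontal one, so that
  \<open>Diff_vertical\<close> applies. The derivatives of the values of the connection forms on (0,
  1) that arise cancel against those in \<open>Diff_vertical_connection\<close>, and the curvature
  equations match the remaining products.\<close>

lemma G_vertical:
  assumes x: "x \<in> B \<times> I"
  shows "Diff (\<lambda>p. G0 p u w) x (0, 1) = - p0 x (0, 1) * G0 x u w - e x (0, 1) * G1 x u w" (is ?th0)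
    and "Diff (\<lambda>p. G1 p u w) x (0, 1) = - k x (0, 1) * G0 x u w - p1 x (0, 1) * G1 x u w" (is ?th1)
proof -
  have "Diff (\<lambda>p. Diff (\<lambda>p. E0 p w) p (u, 0)) x (0, 1) = Diff (\<lambda>p. Diff (\<lambda>p. E0 p w) p (0, 1)) x (u, 0)"
    by (rule Diff_Diff_commute[OF W forms_smooth(1) x])
  also have "Diff (\<lambda>p. Diff (\<lambda>p. E0 p w) p (0, 1)) x = Diff (\<lambda>p. - p0 p (0, 1) * E0 p w - e p (0, 1) * E1 p w) x"
    by (rule Diff_cong_open[OF W x Diff_vertical(1)])
  finally have 0: "Diff (\<lambda>p. Diff (\<lambda>p. E0 p w) p (u, 0)) x (0, 1) = \<dots> (u, 0)" .
  show ?th0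
    unfolding G0_def G1_def Diff_sum3[OF smooth_on_Diff_const[OF forms_smooth(1)] forms_smooth(3,1,4,2) x]
      0 Diff_sum2[OF forms_smooth(3,1,4,2) x] Diff_vertical[OF x] Diff_vertical_connection[OF x] wedge_def
    by (simp add: algebra_simps)
  have "Diff (\<lambda>p. Diff (\<lambda>p. E1 p w) p (u, 0)) x (0, 1) = Diff (\<lambda>p. Diff (\<lambda>p. E1 p w) p (0, 1)) x (u, 0)"
    by (rule Diff_Diff_commute[OF W forms_smooth(2) x])
  also have "Diff (\<lambda>p. Diff (\<lambda>p. E1 p w) p (0, 1)) x = Diff (\<lambda>p. - k p (0, 1) * E0 p w - p1 p (0, 1) * E1 p w) x"
    by (rule Diff_cong_open[OF W x Diff_vertical(2)])
  finally have 1: "Diff (\<lambda>p. Diff (\<lambda>p. E1 p w) p (u, 0)) x (0, 1) = \<dots> (u, 0)" .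
  show ?th1
    unfolding G0_def G1_def Diff_sum3[OF smooth_on_Diff_const[OF forms_smooth(2)] forms_smooth(5,1,6,2) x]
      1 Diff_sum2[OF forms_smooth(5,1,6,2) x] Diff_vertical[OF x] Diff_vertical_connection[OF x] wedge_def
    by (simp add: algebra_simps)
qed

text \<open>Vanishing vertical curvature makes \<open>G\<close> satisfy the same linear equation along the fibres as the
  coframe, so the coefficients of \<open>G\<close> with respect to the coframe are constant on them.\<close>

lemma christoffel_vertical:
  assumes x: "x \<in> B \<times> I"
  shows "Diff (\<lambda>p. christoffel p u w) x (0, 1) = 0"
proof -
  let ?T = "\<lambda>p. christoffel p u w"
  have T: "((\<lambda>p. (?T p, 0::real)) has_derivative (\<lambda>v. (Diff ?T x v, 0))) (at x)"
    by (intro has_derivative_Pair smooth_on_has_derivative[OF christoffel_smooth x] has_derivative_const)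
  have *: "Diff (\<lambda>p. \<alpha> p (?T x, 0)) x (0, 1) + \<alpha> x (Diff ?T x (0, 1), 0) = Diff G x (0, 1)"
    if "form1_on (B \<times> I) \<alpha>" "\<And>p. p \<in> B \<times> I \<Longrightarrow> \<alpha> p (?T p, 0) = G p" for \<alpha> G
  proof -
    have 1: "((\<lambda>p. \<alpha> p (?T p, 0)) has_derivative (\<lambda>v. Diff (\<lambda>p. \<alpha> p (?T x, 0)) x v + \<alpha> x (Diff ?T x v, 0))) (at x)"
      by (rule form1_has_derivative[OF W that(1) W x _ has_derivative_ident T]) auto
    have "Diff (\<lambda>p. \<alpha> p (?T p, 0)) x = Diff G x"
      by (rule Diff_cong_open[OF W x that(2)])
    from fun_cong[OF this, of "(0, 1)"] show ?thesis unfolding Diff_eq[OF 1] .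
  qed
  show ?thesis
  proof (rule E_zero[OF x])
    show "E0 x (Diff ?T x (0, 1)) = 0"
      using *[OF forms(1) E_christoffel(1)] by (simp add: Diff_vertical[OF x] G_vertical[OF x] E_christoffel[OF x])
    show "E1 x (Diff ?T x (0, 1)) = 0"
      using *[OF forms(2) E_christoffel(2)] by (simp add: Diff_vertical[OF x] G_vertical[OF x] E_christoffel[OF x])
  qed
qed

end

lemma constant_on_vertical_segment:
  fixes f :: "'a::euclidean_space \<times> real \<Rightarrow> 'b::euclidean_space"
  assumes "convex I" "smooth_on (B \<times> I) f" "\<And>x. x \<in> B \<times> I \<Longrightarrow> Diff f x (0, 1) = 0"
    and "b \<in> B" "z \<in> I" "z' \<in> I"
  shows "f (b, z) = f (b, z')"
proof (rule has_derivative_zero_unique[OF assms(1) _ assms(5,6)])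
  fix t assume t: "t \<in> I"
  then have bt: "(b, t) \<in> B \<times> I" using assms(4) by simp
  have "((\<lambda>t. (b, t)) has_derivative (\<lambda>s. (0, s))) (at t)"
    by (auto intro!: derivative_eq_intros)
  from has_derivative_compose[OF this smooth_on_has_derivative[OF assms(2) bt]]
  have "((\<lambda>t. f (b, t)) has_derivative (\<lambda>s. Diff f (b, t) (0, s))) (at t)" .
  moreover have "Diff f (b, t) (0, s) = 0" for s
    using linear_scale[OF smooth_on_linear_Diff[OF assms(2) bt], of s "(0, 1)"] assms(3)[OF bt] by simp
  ultimately show "((\<lambda>t. f (b, t)) has_derivative (\<lambda>h. 0)) (at t within I)"
    by (simp add: has_derivative_at_withinI)
qed

context connection_box
begin

definition "\<Gamma> b = christoffel (b, z0)"

lemma Gamma_eq: "x \<in> B \<times> I \<Longrightarrow> \<Gamma> (fst x) u w = christoffel x u w"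
  unfolding \<Gamma>_def
  using constant_on_vertical_segment[OF I(2) christoffel_smooth[of u w] christoffel_vertical, of "fst x" z0 "snd x"] I(3)
  by (cases x) auto

lemma Gamma_connection: "linear_connection_on B \<Gamma>"
  unfolding linear_connection_on_def
proof (intro conjI ballI allI)
  fix b assume "b \<in> B"
  then have x: "(b, z0) \<in> B \<times> I" using I(3) by simp
  let ?x = "(b, z0)"
  have D: "linear (\<lambda>w. Diff (\<lambda>p. E0 p w) ?x v)" "linear (\<lambda>w. Diff (\<lambda>p. E1 p w) ?x v)" for v
  proof -
    have "linear (\<lambda>w::real^2. (w, 0::real))" by (rule linearI) simp_all
    from linear_compose[OF this form1_Diff_linear[OF W forms(1) x]] linear_compose[OF this form1_Diff_linear[OF W forms(2) x]]
    show "linear (\<lambda>w. Diff (\<lambda>p. E0 p w) ?x v)" "linear (\<lambda>w. Diff (\<lambda>p. E1 p w) ?x v)" by (simp_all add: o_def)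
  qed
  have L: "linear (\<lambda>u. \<alpha> (u, 0::real))" if "linear \<alpha>" for \<alpha> :: "(real^2) \<times> real \<Rightarrow> real"
    using linear_compose[OF _ that, of "\<lambda>u. (u, 0)"] by (simp add: o_def linear_iff)
  have Dlin: "linear (Diff (\<lambda>p. E0 p w) ?x)" "linear (Diff (\<lambda>p. E1 p w) ?x)" for w
    by (rule smooth_on_linear_Diff[OF forms_smooth(1) x], rule smooth_on_linear_Diff[OF forms_smooth(2) x])
  have mult: "linear (\<lambda>u. f u * c)" "linear (\<lambda>u. c * f u)" if "linear f" for f :: "real^2 \<Rightarrow> real" and c
    using linear_compose_scale_right[OF that, of c] by (simp_all add: mult.commute)
  have G: "bilinear (G0 ?x)" "bilinear (G1 ?x)"
    unfolding bilinear_def G0_def G1_def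
    by (intro conjI allI linear_compose_add mult D
        L[OF Dlin(1)] L[OF Dlin(2)] L[OF lin(3)[OF x]] L[OF lin(4)[OF x]] L[OF lin(5)[OF x]] L[OF lin(6)[OF x]]
        E_linear[OF x])+
  show "bilinear (\<Gamma> b)"
    using bilinear_ladd[OF G(1)] bilinear_ladd[OF G(2)] bilinear_radd[OF G(1)] bilinear_radd[OF G(2)]
      bilinear_lmul[OF G(1)] bilinear_lmul[OF G(2)] bilinear_rmul[OF G(1)] bilinear_rmul[OF G(2)]
    unfolding bilinear_def \<Gamma>_def christoffel_def
    by (auto intro!: linearI simp: algebra_simps add_divide_distrib diff_divide_distrib scaleR_add_left scaleR_diff_left)
next
  fix u v
  have "smooth_on B (\<lambda>b. (b, z0))" by (intro smooth_intros B)
  then show "smooth_on B (\<lambda>b. \<Gamma> b u v)"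
    unfolding \<Gamma>_def by (intro smooth_on_compose[OF B W _ christoffel_smooth]) (use I(3) in auto)
qed

text \<open>The horizontal part is the definition of \<open>\<Gamma>\<close>, the vertical part is
  \<open>Diff_vertical\<close>. Both fit one formula because \<open>\<Gamma>\<close> does not depend
  on the height.\<close>

lemma Diff_E0:
  assumes x: "x \<in> B \<times> I"
  shows "Diff (\<lambda>p. E0 p w) x (u, \<zeta>) = E0 x (\<Gamma> (fst x) u w) - p0 x (u, \<zeta>) * E0 x w - e x (u, \<zeta>) * E1 x w"
proof -
  have split: "(u, \<zeta>) = (u, 0) + \<zeta> *\<^sub>R (0, 1)" by simp
  have *: "\<alpha> (u, \<zeta>) = \<alpha> (u, 0) + \<zeta> * \<alpha> (0, 1)" if "linear \<alpha>" for \<alpha> :: "(real^2) \<times> real \<Rightarrow> real"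
    unfolding split by (simp only: linear_add[OF that] linear_scale[OF that] real_scaleR_def)
  show ?thesis
    unfolding *[OF smooth_on_linear_Diff[OF forms_smooth(1) x]] *[OF lin(3)[OF x]] *[OF lin(4)[OF x]]
      Diff_vertical[OF x] Gamma_eq[OF x] E_christoffel[OF x] G0_def
    by (simp add: algebra_simps)
qed

text \<open>\<open>E0 a2 / E0 a1\<close> is a coordinate on the directions \<open>w0 = 0\<close>; by the contact condition it is strictly
  monotone along the fibres.\<close>

lemma slope_injective:
  assumes x: "(b, z) \<in> B \<times> I" "(b, z') \<in> B \<times> I" and ker: "{u. E0 (b, z) u = 0} = {u. E0 (b, z') u = 0}"
  shows "z = z'"
proof (rule ccontr)
  assume "z \<noteq> z'"
  define \<rho> where "\<rho> x = E0 x a2 / E0 x a1" for x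
  have "E0 (b, z) (a2 - \<rho> (b, z) *\<^sub>R a1) = 0"
    using slope[OF x(1)] by (simp add: E_linear[OF x(1), THEN linear_diff] E_linear[OF x(1), THEN linear_scale] \<rho>_def)
  then have "E0 (b, z') (a2 - \<rho> (b, z) *\<^sub>R a1) = 0" using ker by blast
  then have eq: "\<rho> (b, z) = \<rho> (b, z')"
    using slope[OF x(2)] by (simp add: E_linear[OF x(2), THEN linear_diff] E_linear[OF x(2), THEN linear_scale] \<rho>_def field_simps)
  have der: "((\<lambda>t. \<rho> (b, t)) has_real_derivative - e (b, t) (0, 1) * Det (b, t) / (E0 (b, t) a1)\<^sup>2) (at t)"
    if "t \<in> I" for t
  proof -
    have bt: "(b, t) \<in> B \<times> I" using that x by simp
    have E: "((\<lambda>t. E0 (b, t) u) has_real_derivative Diff (\<lambda>p. E0 p u) (b, t) (0, 1)) (at t)" for u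
    proof -
      have "((\<lambda>t. (b, t)) has_derivative (\<lambda>s. (0, s))) (at t)"
        by (auto intro!: derivative_eq_intros)
      from has_derivative_compose[OF this smooth_on_has_derivative[OF forms_smooth(1)[of "(u, 0)"] bt]]
      have d: "((\<lambda>t. E0 (b, t) u) has_derivative (\<lambda>s. Diff (\<lambda>p. E0 p u) (b, t) (0, s))) (at t)" .
      have s: "Diff (\<lambda>p. E0 p u) (b, t) (0, s) = s * Diff (\<lambda>p. E0 p u) (b, t) (0, 1)" for s
        using linear_scale[OF smooth_on_linear_Diff[OF forms_smooth(1)[of "(u, 0)"] bt], of s "(0, 1)"] by simp
      show ?thesis
        unfolding has_field_derivative_def
        by (rule has_derivative_eq_rhs[OF d], rule ext, subst s, rule mult.commute)
    qed
    show ?thesis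
      unfolding \<rho>_def
      by (rule DERIV_cong[OF DERIV_divide[OF E E slope[OF bt]]])
        (simp add: Diff_vertical[OF bt] Det_def power2_eq_square algebra_simps)
  qed
  have neq: "- e (b, t) (0, 1) * Det (b, t) / (E0 (b, t) a1)\<^sup>2 \<noteq> 0" if "t \<in> I" for t
  proof -
    have bt: "(b, t) \<in> B \<times> I" using that x by simp
    show ?thesis using e_vertical[OF bt] Det_nonzero[OF bt] slope[OF bt] by simp
  qed
  have False if st: "s < t" "s \<in> I" "t \<in> I" "\<rho> (b, s) = \<rho> (b, t)" for s t
  proof -
    have sub: "{s..t} \<subseteq> I"
      using closed_segment_subset[OF st(2,3) I(2)] st(1) by (simp add: closed_segment_eq_real_ivl)
    have "\<exists>y>s. y < t \<and> \<rho> (b, t) - \<rho> (b, s) = (t - s) * (- e (b, y) (0, 1) * Det (b, y) / (E0 (b, y) a1)\<^sup>2)"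
      by (rule MVT2[OF st(1)]) (use der sub in auto)
    then obtain y where "s < y" "y < t"
      "\<rho> (b, t) - \<rho> (b, s) = (t - s) * (- e (b, y) (0, 1) * Det (b, y) / (E0 (b, y) a1)\<^sup>2)" by blast
    moreover have "y \<in> I" using sub calculation by auto
    ultimately show False using neq[of y] st by auto
  qed
  then show False using \<open>z \<noteq> z'\<close> eq x by (metis linorder_neq_iff mem_Sigma_iff)
qed

end

section \<open>Geodesics and lifted curves\<close>

lemma smooth_curve_velocity:
  fixes \<gamma> :: "real \<Rightarrow> 'a::real_normed_vector"
  assumes "open J" "smooth_on J \<gamma>" "t \<in> J"
  shows "velocity \<gamma> t = Diff \<gamma> t 1" "(\<gamma> has_derivative (\<lambda>r. r *\<^sub>R velocity \<gamma> t)) (at t)"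
    "(velocity \<gamma> has_derivative (\<lambda>r. r *\<^sub>R velocity (velocity \<gamma>) t)) (at t)"
proof -
  have D: "Diff \<gamma> s = (\<lambda>r. r *\<^sub>R velocity \<gamma> s)" if "s \<in> J" for s
    by (rule frechet_derivative_eq_vector_derivative[OF smooth_on_differentiable[OF assms(2) that]])
  then show "velocity \<gamma> t = Diff \<gamma> t 1" using assms(3) by simp
  show "(\<gamma> has_derivative (\<lambda>r. r *\<^sub>R velocity \<gamma> t)) (at t)"
    using smooth_on_has_derivative[OF assms(2,3)] D[OF assms(3)] by simp
  have "smooth_on J (velocity \<gamma>)"
    by (rule smooth_on_cong[OF assms(1) smooth_on_Diff_const[OF assms(2), of 1]]) (simp add: D)
  note sv = this
  have "Diff (velocity \<gamma>) t = (\<lambda>r. r *\<^sub>R velocity (velocity \<gamma>) t)"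
    by (rule frechet_derivative_eq_vector_derivative[OF smooth_on_differentiable[OF sv assms(3)]])
  then show "(velocity \<gamma> has_derivative (\<lambda>r. r *\<^sub>R velocity (velocity \<gamma>) t)) (at t)"
    using smooth_on_has_derivative[OF sv assms(3)] by simp
qed

context connection_box
begin

text \<open>Differentiating E0(b') = 0 along the lift \<open>c\<close> gives E0(b'' + \<Gamma>(b',
  b')) = e(c') E1(b'). Here E1(b') is nonzero, since b' is nonzero and killed by \<open>E0\<close>;
  and a vector is a multiple of b' iff \<open>E0\<close> kills it.\<close>

lemma geodesic_iff:
  assumes J: "open J" and c: "smooth_on J c" "c ` J \<subseteq> B \<times> I"
    and b: "\<And>t. t \<in> J \<Longrightarrow> velocity (\<lambda>t. fst (c t)) t \<noteq> 0 \<and> E0 (c t) (velocity (\<lambda>t. fst (c t)) t) = 0"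
  shows "unparametrized_geodesic \<Gamma> J (\<lambda>t. fst (c t)) \<longleftrightarrow> (\<forall>t\<in>J. e (c t) (velocity c t) = 0)"
proof -
  let ?b = "\<lambda>t. fst (c t)"
  have "(\<exists>\<kappa>. velocity (velocity ?b) t + \<Gamma> (?b t) (velocity ?b t) (velocity ?b t) = \<kappa> *\<^sub>R velocity ?b t) \<longleftrightarrow>
      e (c t) (velocity c t) = 0" if t: "t \<in> J" for t
  proof -
    have x: "c t \<in> B \<times> I" using t c(2) by auto
    have sb: "smooth_on J ?b" by (rule smooth_on_fst[OF J c(1)])
    define b' b'' where "b' = velocity ?b t" and "b'' = velocity (velocity ?b) t"
    obtain u \<zeta> where u: "velocity c t = (u, \<zeta>)" by fastforce
    have "Diff ?b t 1 = fst (Diff c t 1)"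
      by (rule Diff_linear_compose[OF bounded_linear_fst smooth_on_differentiable[OF c(1) t]])
    then have "u = b'"
      using u smooth_curve_velocity(1)[OF J sb t] smooth_curve_velocity(1)[OF J c(1) t] by (simp add: b'_def)
    then have c': "velocity c t = (b', \<zeta>)" using u by simp
    have "((\<lambda>s. (velocity ?b s, 0::real)) has_derivative (\<lambda>r. (r *\<^sub>R b'', 0))) (at t)"
      unfolding b''_def by (intro has_derivative_Pair smooth_curve_velocity(3)[OF J sb t] has_derivative_const)
    from form1_has_derivative[OF W forms(1) J t c(2) smooth_curve_velocity(2)[OF J c(1) t] this]
    have d: "((\<lambda>s. E0 (c s) (velocity ?b s)) has_derivative
        (\<lambda>r. Diff (\<lambda>p. E0 p b') (c t) (r *\<^sub>R (b', \<zeta>)) + E0 (c t) (r *\<^sub>R b''))) (at t)"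
      by (simp add: b'_def[symmetric] c')
    have "Diff (\<lambda>s. E0 (c s) (velocity ?b s)) t = Diff (\<lambda>s. 0) t"
      by (rule Diff_cong_open[OF J t]) (use b in simp)
    then have "Diff (\<lambda>s. E0 (c s) (velocity ?b s)) t 1 = 0" by simp
    then have "Diff (\<lambda>p. E0 p b') (c t) (b', \<zeta>) + E0 (c t) b'' = 0"
      unfolding Diff_eq[OF d] by simp
    moreover have b'0: "b' \<noteq> 0" "E0 (c t) b' = 0" using b[OF t] by (simp_all add: b'_def)
    ultimately have key: "E0 (c t) (b'' + \<Gamma> (?b t) b' b') = e (c t) (velocity c t) * E1 (c t) b'"
      by (simp add: Diff_E0[OF x] c' E_linear(1)[OF x, THEN linear_add])
    have E1: "E1 (c t) b' \<noteq> 0" using E_zero[OF x b'0(2)] b'0(1) by blast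
    show ?thesis
      unfolding b'_def[symmetric] b''_def[symmetric]
    proof
      assume "\<exists>\<kappa>. b'' + \<Gamma> (?b t) b' b' = \<kappa> *\<^sub>R b'"
      then have "E0 (c t) (b'' + \<Gamma> (?b t) b' b') = 0"
        using b'0(2) E_linear(1)[OF x, THEN linear_scale] by auto
      then show "e (c t) (velocity c t) = 0" using key E1 by simp
    next
      assume e0: "e (c t) (velocity c t) = 0"
      define v where "v = b'' + \<Gamma> (?b t) b' b'"
      \<comment> \<open>Both vectors are killed by \<open>E0\<close>, so the ratio of their
        \<open>E1\<close> components is the only possible factor.\<close>
      have "v - (E1 (c t) v / E1 (c t) b') *\<^sub>R b' = 0"
        by (rule E_zero[OF x])
          (use key e0 b'0 E1 in \<open>simp_all add: v_def[symmetric] E_linear[OF x, THEN linear_diff] E_linear[OF x, THEN linear_scale]\<close>)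
      then have "v = (E1 (c t) v / E1 (c t) b') *\<^sub>R b'" by simp
      then show "\<exists>\<kappa>. b'' + \<Gamma> (?b t) b' b' = \<kappa> *\<^sub>R b'"
        unfolding v_def[symmetric] by blast
    qed
  qed
  then show ?thesis unfolding unparametrized_geodesic_def using b by blast
qed

text \<open>Through \<open>\<Phi>\<close> the image of \<open>l\<^sub>1\<close> in the plane is the
  line E0 = 0. Hence a direction determines its height by \<open>slope_injective\<close>, and a
  curve tangent to these directions below already satisfies w0 = 0 above, so that it lies in
  \<open>l\<^sub>1\<close> iff \<open>e\<close> vanishes on it.\<close>

lemma projective_path_geometry_chart:
  fixes \<Phi> :: "real^3 \<Rightarrow> (real^2) \<times> real"
  assumes S': "open S'" and hom: "homeomorphism S' (B \<times> I) \<Phi> g"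
    and sm: "smooth_on S' \<Phi>" "smooth_on (B \<times> I) g"
    and l1: "\<And>y v. y \<in> S' \<Longrightarrow> v \<in> l\<^sub>1 y \<longleftrightarrow> w0 (\<Phi> y) (Diff \<Phi> y v) = 0 \<and> e (\<Phi> y) (Diff \<Phi> y v) = 0"
    and l2: "\<And>y v. y \<in> S' \<Longrightarrow> v \<in> l\<^sub>2 y \<longleftrightarrow> w0 (\<Phi> y) (Diff \<Phi> y v) = 0 \<and> w1 (\<Phi> y) (Diff \<Phi> y v) = 0"
  shows "projective_path_geometry S' l\<^sub>1 l\<^sub>2 (\<lambda>y. fst (\<Phi> y)) B \<Gamma>"
proof -
  let ?p = "\<lambda>y. fst (\<Phi> y)"
  have \<Phi>: "\<Phi> y \<in> B \<times> I" "g (\<Phi> y) = y" if "y \<in> S'" for y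
    using hom that by (auto simp: homeomorphism_def)
  have g: "g x \<in> S'" "\<Phi> (g x) = x" if "x \<in> B \<times> I" for x
    using hom that by (auto simp: homeomorphism_def)
  have D\<Phi>g: "Diff \<Phi> y (Diff g (\<Phi> y) X) = X" if "y \<in> S'" for y X
    using Diff_linear_chart[OF W sm _ g(2) linear_ident \<Phi>(1)[OF that], of X] g(1) \<Phi>(2)[OF that] by auto
  have Dp: "Diff ?p y v = fst (Diff \<Phi> y v)" if "y \<in> S'" for y v
    by (rule Diff_linear_compose[OF bounded_linear_fst smooth_on_differentiable[OF sm(1) that]])
  have image_l1: "Diff ?p y ` l\<^sub>1 y = {u. E0 (\<Phi> y) u = 0}" if y: "y \<in> S'" for y
  proof (intro set_eqI iffI)
    fix u assume "u \<in> Diff ?p y ` l\<^sub>1 y"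
    then obtain v where v: "v \<in> l\<^sub>1 y" "u = fst (Diff \<Phi> y v)" using Dp[OF y] by auto
    then show "u \<in> {u. E0 (\<Phi> y) u = 0}"
      using l1[OF y] horizontal(1)[OF \<Phi>(1)[OF y], of u "snd (Diff \<Phi> y v)"] by simp
  next
    fix u assume u: "u \<in> {u. E0 (\<Phi> y) u = 0}"
    note x = \<Phi>(1)[OF y]
    \<comment> \<open>The lift of \<open>u\<close> on which \<open>e\<close> vanishes; such a lift
      exists because \<open>e\<close> is nonzero on the vertical direction.\<close>
    let ?X = "(u, 0) + (- e (\<Phi> y) (u, 0) / e (\<Phi> y) (0, 1)) *\<^sub>R (0, 1)"
    have "w0 (\<Phi> y) ?X = 0" "e (\<Phi> y) ?X = 0"
      using u vertical[OF x] e_vertical[OF x]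
      by (simp_all only: lin[OF x, THEN linear_add] lin[OF x, THEN linear_scale], simp_all)
    then have "Diff g (\<Phi> y) ?X \<in> l\<^sub>1 y" using l1[OF y] D\<Phi>g[OF y] by simp
    moreover have "u = Diff ?p y (Diff g (\<Phi> y) ?X)" using Dp[OF y] D\<Phi>g[OF y] by simp
    ultimately show "u \<in> Diff ?p y ` l\<^sub>1 y" by (rule image_eqI[rotated])
  qed
  have "leaf_space S' l\<^sub>2 ?p B"
    unfolding leaf_space_def
  proof (intro conjI ballI)
    show "open S'" "open B" by (rule S' B)+
    show "smooth_on S' ?p" by (rule smooth_on_fst[OF S' sm(1)])
    show "?p ` S' = B"
    proof (intro set_eqI iffI)
      fix b assume "b \<in> B"
      then have "(b, z0) \<in> B \<times> I" using I(3) by simp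
      then show "b \<in> ?p ` S'" using g[of "(b, z0)"] by (intro image_eqI[of _ _ "g (b, z0)"]) auto
    qed (use \<Phi>(1) in \<open>auto simp: mem_Times_iff\<close>)
    fix y assume y: "y \<in> S'"
    show "surj (Diff ?p y)"
      by (rule surjI[of _ "\<lambda>u. Diff g (\<Phi> y) (u, 0)"]) (simp add: Dp[OF y] D\<Phi>g[OF y])
    show "{v. Diff ?p y v = 0} = l\<^sub>2 y"
    proof (intro set_eqI)
      fix v
      note x = \<Phi>(1)[OF y]
      obtain u \<zeta> where u: "Diff \<Phi> y v = (u, \<zeta>)" by fastforce
      have "v \<in> l\<^sub>2 y \<longleftrightarrow> E0 (\<Phi> y) u = 0 \<and> E1 (\<Phi> y) u = 0"
        using l2[OF y, of v] horizontal[OF x, of u \<zeta>] by (simp add: u)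
      also have "\<dots> \<longleftrightarrow> u = 0"
        using E_zero[OF x, of u] E_linear[OF x, THEN linear_0] by blast
      finally show "v \<in> {v. Diff ?p y v = 0} \<longleftrightarrow> v \<in> l\<^sub>2 y" using Dp[OF y, of v] u by simp
    qed
  next
    fix b assume b: "b \<in> B"
    have "{y \<in> S'. ?p y = b} = g ` ({b} \<times> I)"
    proof (intro set_eqI iffI)
      fix y assume "y \<in> {y \<in> S'. ?p y = b}"
      then have "y = g (b, snd (\<Phi> y))" "snd (\<Phi> y) \<in> I"
        using \<Phi>[of y] by (auto simp: mem_Times_iff)
      then show "y \<in> g ` ({b} \<times> I)" by auto
    qed (use b g in auto)
    moreover have "connected ({b} \<times> I)"
      using convex_connected[OF convex_Times[OF convex_singleton I(2)]] by blast
    moreover have "continuous_on ({b} \<times> I) g"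
      using b by (auto intro: continuous_on_subset[OF smooth_on_continuous_on[OF sm(2)]])
    ultimately show "connected {y \<in> S'. ?p y = b}"
      by (simp add: connected_continuous_image)
  qed
  moreover have "inj_on (\<lambda>y. (?p y, Diff ?p y ` l\<^sub>1 y)) S'"
  proof (rule inj_onI)
    fix y y' assume y: "y \<in> S'" "y' \<in> S'" and "(?p y, Diff ?p y ` l\<^sub>1 y) = (?p y', Diff ?p y' ` l\<^sub>1 y')"
    then have eq: "?p y = ?p y'" "{u. E0 (\<Phi> y) u = 0} = {u. E0 (\<Phi> y') u = 0}"
      using image_l1 by auto
    obtain b z z' where bz: "\<Phi> y = (b, z)" "\<Phi> y' = (b, z')" using eq(1) by (metis prod.collapse)
    have "z = z'"
      by (rule slope_injective[OF _ _ eq(2)[unfolded bz]]) (use \<Phi>(1)[OF y(1)] \<Phi>(1)[OF y(2)] bz in auto)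
    then have "\<Phi> y = \<Phi> y'" using bz by simp
    then have "g (\<Phi> y) = g (\<Phi> y')" by (rule arg_cong)
    then show "y = y'" unfolding \<Phi>(2)[OF y(1)] \<Phi>(2)[OF y(2)] .
  qed
  moreover have "unparametrized_geodesic \<Gamma> {\<alpha><..<\<beta>} (?p \<circ> \<gamma>) \<longleftrightarrow> (\<forall>t\<in>{\<alpha><..<\<beta>}. velocity \<gamma> t \<in> l\<^sub>1 (\<gamma> t))"
    if \<gamma>: "smooth_on {\<alpha><..<\<beta>} \<gamma>" "\<gamma> ` {\<alpha><..<\<beta>} \<subseteq> S'"
      and v: "\<forall>t\<in>{\<alpha><..<\<beta>}. velocity (?p \<circ> \<gamma>) t \<noteq> 0 \<and> velocity (?p \<circ> \<gamma>) t \<in> Diff ?p (\<gamma> t) ` l\<^sub>1 (\<gamma> t)"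
    for \<alpha> \<beta> \<gamma>
  proof -
    let ?J = "{\<alpha><..<\<beta>}"
    define c where "c t = \<Phi> (\<gamma> t)" for t
    have c: "smooth_on ?J c" unfolding c_def by (rule smooth_on_compose[OF open_greaterThanLessThan S' \<gamma>(2) sm(1) \<gamma>(1)])
    have pc: "?p \<circ> \<gamma> = (\<lambda>t. fst (c t))" by (simp add: fun_eq_iff c_def)
    have J: "open ?J" by simp
    have E0: "E0 (c t) (velocity (\<lambda>t. fst (c t)) t) = 0" if t: "t \<in> ?J" for t
    proof -
      have y: "\<gamma> t \<in> S'" using \<gamma>(2) t by auto
      have "velocity (\<lambda>t. fst (c t)) t \<in> Diff ?p (\<gamma> t) ` l\<^sub>1 (\<gamma> t)" using v t unfolding pc by blast
      then show ?thesis unfolding image_l1[OF y] by (simp add: c_def)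
    qed
    have "velocity \<gamma> t \<in> l\<^sub>1 (\<gamma> t) \<longleftrightarrow> e (c t) (velocity c t) = 0" if t: "t \<in> ?J" for t
    proof -
      have y: "\<gamma> t \<in> S'" using \<gamma>(2) t by auto
      have vc: "velocity c t = Diff \<Phi> (\<gamma> t) (velocity \<gamma> t)"
        unfolding smooth_curve_velocity(1)[OF J c t] smooth_curve_velocity(1)[OF J \<gamma>(1) t] unfolding c_def
        by (rule Diff_compose[OF smooth_on_differentiable[OF \<gamma>(1) t] smooth_on_differentiable[OF sm(1) y]])
      have "fst (velocity c t) = velocity (\<lambda>t. fst (c t)) t"
        unfolding smooth_curve_velocity(1)[OF J c t] smooth_curve_velocity(1)[OF J smooth_on_fst[OF J c] t]
        by (rule Diff_linear_compose[OF bounded_linear_fst smooth_on_differentiable[OF c t], symmetric])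
      then obtain \<zeta> where "velocity c t = (velocity (\<lambda>t. fst (c t)) t, \<zeta>)" by (metis prod.collapse)
      then have "w0 (c t) (velocity c t) = E0 (c t) (velocity (\<lambda>t. fst (c t)) t)"
        using horizontal(1)[OF \<Phi>(1)[OF y], folded c_def] by simp
      then have "w0 (c t) (velocity c t) = 0" using E0[OF t] by simp
      then show ?thesis using l1[OF y, of "velocity \<gamma> t"] vc by (simp add: c_def)
    qed
    moreover have "unparametrized_geodesic \<Gamma> ?J (\<lambda>t. fst (c t)) \<longleftrightarrow> (\<forall>t\<in>?J. e (c t) (velocity c t) = 0)"
    proof (rule geodesic_iff[OF J c])
      show "c ` ?J \<subseteq> B \<times> I" using \<gamma>(2) \<Phi>(1) unfolding c_def by blast
      show "velocity (\<lambda>t. fst (c t)) t \<noteq> 0 \<and> E0 (c t) (velocity (\<lambda>t. fst (c t)) t) = 0" if "t \<in> ?J" for t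
        using v that E0[OF that] unfolding pc by blast
    qed
    ultimately show ?thesis unfolding pc by simp
  qed
  ultimately show ?thesis
    unfolding projective_path_geometry_def using Gamma_connection by blast
qed

end

section \<open>The product chart over the null surface\<close>

lemma (in connection_coframe) dual_vector3:
  assumes "y \<in> V" "DIM('a) = 3"
  obtains v where "w0 y v = c0" "w1 y v = c1" "e y v = c2"
proof -
  define T where "T v = (w0 y v, w1 y v, e y v)" for v
  have T: "linear T"
    unfolding T_def by (rule linearI) (simp_all add: lin[OF assms(1), THEN linear_add] lin[OF assms(1), THEN linear_scale])
  have "v = 0" if "T v = 0" for v
    using that coframe[OF assms(1)] by (auto simp: T_def prod_eq_iff)
  then have "inj T" using T linear_injective_0 by blast
  then have "dim (range T) = 3"
    using dim_image_eq[OF T, of UNIV] assms(2) by (simp add: inj_on_subset)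
  then have "range T = UNIV"
    using dim_eq_full[of "range T"] linear_subspace_image[OF T subspace_UNIV] by (simp add: span_eq_iff[THEN iffD2])
  then obtain v where v: "T v = (c0, c1, c2)" by (metis surjD)
  show thesis by (rule that[of v]) (use v in \<open>simp_all add: T_def\<close>)
qed

text \<open>By \<open>AY\<close> the map \<open>Y\<close> has rank 2 and its differential kills
  exactly the vertical directions. Two coordinates of \<open>Y\<close> and a transverse function
  give a product chart in which \<open>Y\<close> depends on the plane coordinates only. It therefore
  factors through a map \<open>\<sigma>\<close> of the plane domain, and the linear map
  \<open>P\<close> is a left inverse of \<open>\<sigma>\<close>, which makes \<open>\<sigma>\<close>
  an embedding.\<close>

lemma null_surface_chart:
  fixes V :: "(real^3) set" and Y :: "real^3 \<Rightarrow> real^4" and A :: "real^3 \<Rightarrow> real^4^4"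
  assumes con: "connection_coframe V w0 w1 p0 e k p1" and s: "s \<in> V" and Y: "smooth_on V Y"
    and A: "\<And>y. y \<in> V \<Longrightarrow> invertible (A y)"
    and AY: "\<And>y v. y \<in> V \<Longrightarrow> (A y *v Diff Y y v) $ 0 = w0 y v" "\<And>y v. y \<in> V \<Longrightarrow> (A y *v Diff Y y v) $ 1 = w1 y v"
      "\<And>y v. y \<in> V \<Longrightarrow> (A y *v Diff Y y v) $ 2 = 0" "\<And>y v. y \<in> V \<Longrightarrow> (A y *v Diff Y y v) $ 3 = 0"
    and l1: "\<And>y. y \<in> V \<Longrightarrow> l\<^sub>1 y = {v. w0 y v = 0 \<and> e y v = 0}"
    and l2: "\<And>y. y \<in> V \<Longrightarrow> l\<^sub>2 y = {v. w0 y v = 0 \<and> w1 y v = 0}"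
  obtains S' Q \<sigma> \<pi> \<Gamma> where "open S'" "s \<in> S'" "S' \<subseteq> V" "smooth_embedding_on Q \<sigma>" "\<And>y. y \<in> S' \<Longrightarrow> \<sigma> (\<pi> y) = Y y"
    "\<And>b. b \<in> Q \<Longrightarrow> \<exists>y\<in>S'. \<sigma> b = Y y \<and> range (Diff \<sigma> b) = {v. (A y *v v) $ 2 = 0 \<and> (A y *v v) $ 3 = 0}"
    "projective_path_geometry S' l\<^sub>1 l\<^sub>2 \<pi> Q \<Gamma>"
proof -
  interpret connection_coframe V w0 w1 p0 e k p1 by fact
  have A_inj: "u = v" if "y \<in> V" "A y *v u = A y *v v" for y u v
    using that A[OF that(1)] by (metis invertible_def matrix_vector_mul_assoc matrix_vector_mul_lid)
  have all4: "u = v" if "u $ 0 = v $ 0" "u $ 1 = v $ 1" "u $ 2 = v $ 2" "u $ 3 = v $ 3" for u v :: "real^4"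
  proof -
    \<comment> \<open>In the index type the numeral 4, under which \<open>forall_4\<close> lists the
      last index, is 0.\<close>
    have four: "(4::4) = 0" by simp
    show ?thesis by (simp only: vec_eq_iff forall_4 four that)
  qed
  have DY_zero: "Diff Y y v = 0" if "y \<in> V" "w0 y v = 0" "w1 y v = 0" for y v
    by (rule A_inj[OF that(1)], rule all4) (simp_all add: AY[OF that(1)] that)
  \<comment> \<open>With the coframe frozen at \<open>s\<close>, and \<open>e\<close> frozen
    likewise in \<open>\<Phi>\<close> below, the differential of \<open>\<Phi>\<close> at
    \<open>s\<close> has the components \<open>w0\<close>, \<open>w1\<close>, \<open>e\<close>; so
    it is injective.\<close>
  define P :: "real^4 \<Rightarrow> real^2" where "P v = (\<chi> i. if i = 1 then (A s *v v) $ 0 else (A s *v v) $ 1)" for v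
  have P: "linear P"
    by (rule linearI) (simp_all add: P_def vec_eq_iff matrix_vector_right_distrib matrix_vector_mult_scaleR)
  have bP: "bounded_linear P" using P linear_conv_bounded_linear by blast
  define \<Phi> where "\<Phi> y = (P (Y y), e s y)" for y
  have be: "bounded_linear (e s)" using lin(4)[OF s] linear_conv_bounded_linear by blast
  have sm\<Phi>: "smooth_on V \<Phi>"
    unfolding \<Phi>_def by (intro smooth_on_Pair W smooth_on_linear_compose[OF W bP Y] smooth_on_bounded_linear be)
  have D\<Phi>: "Diff \<Phi> y v = (P (Diff Y y v), e s v)" if "y \<in> V" for y v
    unfolding \<Phi>_def
    by (intro Diff_eq[THEN fun_cong] has_derivative_Pair bounded_linear.has_derivative[OF bP smooth_on_has_derivative[OF Y that]]
        bounded_linear_imp_has_derivative be)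
  have "inj (Diff \<Phi> s)"
  proof (rule linear_injective_0[THEN iffD2, OF smooth_on_linear_Diff[OF sm\<Phi> s]], intro allI impI)
    fix v assume "Diff \<Phi> s v = 0"
    then have "P (Diff Y s v) = 0" "e s v = 0" by (simp_all add: D\<Phi>[OF s] zero_prod_def)
    then show "v = 0"
      using coframe[OF s, of v] AY(1,2)[OF s] by (auto simp: P_def vec_eq_iff forall_2)
  qed
  then obtain U' V' g where inv: "open U'" "U' \<subseteq> V" "s \<in> U'" "open V'" "\<Phi> s \<in> V'" "homeomorphism U' V' \<Phi> g"
    "smooth_on V' g" "\<And>x. x \<in> U' \<Longrightarrow> bij (Diff \<Phi> x)"
    by (rule smooth_inverse_function_to_euclidean[OF W sm\<Phi> s]) auto
  have g: "g x \<in> U'" "\<Phi> (g x) = x" if "x \<in> V'" for x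
    using inv(6) that by (auto simp: homeomorphism_def)
  have \<Phi>: "\<Phi> y \<in> V'" "g (\<Phi> y) = y" if "y \<in> U'" for y
    using inv(6) that by (auto simp: homeomorphism_def)
  have smU: "smooth_on U' \<Phi>" by (rule smooth_on_subset[OF sm\<Phi> inv(2)])
  have D\<Phi>g: "Diff \<Phi> (g x) (Diff g x X) = X" if "x \<in> V'" for x X
    by (rule Diff_linear_chart[OF inv(4) smU inv(7) _ g(2) linear_ident that]) (use g in auto)
  have Dg\<Phi>: "Diff g (\<Phi> y) (Diff \<Phi> y v) = v" if "y \<in> U'" for y v
    by (rule Diff_linear_chart[OF inv(1,7) smU _ \<Phi>(2) linear_ident that]) (use \<Phi> in auto)
  define slope where "slope x = pullback g w0 x (axis 1 1, 0)" for x
  have gV: "g ` V' \<subseteq> V" using g inv(2) by auto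
  have "continuous_on V' slope"
    unfolding slope_def
    by (rule smooth_on_continuous_on[OF form1_on_smooth[OF form1_on_pullback[OF W forms(1) inv(4) gV inv(7)]]])
  then have "open (V' \<inter> slope -` (- {0}))"
    by (rule continuous_open_preimage[OF _ inv(4)]) auto
  \<comment> \<open>At \<open>s\<close> the first component of \<open>P\<close> composed with the
    differential of \<open>Y\<close> is \<open>w0\<close> itself, and \<open>g\<close> inverts the
    chart. Nonvanishing of the slope then persists nearby.\<close>
  moreover have "slope (\<Phi> s) = 1"
  proof -
    have "P (Diff Y s (Diff g (\<Phi> s) (axis 1 1, 0))) $ 1 = axis 1 1 $ 1"
      using D\<Phi>g[OF inv(5), of "(axis 1 1, 0)"] \<Phi>(2)[OF inv(3)] D\<Phi>[OF s] by simp
    then show ?thesis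
      using AY(1)[OF s] \<Phi>(2)[OF inv(3)] by (simp add: slope_def pullback_def P_def)
  qed
  ultimately obtain B I' where BI: "open B" "open I'" "\<Phi> s \<in> B \<times> I'" "B \<times> I' \<subseteq> V' \<inter> slope -` (- {0})"
    using open_prod_elim[of "V' \<inter> slope -` (- {0})" "\<Phi> s"] inv(5) by (metis IntI ComplI singletonD vimageI one_neq_zero)
  define z0 where "z0 = snd (\<Phi> s)"
  obtain r where r: "0 < r" "ball z0 r \<subseteq> I'" using BI(2,3) openE unfolding z0_def by (metis mem_Times_iff)
  define I where "I = ball z0 r"
  have I: "open I" "convex I" "z0 \<in> I" using r by (simp_all add: I_def)
  have box: "B \<times> I \<subseteq> V'" "\<And>x. x \<in> B \<times> I \<Longrightarrow> slope x \<noteq> 0"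
    using BI(4) r(2) by (auto simp: I_def)
  have gW: "g ` (B \<times> I) \<subseteq> V" using gV box by auto
  have smg: "smooth_on (B \<times> I) g" by (rule smooth_on_subset[OF inv(7) box(1)])
  have vertical: "w0 (g x) (Diff g x (0, 1)) = 0 \<and> w1 (g x) (Diff g x (0, 1)) = 0" if x: "x \<in> V'" for x
  proof -
    have y: "g x \<in> V" using g(1)[OF x] inv(2) by auto
    obtain v where v: "w0 (g x) v = 0" "w1 (g x) v = 0" "e (g x) v = 1"
      by (rule dual_vector3[OF y]) auto
    \<comment> \<open>The vector \<open>v\<close> is normalised by \<open>e\<close> at
      \<open>g x\<close>, whereas the last coordinate of \<open>\<Phi>\<close> uses \<open>e\<close>
      at \<open>s\<close>. The factor \<open>c\<close> compares the two; it is nonzero because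
      \<open>v\<close> is.\<close>
    define c where "c = e s v"
    have Dv: "Diff \<Phi> (g x) v = c *\<^sub>R (0, 1)"
      using DY_zero[OF y v(1,2)] by (simp add: D\<Phi>[OF y] c_def linear_0[OF P])
    then have vc: "v = c *\<^sub>R Diff g x (0, 1)"
      using Dg\<Phi>[OF g(1)[OF x], of v] g(2)[OF x] linear_scale[OF smooth_on_linear_Diff[OF inv(7) x], of c "(0, 1)"] by simp
    then have "c \<noteq> 0" using v(3) linear_0[OF lin(4)[OF y]] by auto
    then show ?thesis using v(1,2) vc lin[OF y, THEN linear_scale] by simp
  qed
  interpret g: connection_forms "B \<times> I" "pullback g w0" "pullback g w1" "pullback g p0" "pullback g e" "pullback g k" "pullback g p1"
    by (rule pullback[OF open_Times[OF BI(1) I(1)] gW smg])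
  interpret b: connection_box B I "pullback g w0" "pullback g w1" "pullback g p0" "pullback g e" "pullback g k" "pullback g p1" z0
  proof
    fix x :: "(real^2) \<times> real" and v assume x: "x \<in> B \<times> I"
      and "pullback g w0 x v = 0" "pullback g w1 x v = 0" "pullback g e x v = 0"
    then have "Diff g x v = 0"
      using coframe[of "g x" "Diff g x v"] gW by (auto simp: pullback_def)
    then show "v = 0"
      using D\<Phi>g[of x v] x box(1) linear_0[OF smooth_on_linear_Diff[OF sm\<Phi>, of "g x"]] gW by auto
  next
    fix x :: "(real^2) \<times> real" assume x: "x \<in> B \<times> I"
    show "pullback g w0 x (0, 1) = 0" "pullback g w1 x (0, 1) = 0"
      using vertical[of x] x box(1) by (auto simp: pullback_def)
    show "pullback g w0 x (axis 1 1, 0) \<noteq> 0" using box(2)[OF x] by (simp add: slope_def)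
  qed (use BI(1) I in auto)
  define S' where "S' = U' \<inter> \<Phi> -` (B \<times> I)"
  have opS: "open S'"
    unfolding S'_def
    by (rule continuous_open_preimage[OF smooth_on_continuous_on[OF smU] inv(1) open_Times[OF BI(1) I(1)]])
  have SV: "S' \<subseteq> V" using inv(2) by (auto simp: S'_def)
  have sS: "s \<in> S'" using inv(3) BI(3) I(3) by (auto simp: S'_def z0_def mem_Times_iff)
  have homS: "homeomorphism S' (B \<times> I) \<Phi> g"
  proof (rule homeomorphismI)
    show "continuous_on S' \<Phi>" by (rule smooth_on_continuous_on[OF smooth_on_subset[OF sm\<Phi> SV]])
    show "continuous_on (B \<times> I) g" by (rule smooth_on_continuous_on[OF smg])
    have gx: "g x \<in> U'" "\<Phi> (g x) = x" if "x \<in> B \<times> I" for x using g[of x] box(1) that by auto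
    then show "g ` (B \<times> I) \<subseteq> S'" unfolding S'_def by auto
    show "\<Phi> (g x) = x" if "x \<in> B \<times> I" for x using gx(2)[OF that] .
  qed (auto simp: S'_def \<Phi>(2))
  have DYg: "Diff (\<lambda>x. Y (g x)) x X = Diff Y (g x) (Diff g x X)" if "x \<in> B \<times> I" for x X
    by (rule Diff_compose[OF smooth_on_differentiable[OF smg that] smooth_on_differentiable[OF Y]]) (use that gW in auto)
  have smYg: "smooth_on (B \<times> I) (\<lambda>x. Y (g x))"
    by (rule smooth_on_compose[OF open_Times[OF BI(1) I(1)] W gW Y smg])
  have DYg0: "Diff (\<lambda>x. Y (g x)) x (0, 1) = 0" if "x \<in> B \<times> I" for x
    unfolding DYg[OF that] using vertical[of x] box(1) gW that by (intro DY_zero) auto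
  define \<sigma> where "\<sigma> b = Y (g (b, z0))" for b
  have \<sigma>_eq: "\<sigma> b = Y (g (b, z))" if "b \<in> B" "z \<in> I" for b z
    unfolding \<sigma>_def using constant_on_vertical_segment[OF I(2) smYg DYg0 that(1) I(3) that(2)] .
  have P\<sigma>: "P (\<sigma> b) = b" if "b \<in> B" for b
    using g(2)[of "(b, z0)"] box(1) that I(3) by (auto simp: \<sigma>_def \<Phi>_def)
  have inc: "smooth_on B (\<lambda>b. (b, z0))" by (intro smooth_intros BI(1))
  have sm\<sigma>: "smooth_on B \<sigma>"
    unfolding \<sigma>_def
    by (rule smooth_on_compose[OF BI(1) open_Times[OF BI(1) I(1)] _ smYg inc]) (use I(3) in auto)
  have D\<sigma>: "Diff \<sigma> b u = Diff Y (g (b, z0)) (Diff g (b, z0) (u, 0))" if b: "b \<in> B" for b u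
  proof -
    have x: "(b, z0) \<in> B \<times> I" using b I(3) by simp
    have "Diff (\<lambda>b. (b, z0)) b = (\<lambda>u. (u, 0))"
      by (rule Diff_eq) (auto intro!: derivative_eq_intros)
    then have "Diff (\<lambda>b. Y (g (b, z0))) b u = Diff (\<lambda>x. Y (g x)) (b, z0) (u, 0)"
      using Diff_compose[OF smooth_on_differentiable[OF inc b] smooth_on_differentiable[OF smYg x], of u] by simp
    then show ?thesis using DYg[OF x] by (simp add: \<sigma>_def[abs_def])
  qed
  have emb: "smooth_embedding_on B \<sigma>"
    unfolding smooth_embedding_on_def
  proof (intro conjI ballI)
    show "open B" "smooth_on B \<sigma>" by (rule BI(1), rule sm\<sigma>)
    fix b assume b: "b \<in> B"
    have "P (Diff \<sigma> b u) = u" for u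
    proof -
      have "Diff (\<lambda>b. P (\<sigma> b)) b u = P (Diff \<sigma> b u)"
        by (rule Diff_linear_compose[OF bP smooth_on_differentiable[OF sm\<sigma> b]])
      moreover have "Diff (\<lambda>b. P (\<sigma> b)) b = Diff (\<lambda>b. b) b"
        by (rule Diff_cong_open[OF BI(1) b P\<sigma>])
      ultimately show ?thesis by simp
    qed
    then show "inj (Diff \<sigma> b)" by (rule inj_on_inverseI)
  next
    have "homeomorphism B (\<sigma> ` B) \<sigma> P"
      using P\<sigma> by (intro homeomorphismI smooth_on_continuous_on[OF sm\<sigma>] linear_continuous_on bP) auto
    then show "\<exists>g. homeomorphism B (\<sigma> ` B) \<sigma> g" by blast
  qed
  show thesis
  proof (rule that[OF opS sS SV emb])
    fix y assume y: "y \<in> S'"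
    then have "\<Phi> y \<in> B \<times> I" "g (\<Phi> y) = y" using \<Phi>(2) by (auto simp: S'_def)
    then show "\<sigma> (fst (\<Phi> y)) = Y y"
      using \<sigma>_eq[of "fst (\<Phi> y)" "snd (\<Phi> y)"] by (simp add: mem_Times_iff)
  next
    fix b assume b: "b \<in> B"
    have x: "(b, z0) \<in> B \<times> I" using b I(3) by simp
    define y where "y = g (b, z0)"
    have y: "y \<in> S'" "y \<in> V" "y \<in> U'" "\<Phi> y = (b, z0)" using g[of "(b, z0)"] x box(1) inv(2) by (auto simp: S'_def y_def)
    have "range (Diff \<sigma> b) = {v. (A y *v v) $ 2 = 0 \<and> (A y *v v) $ 3 = 0}"
    proof (intro set_eqI iffI)
      fix v assume "v \<in> range (Diff \<sigma> b)"
      then show "v \<in> {v. (A y *v v) $ 2 = 0 \<and> (A y *v v) $ 3 = 0}"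
        using D\<sigma>[OF b] AY(3,4)[OF y(2)] by (auto simp: y_def)
    next
      fix v assume "v \<in> {v. (A y *v v) $ 2 = 0 \<and> (A y *v v) $ 3 = 0}"
      then have v: "(A y *v v) $ 2 = 0" "(A y *v v) $ 3 = 0" by auto
      obtain w where w: "w0 y w = (A y *v v) $ 0" "w1 y w = (A y *v v) $ 1" "e y w = 0"
        by (rule dual_vector3[OF y(2)]) auto
      have "Diff Y y w = v"
        by (rule A_inj[OF y(2)], rule all4) (simp_all add: AY[OF y(2)] w v)
      moreover obtain u \<zeta> where u: "Diff \<Phi> y w = (u, \<zeta>)" by fastforce
      moreover have "w = Diff g (b, z0) ((u, 0) + \<zeta> *\<^sub>R (0, 1))"
        using Dg\<Phi>[OF y(3), of w] by (simp add: u y(4))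
      ultimately have "v = Diff Y y (Diff g (b, z0) (u, 0)) + \<zeta> *\<^sub>R Diff Y y (Diff g (b, z0) (0, 1))"
        by (simp only: linear_add[OF smooth_on_linear_Diff[OF smg x]] linear_scale[OF smooth_on_linear_Diff[OF smg x]]
            linear_add[OF smooth_on_linear_Diff[OF Y y(2)]] linear_scale[OF smooth_on_linear_Diff[OF Y y(2)]])
      then have "v = Diff \<sigma> b u"
        using DYg0[OF x] by (simp add: DYg[OF x] D\<sigma>[OF b] y_def)
      then show "v \<in> range (Diff \<sigma> b)" by blast
    qed
    then show "\<exists>y\<in>S'. \<sigma> b = Y y \<and> range (Diff \<sigma> b) = {v. (A y *v v) $ 2 = 0 \<and> (A y *v v) $ 3 = 0}"
      using y(1) by (auto simp: \<sigma>_def y_def)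
  next
    show "projective_path_geometry S' l\<^sub>1 l\<^sub>2 (\<lambda>y. fst (\<Phi> y)) B b.\<Gamma>"
    proof (rule b.projective_path_geometry_chart[OF opS homS smooth_on_subset[OF sm\<Phi> SV] smg])
      fix y v assume y: "y \<in> S'"
      then have "y \<in> V" "y \<in> U'" using SV by (auto simp: S'_def)
      then show "v \<in> l\<^sub>1 y \<longleftrightarrow> pullback g w0 (\<Phi> y) (Diff \<Phi> y v) = 0 \<and> pullback g e (\<Phi> y) (Diff \<Phi> y v) = 0"
        "v \<in> l\<^sub>2 y \<longleftrightarrow> pullback g w0 (\<Phi> y) (Diff \<Phi> y v) = 0 \<and> pullback g w1 (\<Phi> y) (Diff \<Phi> y v) = 0"
        using l1 l2 by (simp_all add: pullback_def Dg\<Phi> \<Phi>(2))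
    qed
  qed
qed

section \<open>Adapted coframes\<close>

lemma cayley_cubic_derivative:
  "((\<lambda>t. cayley_cubic (w + t *\<^sub>R u)) has_real_derivative
     (w$2)^2 * u$2 + u$0 * w$3 * w$3 + 2 * w$0 * w$3 * u$3 - u$1 * w$2 * w$3 - w$1 * u$2 * w$3 - w$1 * w$2 * u$3) (at 0)"
  unfolding cayley_cubic_def
  by (auto intro!: derivative_eq_intros simp: power2_eq_square algebra_simps)

text \<open>The plane \<open>w 2 = w 3 = 0\<close> is the singular locus of the cubic, which makes it independent of the
  adapted coframe.\<close>

lemma cayley_cubic_singular:
  "(\<forall>u. ((\<lambda>t. cayley_cubic (w + t *\<^sub>R u)) has_real_derivative 0) (at 0)) \<longleftrightarrow> w $ 2 = 0 \<and> w $ 3 = 0"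
proof
  assume "\<forall>u. ((\<lambda>t. cayley_cubic (w + t *\<^sub>R u)) has_real_derivative 0) (at 0)"
  then have *: "(w$2)^2 * u$2 + u$0 * w$3 * w$3 + 2 * w$0 * w$3 * u$3 - u$1 * w$2 * w$3 - w$1 * u$2 * w$3 - w$1 * w$2 * u$3 = 0" for u :: "real^4"
    using DERIV_unique[OF cayley_cubic_derivative] by metis
  have "w $ 3 = 0" using *[of "axis 0 1"] by (simp add: axis_def)
  moreover have "w $ 2 = 0" using *[of "axis 2 1"] calculation by (simp add: axis_def)
  ultimately show "w $ 2 = 0 \<and> w $ 3 = 0" by simp
next
  assume "w $ 2 = 0 \<and> w $ 3 = 0"
  then show "\<forall>u. ((\<lambda>t. cayley_cubic (w + t *\<^sub>R u)) has_real_derivative 0) (at 0)"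
    using cayley_cubic_derivative[of w] by simp
qed

text \<open>The cubics of two adapted coframes differ by a nonzero factor, hence have the same
  singular directions.\<close>

lemma adapted_coframe_plane:
  assumes A: "adapted_coframe \<rho> x A" and B: "adapted_coframe \<rho> x B"
    and v: "(A *v v) $ 2 = 0" "(A *v v) $ 3 = 0"
  shows "(B *v v) $ 2 = 0 \<and> (B *v v) $ 3 = 0"
proof -
  obtain r where r: "r \<noteq> 0" "\<And>v. cayley_cubic (A *v v) = r * \<rho> x v" using A by (auto simp: adapted_coframe_def)
  obtain s where s: "s \<noteq> 0" "\<And>v. cayley_cubic (B *v v) = s * \<rho> x v" using B by (auto simp: adapted_coframe_def)
  \<comment> \<open>Every direction at the image of \<open>v\<close> under \<open>B\<close> comes
    from a tangent vector, so all directions can be tested through \<open>A\<close>.\<close>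
  obtain B' where B': "\<And>u. B *v (B' *v u) = u"
    using B unfolding adapted_coframe_def invertible_def
    by (metis matrix_vector_mul_assoc matrix_vector_mul_lid)
  have BA: "cayley_cubic (B *v v) = (s / r) * cayley_cubic (A *v v)" for v
    using r s by simp
  have "((\<lambda>t. cayley_cubic (B *v v + t *\<^sub>R u)) has_real_derivative 0) (at 0)" for u
  proof -
    have "((\<lambda>t. cayley_cubic (A *v v + t *\<^sub>R (A *v (B' *v u)))) has_real_derivative 0) (at 0)"
      using cayley_cubic_singular v by blast
    from DERIV_cmult[OF this, of "s / r"]
    have "((\<lambda>t. (s / r) * cayley_cubic (A *v (v + t *\<^sub>R (B' *v u)))) has_real_derivative 0) (at 0)"
      by (simp add: matrix_vector_right_distrib matrix_vector_mult_scaleR)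
    then show ?thesis
      unfolding BA[symmetric] by (simp add: matrix_vector_right_distrib matrix_vector_mult_scaleR B')
  qed
  then show ?thesis using cayley_cubic_singular by blast
qed

lemma cong_plane_eq:
  assumes "adapted_coframe \<rho> x A"
  shows "cong_plane \<rho> x = {v. (A *v v) $ 2 = 0 \<and> (A *v v) $ 3 = 0}"
  using assms adapted_coframe_plane[OF assms] by (auto simp: cong_plane_def)

lemma cong_plane_null:
  assumes "cayley_structure M \<rho>" "x \<in> M" "v \<in> cong_plane \<rho> x"
  shows "\<rho> x v = 0"
proof -
  obtain A where A: "invertible A" "\<And>v. \<rho> x v = cayley_cubic (A *v v)"
    using assms(1,2) unfolding cayley_structure_def by blast
  then have "adapted_coframe \<rho> x A" by (auto simp: adapted_coframe_def intro!: exI[of _ 1])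
  then show ?thesis using assms(3) A(2)[of v] by (simp add: cong_plane_eq cayley_cubic_def)
qed

lemma taut_form_form1_on:
  assumes "open U" "smooth_on U \<Psi>"
  shows "form1_on U (taut_form \<Psi> i)"
  unfolding form1_on_def taut_form_def
proof (intro conjI ballI allI)
  fix p assume "p \<in> U"
  from smooth_on_linear_Diff[OF smooth_on_fst[OF assms] this]
  show "linear (\<lambda>v. (snd (\<Psi> p) *v Diff (\<lambda>p. fst (\<Psi> p)) p v) $ i)"
    by (intro linearI) (simp_all add: linear_add linear_scale matrix_vector_right_distrib matrix_vector_mult_scaleR)
next
  fix v
  show "smooth_on U (\<lambda>p. (snd (\<Psi> p) *v Diff (\<lambda>p. fst (\<Psi> p)) p v) $ i)"
    unfolding matrix_vector_mult_def vec_lambda_beta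
    by (intro smooth_intros smooth_on_Diff_const assms)
qed

section \<open>Null surfaces\<close>

text \<open>Vectors tangent to a leaf are killed by \<open>w2\<close> and \<open>w3\<close>, which
  provides the side conditions of the equations on U; naturality of the exterior derivative
  transfers them to the leaf.\<close>

lemma (in cayley_coframe) leaf_connection_forms:
  fixes \<psi> :: "'a::euclidean_space \<Rightarrow> real^8"
  assumes \<psi>: "open W" "\<psi> ` W \<subseteq> U" "smooth_on W \<psi>"
    and leaf: "\<And>w v. w \<in> W \<Longrightarrow> w2 (\<psi> w) (Diff \<psi> w v) = 0 \<and> w3 (\<psi> w) (Diff \<psi> w v) = 0"
  shows "connection_forms W (pullback \<psi> w0) (pullback \<psi> w1) (pullback \<psi> \<psi>0) (pullback \<psi> \<eta>) (pullback \<psi> \<kappa>) (pullback \<psi> \<psi>1)"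
proof
  \<comment> \<open>The fact lists \<open>\<psi>0\<close>, \<open>\<psi>1\<close>,
    \<open>\<eta>\<close>, \<open>\<kappa>\<close>; the permutation gives the row by row order of
    the matrix.\<close>
  note fs = forms(1,2) connection_forms(1,3,4,2)
  note d = fs[THEN ext_d_pullback[OF U _ \<psi>]]
  show "open W" by fact
  show "form1_on W (pullback \<psi> w0)" "form1_on W (pullback \<psi> w1)" "form1_on W (pullback \<psi> \<psi>0)"
    "form1_on W (pullback \<psi> \<eta>)" "form1_on W (pullback \<psi> \<kappa>)" "form1_on W (pullback \<psi> \<psi>1)"
    by (rule fs[THEN form1_on_pullback[OF U _ \<psi>]])+
  fix x X Y assume x: "x \<in> W" and X: "pullback \<psi> w0 x X = 0" "pullback \<psi> w1 x X = 0"
  have p: "\<psi> x \<in> U" using x \<psi>(2) by auto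
  note * = p X[unfolded pullback_def] leaf[OF x, THEN conjunct1] leaf[OF x, THEN conjunct2]
    leaf[OF x, THEN conjunct1] leaf[OF x, THEN conjunct2]
  show "ext_d (pullback \<psi> w0) x X Y = - pullback \<psi> \<psi>0 x X * pullback \<psi> w0 x Y - pullback \<psi> \<eta> x X * pullback \<psi> w1 x Y"
    unfolding d(1)[OF x] connection_w0[OF *] by (simp add: pullback_def)
  show "ext_d (pullback \<psi> w1) x X Y = - pullback \<psi> \<kappa> x X * pullback \<psi> w0 x Y - pullback \<psi> \<psi>1 x X * pullback \<psi> w1 x Y"
    unfolding d(2)[OF x] connection_w1[OF *] by (simp add: pullback_def)
  show "ext_d (pullback \<psi> \<psi>0) x X Y = - wedge (pullback \<psi> \<eta>) (pullback \<psi> \<kappa>) x X Y"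
    unfolding d(3)[OF x] curvature_psi0[OF *] by (simp add: wedge_def pullback_def)
  show "ext_d (pullback \<psi> \<eta>) x X Y = - wedge (pullback \<psi> \<psi>0) (pullback \<psi> \<eta>) x X Y - wedge (pullback \<psi> \<eta>) (pullback \<psi> \<psi>1) x X Y"
    unfolding d(4)[OF x] curvature_eta[OF *] by (simp add: wedge_def pullback_def)
  show "ext_d (pullback \<psi> \<kappa>) x X Y = - wedge (pullback \<psi> \<kappa>) (pullback \<psi> \<psi>0) x X Y - wedge (pullback \<psi> \<psi>1) (pullback \<psi> \<kappa>) x X Y"
    unfolding d(5)[OF x] curvature_kappa[OF *] by (simp add: wedge_def pullback_def)
  show "ext_d (pullback \<psi> \<psi>1) x X Y = - wedge (pullback \<psi> \<kappa>) (pullback \<psi> \<eta>) x X Y"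
    unfolding d(6)[OF x] curvature_psi1[OF *] by (simp add: wedge_def pullback_def)
  show "pullback \<psi> \<kappa> x X = 0" using X by (simp add: pullback_def \<kappa>_def)
qed

text \<open>By \<open>leaf_space_kernels\<close> every point of the fibre contributes the same
  vectors, so the union in \<open>push_distribution\<close> can be read off at the single point
  \<open>w\<close>.\<close>

lemma push_distribution_iff:
  fixes q :: "real^'n \<Rightarrow> 'b::euclidean_space"
  assumes con: "connection_forms W w0 w1 p0 e k p1" and leaf: "leaf_space W (annihilator {w0, w1, e}) q S"
    and I: "I \<subseteq> {w0, w1, e}" and w: "w \<in> W"
  shows "Diff q w u \<in> push_distribution W q (annihilator I) (q w) \<longleftrightarrow> u \<in> annihilator I w"
proof
  assume "Diff q w u \<in> push_distribution W q (annihilator I) (q w)"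
  then obtain w' u' where w': "w' \<in> W" "q w = q w'" "u' \<in> annihilator I w'" "Diff q w u = Diff q w' u'"
    by (auto simp: push_distribution_def)
  show "u \<in> annihilator I w"
    using leaf_space_kernels[OF con leaf w w'(1,2,4)] w'(3) I by (auto simp: annihilator_def)
qed (use w in \<open>auto simp: push_distribution_def\<close>)

text \<open>The differential of a section is a right inverse of that of \<open>q\<close>. A vector
  killed by all three pulled back forms is sent by it into the kernel of the differential of
  \<open>q\<close>, hence is zero.\<close>

lemma connection_coframe_section:
  fixes q :: "real^'n \<Rightarrow> 'b::euclidean_space"
  assumes con: "connection_forms W w0 w1 p0 e k p1" and leaf: "leaf_space W (annihilator {w0, w1, e}) q S"
    and V: "open V" "smooth_on V t" "t ` V \<subseteq> W" "\<And>y. y \<in> V \<Longrightarrow> q (t y) = y"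
  shows "connection_coframe V (pullback t w0) (pullback t w1) (pullback t p0) (pullback t e) (pullback t k) (pullback t p1)"
    and "I \<subseteq> {w0, w1, e} \<Longrightarrow> y \<in> V \<Longrightarrow> push_distribution W q (annihilator I) y = annihilator (pullback t ` I) y"
proof -
  interpret connection_forms W w0 w1 p0 e k p1 by fact
  note leafD = leaf_spaceD[OF leaf]
  have Dq: "Diff q (t y) (Diff t y v) = v" if "y \<in> V" for y v
    by (rule Diff_linear_chart[OF V(1) leafD(3) V(2-4) linear_ident that])
  show "connection_coframe V (pullback t w0) (pullback t w1) (pullback t p0) (pullback t e) (pullback t k) (pullback t p1)"
  proof (intro connection_coframe.intro pullback[OF V(1,3,2)] connection_coframe_axioms.intro)
    fix y v assume y: "y \<in> V" and "pullback t w0 y v = 0" "pullback t w1 y v = 0" "pullback t e y v = 0"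
    then have "Diff t y v \<in> annihilator {w0, w1, e} (t y)" by (simp add: annihilator_def pullback_def)
    moreover have "t y \<in> W" using y V(3) by auto
    ultimately show "v = 0" using leafD(6) Dq[OF y, of v] by metis
  qed
  assume I: "I \<subseteq> {w0, w1, e}" and y: "y \<in> V"
  have ty: "t y \<in> W" using y V(3) by auto
  have "v \<in> push_distribution W q (annihilator I) y \<longleftrightarrow> v \<in> annihilator (pullback t ` I) y" for v
    using push_distribution_iff[OF con leaf I ty, of "Diff t y v"] Dq[OF y, of v] V(4)[OF y]
    by (simp add: annihilator_def pullback_def)
  then show "push_distribution W q (annihilator I) y = annihilator (pullback t ` I) y" by blast
qed

theorem proposition5p5:
  fixes M :: "(real^4) set" and \<rho> :: "real^4 \<Rightarrow> real^4 \<Rightarrow> real"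
    and U :: "(real^8) set" and \<Psi> :: "real^8 \<Rightarrow> (real^4) \<times> (real^4^4)"
    and \<theta>\<^sub>1 \<theta>\<^sub>2 \<phi>\<^sub>0 \<phi>\<^sub>1 :: "(real^8) form1"
    and a :: "nat \<Rightarrow> real^8 \<Rightarrow> real" and c :: real
  assumes "cayley_structure M \<rho>" and "half_flat M \<rho>"
    and "bundle_chart M \<rho> U \<Psi>"
    and "c = 2 \<or> c = 3/2"
    and "structure_coframe U (taut_form \<Psi>) c \<theta>\<^sub>1 \<theta>\<^sub>2 \<phi>\<^sub>0 \<phi>\<^sub>1 a"
    and "\<forall>p\<in>U. a 6 p = 0"
  shows "pfaffian_integrable U {taut_form \<Psi> 2, taut_form \<Psi> 3} \<and>
    (\<forall>x\<in>M. \<forall>v\<in>cong_plane \<rho> x. \<rho> x v = 0) \<and>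
    (\<forall>(W :: (real^6) set) \<psi> (S :: (real^3) set) q l\<^sub>1 l\<^sub>2.
       cong_leaf U (taut_form \<Psi>) W \<psi> \<and>
       leaf_space W (annihilator (pullback \<psi> ` {taut_form \<Psi> 0, taut_form \<Psi> 1, \<theta>\<^sub>2})) q S \<and>
       l\<^sub>1 = push_distribution W q (annihilator (pullback \<psi> ` {taut_form \<Psi> 0, \<theta>\<^sub>2})) \<and>
       l\<^sub>2 = push_distribution W q (annihilator (pullback \<psi> ` {taut_form \<Psi> 0, taut_form \<Psi> 1})) \<longrightarrow>
       path_geometry S l\<^sub>1 l\<^sub>2 \<and>
       (\<forall>s\<in>S. \<exists>S' Q \<sigma> \<pi> \<Gamma>. open S' \<and> s \<in> S' \<and> S' \<subseteq> S \<and>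
          cong_surface M \<rho> Q \<sigma> \<and>
          (\<forall>w\<in>W. q w \<in> S' \<longrightarrow> \<sigma> (\<pi> (q w)) = fst (\<Psi> (\<psi> w))) \<and>
          projective_path_geometry S' l\<^sub>1 l\<^sub>2 \<pi> Q \<Gamma>))"
proof (intro conjI)
  have \<Psi>: "open U" "smooth_on U \<Psi>"
    using assms(3) by (simp_all add: bundle_chart_def smooth_embedding_on_def)
  have adapted: "fst (\<Psi> p) \<in> M" "adapted_coframe \<rho> (fst (\<Psi> p)) (snd (\<Psi> p))" if "p \<in> U" for p
  proof -
    have "\<Psi> p \<in> adapted_bundle M \<rho>"
      using assms(3) that openin_imp_subset unfolding bundle_chart_def by fastforce
    then show "fst (\<Psi> p) \<in> M" "adapted_coframe \<rho> (fst (\<Psi> p)) (snd (\<Psi> p))"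
      by (auto simp: adapted_bundle_def)
  qed
  note sc = assms(5)[unfolded structure_coframe_def]
  interpret c: cayley_coframe U "taut_form \<Psi> 0" "taut_form \<Psi> 1" "taut_form \<Psi> 2" "taut_form \<Psi> 3"
    \<theta>\<^sub>1 \<theta>\<^sub>2 \<phi>\<^sub>0 \<phi>\<^sub>1 "a 1" "a 2" "a 3" "a 4" "a 5"
  proof (standard, goal_cases)
    case 1 show ?case by (rule \<Psi>(1))
  next
    case (15 p) then show ?case using sc by blast
  next
    case (16 p X Y) then show ?case using sc by blast
  next
    case (17 p X Y) then show ?case using sc by blast
  next
    case (18 p X Y) then show ?case using sc assms(6) by simp
  next
    case (19 p X Y) then show ?case using sc assms(6) by simp
  qed (use sc taut_form_form1_on[OF \<Psi>] in auto)
  show "pfaffian_integrable U {taut_form \<Psi> 2, taut_form \<Psi> 3}"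
    unfolding pfaffian_integrable_def by (auto simp: annihilator_def c.d_w2 c.d_w3 wedge_def)
  show "\<forall>x\<in>M. \<forall>v\<in>cong_plane \<rho> x. \<rho> x v = 0"
    using cong_plane_null[OF assms(1)] by blast
  show "\<forall>(W :: (real^6) set) \<psi> (S :: (real^3) set) q l\<^sub>1 l\<^sub>2.
       cong_leaf U (taut_form \<Psi>) W \<psi> \<and>
       leaf_space W (annihilator (pullback \<psi> ` {taut_form \<Psi> 0, taut_form \<Psi> 1, \<theta>\<^sub>2})) q S \<and>
       l\<^sub>1 = push_distribution W q (annihilator (pullback \<psi> ` {taut_form \<Psi> 0, \<theta>\<^sub>2})) \<and>
       l\<^sub>2 = push_distribution W q (annihilator (pullback \<psi> ` {taut_form \<Psi> 0, taut_form \<Psi> 1})) \<longrightarrow>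
       path_geometry S l\<^sub>1 l\<^sub>2 \<and>
       (\<forall>s\<in>S. \<exists>S' Q \<sigma> \<pi> \<Gamma>. open S' \<and> s \<in> S' \<and> S' \<subseteq> S \<and>
          cong_surface M \<rho> Q \<sigma> \<and>
          (\<forall>w\<in>W. q w \<in> S' \<longrightarrow> \<sigma> (\<pi> (q w)) = fst (\<Psi> (\<psi> w))) \<and>
          projective_path_geometry S' l\<^sub>1 l\<^sub>2 \<pi> Q \<Gamma>)"
  proof (intro allI impI, elim conjE)
    fix W :: "(real^6) set" and \<psi> and S :: "(real^3) set" and q l\<^sub>1 l\<^sub>2
    assume cl: "cong_leaf U (taut_form \<Psi>) W \<psi>"
      and ls: "leaf_space W (annihilator (pullback \<psi> ` {taut_form \<Psi> 0, taut_form \<Psi> 1, \<theta>\<^sub>2})) q S"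
      and l1: "l\<^sub>1 = push_distribution W q (annihilator (pullback \<psi> ` {taut_form \<Psi> 0, \<theta>\<^sub>2}))"
      and l2: "l\<^sub>2 = push_distribution W q (annihilator (pullback \<psi> ` {taut_form \<Psi> 0, taut_form \<Psi> 1}))"
    let ?w0 = "pullback \<psi> (taut_form \<Psi> 0)" and ?w1 = "pullback \<psi> (taut_form \<Psi> 1)" and ?e = "pullback \<psi> c.\<eta>"
    have \<psi>: "open W" "\<psi> ` W \<subseteq> U" "smooth_on W \<psi>"
      using cl by (simp_all add: cong_leaf_def smooth_embedding_on_def)
    have leaf: "taut_form \<Psi> 2 (\<psi> w) (Diff \<psi> w v) = 0 \<and> taut_form \<Psi> 3 (\<psi> w) (Diff \<psi> w v) = 0" if "w \<in> W" for w v
    proof -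
      have "Diff \<psi> w v \<in> annihilator {taut_form \<Psi> 2, taut_form \<Psi> 3} (\<psi> w)"
        using cl that unfolding cong_leaf_def by blast
      then show ?thesis by (simp add: annihilator_def)
    qed
    have "connection_forms W ?w0 ?w1 (pullback \<psi> c.\<psi>0) ?e (pullback \<psi> c.\<kappa>) (pullback \<psi> c.\<psi>1)"
      by (rule c.leaf_connection_forms[OF \<psi> leaf])
    note con = this
    \<comment> \<open>The form \<open>\<eta>\<close> differs from \<theta>2 by a multiple of the
      first tautological form, which belongs to both systems. So the given distributions are those
      of the connection forms.\<close>
    have ann: "annihilator (pullback \<psi> ` {taut_form \<Psi> 0, taut_form \<Psi> 1, \<theta>\<^sub>2}) = annihilator {?w0, ?w1, ?e}"
      "annihilator (pullback \<psi> ` {taut_form \<Psi> 0, \<theta>\<^sub>2}) = annihilator {?w0, ?e}"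
      by (auto simp: fun_eq_iff annihilator_def pullback_def c.\<eta>_def)
    note lsp = ls[unfolded ann]
    note lspD = leaf_spaceD[OF lsp]
    have l1': "l\<^sub>1 = push_distribution W q (annihilator {?w0, ?e})" by (simp only: l1 ann)
    have l2': "l\<^sub>2 = push_distribution W q (annihilator {?w0, ?w1})" by (simp only: l2 image_insert image_empty)
    \<comment> \<open>The base point in M. Applying the coframe to its differential returns the four
      tautological forms, all of which vanish on the leaves of the three-dimensional distribution;
      so it will descend to S.\<close>
    define h where "h w = fst (\<Psi> (\<psi> w))" for w
    have sm_fst: "smooth_on U (\<lambda>p. fst (\<Psi> p))" by (rule smooth_on_fst[OF \<Psi>])
    have smh: "smooth_on W h"
      unfolding h_def by (rule smooth_on_compose[OF \<psi>(1) \<Psi>(1) \<psi>(2) sm_fst \<psi>(3)])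
    have Dh: "(snd (\<Psi> (\<psi> w)) *v Diff h w v) $ i = taut_form \<Psi> i (\<psi> w) (Diff \<psi> w v)" if w: "w \<in> W" for w v i
    proof -
      have "Diff h w v = Diff (\<lambda>p. fst (\<Psi> p)) (\<psi> w) (Diff \<psi> w v)"
        unfolding h_def
        by (rule Diff_compose[OF smooth_on_differentiable[OF \<psi>(3) w] smooth_on_differentiable[OF sm_fst]]) (use w \<psi>(2) in auto)
      then show ?thesis by (simp add: taut_form_def)
    qed
    have h_vertical: "Diff h w v = 0" if w: "w \<in> W" and v: "v \<in> annihilator {?w0, ?w1, ?e} w" for w v
    proof -
      have p: "\<psi> w \<in> U" using w \<psi>(2) by auto
      have four: "(4::4) = 0" by simp
      have "(snd (\<Psi> (\<psi> w)) *v Diff h w v) $ i = 0" for i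
      proof -
        have "\<forall>i. (snd (\<Psi> (\<psi> w)) *v Diff h w v) $ i = 0"
          unfolding forall_4 four Dh[OF w] using v leaf[OF w, of v] by (simp add: annihilator_def pullback_def)
        then show ?thesis ..
      qed
      then have zero: "snd (\<Psi> (\<psi> w)) *v Diff h w v = 0" by (simp add: vec_eq_iff)
      have "invertible (snd (\<Psi> (\<psi> w)))" using adapted(2)[OF p] by (simp add: adapted_coframe_def)
      then obtain C where C: "C ** snd (\<Psi> (\<psi> w)) = mat 1" unfolding invertible_def by blast
      have "Diff h w v = C *v (snd (\<Psi> (\<psi> w)) *v Diff h w v)"
        by (simp only: matrix_vector_mul_assoc C matrix_vector_mul_lid)
      then show ?thesis unfolding zero by simp
    qed
    have sect: "\<exists>V t. open V \<and> s \<in> V \<and> V \<subseteq> S \<and> smooth_on V t \<and> t ` V \<subseteq> W \<and> (\<forall>y\<in>V. q (t y) = y)" if "s \<in> S" for s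
      using leaf_space_section[OF lsp that] by metis
    have l12: "l\<^sub>1 y = {v. pullback t ?w0 y v = 0 \<and> pullback t ?e y v = 0}"
        "l\<^sub>2 y = {v. pullback t ?w0 y v = 0 \<and> pullback t ?w1 y v = 0}"
      if "open V" "smooth_on V t" "t ` V \<subseteq> W" "\<And>y. y \<in> V \<Longrightarrow> q (t y) = y" "y \<in> V" for V t y
      using connection_coframe_section(2)[OF con lsp that(1-4) _ that(5), of "{?w0, ?e}"]
        connection_coframe_section(2)[OF con lsp that(1-4) _ that(5), of "{?w0, ?w1}"]
      by (simp_all add: l1' l2' annihilator_def)
    show "path_geometry S l\<^sub>1 l\<^sub>2 \<and>
       (\<forall>s\<in>S. \<exists>S' Q \<sigma> \<pi> \<Gamma>. open S' \<and> s \<in> S' \<and> S' \<subseteq> S \<and>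
          cong_surface M \<rho> Q \<sigma> \<and>
          (\<forall>w\<in>W. q w \<in> S' \<longrightarrow> \<sigma> (\<pi> (q w)) = fst (\<Psi> (\<psi> w))) \<and>
          projective_path_geometry S' l\<^sub>1 l\<^sub>2 \<pi> Q \<Gamma>)"
    proof (unfold path_geometry_def, intro conjI ballI)
      show "open S" by (rule lspD(2))
    next
      fix s assume "s \<in> S"
      then obtain V t where V: "open V" "s \<in> V" "V \<subseteq> S" "smooth_on V t" "t ` V \<subseteq> W" "\<And>y. y \<in> V \<Longrightarrow> q (t y) = y"
        using sect by metis
      note cc = connection_coframe_section(1)[OF con lsp V(1,4,5,6)]
      show "\<exists>V X\<^sub>1 X\<^sub>2. open V \<and> s \<in> V \<and> V \<subseteq> S \<and> smooth_on V X\<^sub>1 \<and> smooth_on V X\<^sub>2 \<and>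
        (\<forall>y\<in>V. l\<^sub>1 y = span {X\<^sub>1 y} \<and> l\<^sub>2 y = span {X\<^sub>2 y} \<and> span {X\<^sub>1 y, X\<^sub>2 y, lie_bracket X\<^sub>1 X\<^sub>2 y} = UNIV)"
      proof (rule connection_coframe_path_geometry[OF cc l12[OF V(1,4,5,6)]])
        fix X\<^sub>1 X\<^sub>2
        assume X: "smooth_on V X\<^sub>1" "smooth_on V X\<^sub>2"
          "\<And>y. y \<in> V \<Longrightarrow> l\<^sub>1 y = span {X\<^sub>1 y} \<and> l\<^sub>2 y = span {X\<^sub>2 y} \<and>
            span {X\<^sub>1 y, X\<^sub>2 y, lie_bracket X\<^sub>1 X\<^sub>2 y} = UNIV"
        show ?thesis
          by (rule exI[of _ V], rule exI[of _ X\<^sub>1], rule exI[of _ X\<^sub>2]) (intro conjI ballI V(1-3) X)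
      qed
    next
      fix s assume "s \<in> S"
      then obtain V t where V: "open V" "s \<in> V" "V \<subseteq> S" "smooth_on V t" "t ` V \<subseteq> W" "\<And>y. y \<in> V \<Longrightarrow> q (t y) = y"
        using sect by metis
      note cc = connection_coframe_section(1)[OF con lsp V(1,4,5,6)]
      have tW: "t y \<in> W" "\<psi> (t y) \<in> U" if "y \<in> V" for y using that V(5) \<psi>(2) by auto
      define A where "A y = snd (\<Psi> (\<psi> (t y)))" for y
      have smY: "smooth_on V (\<lambda>y. h (t y))" by (rule smooth_on_compose[OF V(1) \<psi>(1) V(5) smh V(4)])
      have A: "invertible (A y)" if "y \<in> V" for y
        using adapted(2)[OF tW(2)[OF that]] by (simp add: A_def adapted_coframe_def)
      have AY: "(A y *v Diff (\<lambda>y. h (t y)) y v) $ i = taut_form \<Psi> i (\<psi> (t y)) (Diff \<psi> (t y) (Diff t y v))" if y: "y \<in> V" for y v i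
        unfolding A_def Diff_compose[OF smooth_on_differentiable[OF V(4) y] smooth_on_differentiable[OF smh tW(1)[OF y]]]
        by (rule Dh[OF tW(1)[OF y]])
      obtain S' Q \<sigma> \<pi> \<Gamma> where S': "open S'" "s \<in> S'" "S' \<subseteq> V" "smooth_embedding_on Q \<sigma>"
        "\<And>y. y \<in> S' \<Longrightarrow> \<sigma> (\<pi> y) = h (t y)"
        "\<And>b. b \<in> Q \<Longrightarrow> \<exists>y\<in>S'. \<sigma> b = h (t y) \<and> range (Diff \<sigma> b) = {v. (A y *v v) $ 2 = 0 \<and> (A y *v v) $ 3 = 0}"
        "projective_path_geometry S' l\<^sub>1 l\<^sub>2 \<pi> Q \<Gamma>"
      proof (rule null_surface_chart[OF cc V(2) smY A, where l\<^sub>1 = l\<^sub>1 and l\<^sub>2 = l\<^sub>2])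
        show "l\<^sub>1 y = {v. pullback t ?w0 y v = 0 \<and> pullback t ?e y v = 0}"
          "l\<^sub>2 y = {v. pullback t ?w0 y v = 0 \<and> pullback t ?w1 y v = 0}" if "y \<in> V" for y
          by (rule l12[OF V(1,4,5,6) that], assumption)+
        show "(A y *v Diff (\<lambda>y. h (t y)) y v) $ 0 = pullback t ?w0 y v"
          "(A y *v Diff (\<lambda>y. h (t y)) y v) $ 1 = pullback t ?w1 y v"
          "(A y *v Diff (\<lambda>y. h (t y)) y v) $ 2 = 0" "(A y *v Diff (\<lambda>y. h (t y)) y v) $ 3 = 0" if "y \<in> V" for y v
          unfolding AY[OF that] using leaf[OF tW(1)[OF that]] by (simp_all add: pullback_def)
      qed (assumption | (rule that; assumption))+
      have "cong_surface M \<rho> Q \<sigma>"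
        unfolding cong_surface_def
      proof (intro conjI ballI)
        show "smooth_embedding_on Q \<sigma>" by (rule S'(4))
        have "\<sigma> b \<in> M \<and> range (Diff \<sigma> b) = cong_plane \<rho> (\<sigma> b)" if b: "b \<in> Q" for b
        proof -
          obtain y where y: "y \<in> S'" "\<sigma> b = h (t y)"
            "range (Diff \<sigma> b) = {v. (A y *v v) $ 2 = 0 \<and> (A y *v v) $ 3 = 0}"
            using S'(6)[OF b] by blast
          have "\<psi> (t y) \<in> U" using y(1) S'(3) tW by auto
          from adapted[OF this] show ?thesis
            using cong_plane_eq y(2,3) by (simp add: h_def A_def)
        qed
        then show "\<sigma> ` Q \<subseteq> M" "\<And>b. b \<in> Q \<Longrightarrow> range (Diff \<sigma> b) = cong_plane \<rho> (\<sigma> b)" by auto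
      qed
      moreover have "\<sigma> (\<pi> (q w)) = fst (\<Psi> (\<psi> w))" if w: "w \<in> W" "q w \<in> S'" for w
      proof -
        have y: "q w \<in> V" using w(2) S'(3) by auto
        \<comment> \<open>The points \<open>t (q w)\<close> and \<open>w\<close> lie in the same
          fibre of \<open>q\<close>, on which the base point is constant; so a formula obtained on
          the section holds on the whole leaf.\<close>
        have "h (t (q w)) = h w"
          by (rule leaf_space_constant_of_Diff[OF lsp tW(1)[OF y] w(1) V(6)[OF y] smh h_vertical])
        then show ?thesis using S'(5)[OF w(2)] by (simp add: h_def)
      qed
      moreover have "S' \<subseteq> S" using S'(3) V(3) by auto
      ultimately show "\<exists>S' Q \<sigma> \<pi> \<Gamma>. open S' \<and> s \<in> S' \<and> S' \<subseteq> S \<and> cong_surface M \<rho> Q \<sigma> \<and>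
          (\<forall>w\<in>W. q w \<in> S' \<longrightarrow> \<sigma> (\<pi> (q w)) = fst (\<Psi> (\<psi> w))) \<and>
          projective_path_geometry S' l\<^sub>1 l\<^sub>2 \<pi> Q \<Gamma>"
        using S'(1,2,7) by blast
    qed
  qed
qed

end
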